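(* There is a Tauberian operator $T : L_1(0,1) \to L_1(0,1)$ that is injective, is not surjective, and has dense range.
   Context: "Operator" means bounded linear operator between Banach spaces. $L_1(0,1)$ is the usual Lebesgue space of the interval $(0,1)$ with Lebesgue measure. An operator $T$ from a Banach space $X$ into a Banach space $Y$ is called Tauberian if $(T^{**})^{-1}(Y) = X$, where $T^{**} : X^{**} \to Y^{**}$ is the second adjoint and $X$, $Y$ are identified with their canonical images in $X^{**}$, $Y^{**}$; i.e. whenever $x^{**} \in X^{**}$ and $T^{**}x^{**} \in Y$, then $x^{**} \in X$. *)

theory Defs
  imports "HOL-Analysis.Analysis"
begin

section \<open>The Banach space \<open>L\<^sub>1(0,1)\<close>\<close>

abbreviation leb01 :: "real measure"
  where "leb01 \<equiv> lebesgue_on {0<..<1}"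

definition L1_rel :: "(real \<Rightarrow> real) \<Rightarrow> (real \<Rightarrow> real) \<Rightarrow> bool"
  where "L1_rel f g \<longleftrightarrow> integrable leb01 f \<and> integrable leb01 g \<and> (AE x in leb01. f x = g x)"

text \<open>The scalar field is \<open>\<real>\<close>. The relation is a partial equivalence whose domain consists of the
  integrable functions, so the elements of the quotient are classes of integrable functions modulo
  equality almost everywhere. Values outside \<open>(0,1)\<close> play no role.\<close>

quotient_type L1 = "real \<Rightarrow> real" / partial: L1_rel
proof (rule part_equivpI)
  show "\<exists>f. L1_rel f f"
    by (rule exI[of _ "\<lambda>_. 0"]) (simp add: L1_rel_def)
  show "symp L1_rel"
    by (rule sympI) (auto simp: L1_rel_def elim: eventually_mono)
  show "transp L1_rel"
    by (rule transpI) (auto simp: L1_rel_def elim: eventually_elim2)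
qed

lemma L1_rel_norm_eq_0:
  fixes f :: "real \<Rightarrow> real"
  assumes "integrable leb01 f"
  shows "(LINT x|leb01. \<bar>f x\<bar>) = 0 \<longleftrightarrow> (AE x in leb01. f x = 0)"
  using integral_nonneg_eq_0_iff_AE[of leb01 "\<lambda>x. \<bar>f x\<bar>"] assms by simp

instantiation L1 :: real_normed_vector
begin

lift_definition norm_L1 :: "L1 \<Rightarrow> real" is "\<lambda>f. LINT x|leb01. \<bar>f x\<bar>"
  unfolding L1_rel_def by (intro integral_cong_AE) auto

lift_definition zero_L1 :: L1 is "\<lambda>_. 0"
  by (simp add: L1_rel_def)

lift_definition plus_L1 :: "L1 \<Rightarrow> L1 \<Rightarrow> L1" is "\<lambda>f g x. f x + g x"
  unfolding L1_rel_def by (auto elim: eventually_elim2)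

lift_definition minus_L1 :: "L1 \<Rightarrow> L1 \<Rightarrow> L1" is "\<lambda>f g x. f x - g x"
  unfolding L1_rel_def by (auto elim: eventually_elim2)

lift_definition uminus_L1 :: "L1 \<Rightarrow> L1" is "\<lambda>f x. - f x"
  unfolding L1_rel_def by auto

lift_definition scaleR_L1 :: "real \<Rightarrow> L1 \<Rightarrow> L1" is "\<lambda>c f x. c * f x"
  unfolding L1_rel_def by (auto elim: eventually_mono)

definition dist_L1 :: "L1 \<Rightarrow> L1 \<Rightarrow> real"
  where "dist_L1 a b = norm (a - b)"

definition [code del]:
  "(uniformity :: (L1 \<times> L1) filter) = (INF e\<in>{0 <..}. principal {(x, y). dist x y < e})"

definition open_L1 :: "L1 set \<Rightarrow> bool"
  where [code del]: "open_L1 S = (\<forall>x\<in>S. \<forall>\<^sub>F (x', y) in uniformity. x' = x \<longrightarrow> y \<in> S)"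

definition sgn_L1 :: "L1 \<Rightarrow> L1"
  where "sgn_L1 x = scaleR (inverse (norm x)) x"

instance
proof
  fix x y z :: L1 and a b :: real and U :: "L1 set"
  show "x + y + z = x + (y + z)" "x + y = y + x" "0 + x = x" "- x + x = 0" "x - y = x + - y"
    by (transfer, simp add: L1_rel_def algebra_simps)+
  show "a *\<^sub>R (x + y) = a *\<^sub>R x + a *\<^sub>R y" "(a + b) *\<^sub>R x = a *\<^sub>R x + b *\<^sub>R x"
    "a *\<^sub>R b *\<^sub>R x = (a * b) *\<^sub>R x" "1 *\<^sub>R x = x"
    by (transfer, simp add: L1_rel_def algebra_simps)+
  show "dist x y = norm (x - y)" "sgn x = scaleR (inverse (norm x)) x"
    "uniformity = (INF e\<in>{0 <..}. principal {(x :: L1, y). dist x y < e})"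
    "open U \<longleftrightarrow> (\<forall>x\<in>U. \<forall>\<^sub>F (x', y) in uniformity. x' = x \<longrightarrow> y \<in> U)"
    by (simp_all add: dist_L1_def sgn_L1_def uniformity_L1_def open_L1_def)
  show "norm x = 0 \<longleftrightarrow> x = 0"
    by transfer (simp add: L1_rel_def L1_rel_norm_eq_0)
  show "norm (x + y) \<le> norm x + norm y"
  proof transfer
    fix f g assume "L1_rel f f" "L1_rel g g"
    then have [simp]: "integrable leb01 f" "integrable leb01 g"
      by (simp_all add: L1_rel_def)
    have "(LINT x|leb01. \<bar>f x + g x\<bar>) \<le> (LINT x|leb01. \<bar>f x\<bar> + \<bar>g x\<bar>)"
      by (intro integral_mono) auto
    then show "(LINT x|leb01. \<bar>f x + g x\<bar>) \<le> (LINT x|leb01. \<bar>f x\<bar>) + (LINT x|leb01. \<bar>g x\<bar>)"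
      by simp
  qed
  show "norm (a *\<^sub>R x) = \<bar>a\<bar> * norm x"
    by transfer (simp add: abs_mult)
qed

end

lemma L1_complete_aux:
  fixes s :: "nat \<Rightarrow> real \<Rightarrow> real"
  assumes int [measurable]: "\<And>n. integrable leb01 (s n)"
    and cauchy: "\<And>e. e > 0 \<Longrightarrow> \<exists>N. \<forall>i\<ge>N. \<forall>j\<ge>N. (LINT x|leb01. \<bar>s i x - s j x\<bar>) < e"
  shows "\<exists>f. integrable leb01 f \<and>
    (\<forall>e>0. \<exists>N. \<forall>n\<ge>N. (LINT x|leb01. \<bar>s n x - f x\<bar>) < e)"
proof -
  obtain r where r: "strict_mono r" and ae: "AE x in leb01. Cauchy (\<lambda>i. s (r i) x)"
    using cauchy_L1_AE_cauchy_subseq[of leb01 s] int cauchy by (auto simp: real_norm_def)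
  define f where "f x = lim (\<lambda>i. s (r i) x)" for x
  have meas_s [measurable]: "s n \<in> borel_measurable leb01" for n
    using int by (rule borel_measurable_integrable)
  have meas_f [measurable]: "f \<in> borel_measurable leb01"
    unfolding f_def by measurable
  have lim: "AE x in leb01. (\<lambda>i. s (r i) x) \<longlonglongrightarrow> f x"
    using ae by eventually_elim (simp add: f_def Cauchy_convergent_iff convergent_LIMSEQ_iff)
  have fatou: "(\<integral>\<^sup>+x. ennreal \<bar>s n x - f x\<bar> \<partial>leb01) \<le> ennreal e"
    if n: "n \<ge> N" and N: "\<And>i j. i \<ge> N \<Longrightarrow> j \<ge> N \<Longrightarrow> (LINT x|leb01. \<bar>s i x - s j x\<bar>) < e" for n N e
  proof -
    have "(\<integral>\<^sup>+x. ennreal \<bar>s n x - f x\<bar> \<partial>leb01)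
        = (\<integral>\<^sup>+x. liminf (\<lambda>i. ennreal \<bar>s n x - s (r i) x\<bar>) \<partial>leb01)"
    proof (rule nn_integral_cong_AE, use lim in eventually_elim)
      fix x assume "(\<lambda>i. s (r i) x) \<longlonglongrightarrow> f x"
      then have "(\<lambda>i. ennreal \<bar>s n x - s (r i) x\<bar>) \<longlonglongrightarrow> ennreal \<bar>s n x - f x\<bar>"
        by (intro tendsto_intros)
      then show "ennreal \<bar>s n x - f x\<bar> = liminf (\<lambda>i. ennreal \<bar>s n x - s (r i) x\<bar>)"
        by (metis lim_imp_Liminf trivial_limit_sequentially)
    qed
    also have "\<dots> \<le> liminf (\<lambda>i. \<integral>\<^sup>+x. ennreal \<bar>s n x - s (r i) x\<bar> \<partial>leb01)"
      by (rule nn_integral_liminf) measurable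
    also have "\<dots> \<le> ennreal e"
    proof (rule Liminf_le)
      show "\<forall>\<^sub>F i in sequentially. (\<integral>\<^sup>+x. ennreal \<bar>s n x - s (r i) x\<bar> \<partial>leb01) \<le> ennreal e"
        using eventually_ge_at_top[of N]
      proof eventually_elim
        case (elim i)
        then have "r i \<ge> N"
          using r seq_suble le_trans by blast
        moreover have "(\<integral>\<^sup>+x. ennreal \<bar>s n x - s (r i) x\<bar> \<partial>leb01)
            = ennreal (LINT x|leb01. \<bar>s n x - s (r i) x\<bar>)"
          using int by (intro nn_integral_eq_integral) auto
        ultimately show ?case
          using N[OF n, of "r i"] by (simp add: ennreal_leI)
      qed
    qed simp
    finally show ?thesis .
  qed
  have diff: "integrable leb01 (\<lambda>x. s n x - f x)"
    if "n \<ge> N" "\<And>i j. i \<ge> N \<Longrightarrow> j \<ge> N \<Longrightarrow> (LINT x|leb01. \<bar>s i x - s j x\<bar>) < e" for n N e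
    using fatou[OF that] by (intro integrableI_bounded) (auto simp: le_less_trans)
  have int_f: "integrable leb01 f"
  proof -
    obtain N where N: "\<And>i j. i \<ge> N \<Longrightarrow> j \<ge> N \<Longrightarrow> (LINT x|leb01. \<bar>s i x - s j x\<bar>) < 1"
      using cauchy[of 1] by auto
    have "integrable leb01 (\<lambda>x. s N x - f x)"
      by (rule diff[where N = N and e = 1]) (simp_all add: N)
    from Bochner_Integration.integrable_diff[OF int[of N] this]
    show ?thesis by simp
  qed
  have "\<exists>N. \<forall>n\<ge>N. (LINT x|leb01. \<bar>s n x - f x\<bar>) < e" if "e > 0" for e
  proof -
    obtain N where N: "\<And>i j. i \<ge> N \<Longrightarrow> j \<ge> N \<Longrightarrow> (LINT x|leb01. \<bar>s i x - s j x\<bar>) < e / 2"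
      using cauchy[of "e / 2"] \<open>e > 0\<close> by auto
    have "(LINT x|leb01. \<bar>s n x - f x\<bar>) < e" if "n \<ge> N" for n
    proof -
      have "ennreal (LINT x|leb01. \<bar>s n x - f x\<bar>) = (\<integral>\<^sup>+x. ennreal \<bar>s n x - f x\<bar> \<partial>leb01)"
        using int int_f by (intro nn_integral_eq_integral[symmetric]) auto
      also have "\<dots> \<le> ennreal (e / 2)"
        using fatou[OF that N] .
      finally show ?thesis
        using \<open>e > 0\<close> by (simp add: ennreal_le_iff)
    qed
    then show ?thesis by blast
  qed
  with int_f show ?thesis by blast
qed

instance L1 :: banach
proof
  fix X :: "nat \<Rightarrow> L1"
  assume X: "Cauchy X"
  define s where "s n = rep_L1 (X n)" for n
  have rel: "L1_rel (s n) (s n)" for n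
    unfolding s_def using Quotient3_rep_reflp[OF Quotient3_L1] .
  have X_eq: "X n = abs_L1 (s n)" for n
    unfolding s_def using Quotient3_abs_rep[OF Quotient3_L1] by simp
  have int: "integrable leb01 (s n)" for n
    using rel by (simp add: L1_rel_def)
  have norm_diff: "norm (abs_L1 f - abs_L1 g) = (LINT x|leb01. \<bar>f x - g x\<bar>)"
    if "integrable leb01 f" "integrable leb01 g" for f g
    using that by (simp add: minus_L1.abs_eq norm_L1.abs_eq L1_rel_def eq_onp_def)
  have "\<exists>N. \<forall>i\<ge>N. \<forall>j\<ge>N. (LINT x|leb01. \<bar>s i x - s j x\<bar>) < e" if "e > 0" for e
    using metric_CauchyD[OF X that] by (simp add: dist_norm X_eq norm_diff int)
  from L1_complete_aux[of s, OF int this] obtain f where f: "integrable leb01 f"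
    and conv: "\<And>e. e > 0 \<Longrightarrow> \<exists>N. \<forall>n\<ge>N. (LINT x|leb01. \<bar>s n x - f x\<bar>) < e"
    by blast
  have "X \<longlonglongrightarrow> abs_L1 f"
    by (rule metric_LIMSEQ_I) (simp add: dist_norm X_eq norm_diff int f conv)
  then show "convergent X"
    by (rule convergentI)
qed


section \<open>Second adjoints and Tauberian operators\<close>

lift_definition banach_adjoint ::
  "('a::real_normed_vector \<Rightarrow>\<^sub>L 'b::real_normed_vector) \<Rightarrow> ('b \<Rightarrow>\<^sub>L real) \<Rightarrow>\<^sub>L ('a \<Rightarrow>\<^sub>L real)"
  is "\<lambda>T \<phi>. \<phi> o\<^sub>L T"
  by (rule bounded_bilinear.bounded_linear_left[OF bounded_bilinear_blinfun_compose])

lift_definition bidual_embedding ::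
  "'a::real_normed_vector \<Rightarrow> ('a \<Rightarrow>\<^sub>L real) \<Rightarrow>\<^sub>L real"
  is "\<lambda>x \<phi>. blinfun_apply \<phi> x"
  by (rule blinfun.bounded_linear_left)

lemma banach_adjoint_apply [simp]:
  "blinfun_apply (blinfun_apply (banach_adjoint T) \<phi>) x = blinfun_apply \<phi> (blinfun_apply T x)"
  by (simp add: banach_adjoint.rep_eq)

lemma bidual_embedding_apply [simp]:
  "blinfun_apply (bidual_embedding x) \<phi> = blinfun_apply \<phi> x"
  by (simp add: bidual_embedding.rep_eq)

definition tauberian :: "('a::banach \<Rightarrow>\<^sub>L 'b::banach) \<Rightarrow> bool"
  where "tauberian T \<longleftrightarrow>
    blinfun_apply (banach_adjoint (banach_adjoint T)) -` range bidual_embedding = range bidual_embedding"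

end

theory Submission
  imports Defs
begin

text \<open>
  Attach infinitely many independent random bits to every vertex of the \<open>5\<close>-regular tree, whose
  vertices are the words over five letters in which neighbouring letters differ. Through its binary
  digits a point of \<open>(0,1)\<close> is such a labelling, so a function on \<open>(0,1)\<close> is a function of the
  labelled tree as seen from its root. The operator behind the theorem sends \<open>f\<close> to the sum of the
  five functions obtained by evaluating \<open>f\<close> at the neighbours of the root. Two properties, which at
  first sight exclude each other, make it useful.

  It is bounded below on functions of small support (\<open>small_support_bound_cylinder\<close>). In a suitable
  finite \<open>5\<close>-regular graph every small set \<open>S\<close> has at least \<open>3 * card S\<close> neighbours, and since
  \<open>3\<close> exceeds half of the degree, summation over neighbours does not decrease the \<open>\<ell>\<^sub>1\<close>-norm of a
  function of small support (\<open>expanding_lower_bound\<close>). Random permutations give such graphs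
  (\<open>few_nonexpanding\<close>) in which moreover almost every vertex has a tree-like neighbourhood
  (\<open>few_fixed\<close>). On a finite graph with random labels, a function of the labelled tree can be
  evaluated at almost every vertex, which carries the bound from the graphs to the operator.

  It is not bounded below on the span of the Rademacher functions, where it acts like the adjacency
  operator of the tree on \<open>\<ell>\<^sub>2\<close>: a slowly truncated radial function on the tree is almost annihilated
  (\<open>radial_nbr_sum_squares\<close>). Different bits at the vertices provide infinitely many such functions.

  The first property makes the operator Tauberian (\<open>tauberian_criterion\<close>): an element of the bidual
  of \<open>L\<^sub>1\<close> is the sum of an absolutely continuous part, which belongs to \<open>L\<^sub>1\<close>, and of a part
  living on sets of arbitrarily small measure, on which the operator is an isomorphism; if the image
  is in \<open>L\<^sub>1\<close>, the second part must vanish. Adding a nuclear operator does not affect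
  this. The second property leaves enough room to add a nuclear operator that produces injectivity and
  dense range while surjectivity fails (\<open>injective_dense_range_perturbation\<close>); for this purpose the
  digits of the target are indexed so that the range of the operator depends on the even ones only.
\<close>

section \<open>Extension of functionals and operators\<close>

text \<open>Functionals are treated as their graphs: a subspace of the product with the reals on which the second
  component is bounded by a multiple of the first is automatically the graph of a bounded functional
  on a subspace. Zorn's lemma then applies to plain set inclusion.\<close>

lemma hahn_banach_extension:
  fixes M :: "'a::real_normed_vector set" and g :: "'a \<Rightarrow> real"
  assumes M: "subspace M" and B: "0 \<le> B"
    and add: "\<And>x y. x \<in> M \<Longrightarrow> y \<in> M \<Longrightarrow> g (x + y) = g x + g y"
    and scale: "\<And>c x. x \<in> M \<Longrightarrow> g (c *\<^sub>R x) = c * g x"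
    and bound: "\<And>x. x \<in> M \<Longrightarrow> \<bar>g x\<bar> \<le> B * norm x"
  shows "\<exists>\<phi> :: 'a \<Rightarrow>\<^sub>L real. \<forall>x\<in>M. \<phi> x = g x"
proof -
  define admissible where
    "admissible G \<longleftrightarrow> subspace G \<and> (\<forall>z\<in>G. \<bar>snd z\<bar> \<le> B * norm (fst z))" for G :: "('a \<times> real) set"
  define G0 where "G0 = (\<lambda>x. (x, g x)) ` M"
  define A where "A = {G. admissible G \<and> G0 \<subseteq> G}"
  have g0: "g 0 = 0" using scale[OF subspace_0[OF M], of 0] by simp
  have "subspace G0"
    unfolding subspace_def
  proof (intro conjI ballI allI)
    show "0 \<in> G0" using g0 subspace_0[OF M] by (force simp: G0_def zero_prod_def)
  next
    fix x y assume "x \<in> G0" "y \<in> G0"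
    then show "x + y \<in> G0" using subspace_add[OF M] add by (auto simp: G0_def image_iff)
  next
    fix c x assume "x \<in> G0"
    then show "c *\<^sub>R x \<in> G0" using subspace_scale[OF M] scale by (auto simp: G0_def image_iff)
  qed
  then have adm0: "G0 \<in> A"
    using bound by (auto simp: A_def admissible_def G0_def)
  have "\<exists>G\<in>A. \<forall>H\<in>A. G \<subseteq> H \<longrightarrow> H = G"
  proof (rule subset_Zorn_nonempty)
    show "A \<noteq> {}" using adm0 by blast
    fix \<C> assume ne: "\<C> \<noteq> {}" and ch: "subset.chain A \<C>"
    have dir: "\<exists>G\<in>\<C>. x \<in> G \<and> y \<in> G" if xy: "x \<in> \<Union>\<C>" "y \<in> \<Union>\<C>" for x y
    proof -
      obtain G H where GH: "G \<in> \<C>" "x \<in> G" "H \<in> \<C>" "y \<in> H" using xy by blast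
      then have "G \<subseteq> H \<or> H \<subseteq> G" using ch unfolding subset.chain_def by blast
      then show ?thesis using GH by blast
    qed
    have sub: "G \<in> \<C> \<Longrightarrow> G \<in> A" for G using ch by (auto simp: subset.chain_def)
    have "subspace (\<Union>\<C>)"
      unfolding subspace_def
    proof (intro conjI ballI allI)
      show "0 \<in> \<Union>\<C>" using ne sub subspace_0 unfolding A_def admissible_def by blast
    next
      fix x y assume "x \<in> \<Union>\<C>" "y \<in> \<Union>\<C>"
      then obtain G where "G \<in> \<C>" "x \<in> G" "y \<in> G" using dir by blast
      then show "x + y \<in> \<Union>\<C>" using sub[of G] by (auto simp: A_def admissible_def intro: subspace_add)
    next
      fix c x assume "x \<in> \<Union>\<C>"
      then obtain G where "G \<in> \<C>" "x \<in> G" by blast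
      then show "c *\<^sub>R x \<in> \<Union>\<C>" using sub[of G] by (auto simp: A_def admissible_def intro: subspace_scale)
    qed
    moreover have "\<bar>snd z\<bar> \<le> B * norm (fst z)" if "z \<in> \<Union>\<C>" for z
      using that sub unfolding A_def admissible_def by blast
    moreover have "G0 \<subseteq> \<Union>\<C>" using ne sub unfolding A_def by blast
    ultimately show "\<Union>\<C> \<in> A" unfolding A_def admissible_def by blast
  qed
  then obtain G where GA: "G \<in> A" and max: "\<And>H. H \<in> A \<Longrightarrow> G \<subseteq> H \<Longrightarrow> H = G" by blast
  have sG: "subspace G" and bG: "\<And>x r. (x, r) \<in> G \<Longrightarrow> \<bar>r\<bar> \<le> B * norm x" and G0G: "G0 \<subseteq> G"
    using GA by (auto simp: A_def admissible_def)
  have uniq: "r = s" if "(x, r) \<in> G" "(x, s) \<in> G" for x r s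
    using bG[of 0 "r - s"] subspace_diff[OF sG that] by simp
  have total: "\<exists>r. (x, r) \<in> G" for x
  proof (rule ccontr)
    assume no: "\<nexists>r. (x, r) \<in> G"
    have cross: "r - B * norm (z - x) \<le> - s + B * norm (w + x)" if "(z, r) \<in> G" "(w, s) \<in> G" for z r w s
    proof -
      have "r + s \<le> B * norm (z + w)"
        using bG[of "z + w" "r + s"] subspace_add[OF sG that] by simp
      also have "\<dots> = B * norm ((z - x) + (w + x))" by (simp add: algebra_simps)
      also have "\<dots> \<le> B * (norm (z - x) + norm (w + x))"
      by (rule mult_left_mono[OF norm_triangle_ineq B])
      finally show ?thesis by (simp add: algebra_simps)
    qed
    define lower where "lower = (\<lambda>(z, r). r - B * norm (z - x)) ` G"
    \<comment> \<open>any value between the two sides of \<open>cross\<close> can be assigned to \<open>x\<close>\<close>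
    define c where "c = Sup lower"
    have G_ne: "(0, 0) \<in> G" using subspace_0[OF sG] by (simp add: zero_prod_def)
    have bdd: "bdd_above lower"
      unfolding lower_def using cross[OF _ G_ne] by (auto intro!: bdd_aboveI[of _ "B * norm x"])
    have c_ge: "r - B * norm (z - x) \<le> c" if "(z, r) \<in> G" for z r
      unfolding c_def using that by (intro cSup_upper bdd) (auto simp: lower_def image_iff intro!: bexI)
    have c_le: "c \<le> - s + B * norm (w + x)" if "(w, s) \<in> G" for w s
      unfolding c_def using cross[OF _ that] G_ne by (intro cSup_least) (auto simp: lower_def)
    have one_sided: "r + t * c \<le> B * norm (z + t *\<^sub>R x)" if zr: "(z, r) \<in> G" for z r t
    proof (cases t "0::real" rule: linorder_cases)
      case equal then show ?thesis using bG[OF zr] by simp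
    next
      case greater
      define v where "v = (1/t) *\<^sub>R z + x"
      have "((1/t) *\<^sub>R z, (1/t) * r) \<in> G" using subspace_scale[OF sG zr, of "1/t"] by simp
      from c_le[OF this] have "t * c \<le> t * (- ((1/t) * r) + B * norm v)"
        unfolding v_def using greater by (intro mult_left_mono) auto
      also have "\<dots> = - r + B * norm (t *\<^sub>R v)"
        using greater by (simp add: algebra_simps)
      also have "t *\<^sub>R v = z + t *\<^sub>R x"
        using greater by (simp add: v_def algebra_simps)
      finally show ?thesis by simp
    next
      case less
      define s where "s = - t"
      have s: "s > 0" using less by (simp add: s_def)
      define v where "v = (1/s) *\<^sub>R z - x"
      have "((1/s) *\<^sub>R z, (1/s) * r) \<in> G" using subspace_scale[OF sG zr, of "1/s"] by simp
      from c_ge[OF this] have "s * ((1/s) * r - B * norm v) \<le> s * c"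
        unfolding v_def using s by (intro mult_left_mono) auto
      moreover have "s * ((1/s) * r - B * norm v) = r - B * norm (s *\<^sub>R v)"
        using s by (simp add: algebra_simps)
      moreover have "s *\<^sub>R v = z + t *\<^sub>R x"
        using s by (simp add: v_def algebra_simps s_def)
      ultimately have "r - B * norm (z + t *\<^sub>R x) \<le> s * c" by metis
      then show ?thesis by (simp add: s_def)
    qed
    define H where "H = {p + q |p q. p \<in> G \<and> q \<in> span {(x, c)}}"
    have sH: "subspace H" unfolding H_def by (intro subspace_sums sG subspace_span)
    have "\<bar>snd h\<bar> \<le> B * norm (fst h)" if hH: "h \<in> H" for h
    proof -
      obtain p t where p: "p \<in> G" and h: "h = p + t *\<^sub>R (x, c)"
        using hH unfolding H_def span_singleton by blast
      have "(- fst p, - snd p) \<in> G" using subspace_neg[OF sG p] by (simp add: uminus_prod_def)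
      from one_sided[OF this, of "- t"] one_sided[of "fst p" "snd p" t] p
      have "snd p + t * c \<le> B * norm (fst p + t *\<^sub>R x)"
        "- (snd p + t * c) \<le> B * norm (- (fst p + t *\<^sub>R x))"
        by (auto simp: algebra_simps)
      then show ?thesis by (simp add: h abs_le_iff norm_minus_cancel[of "fst p + t *\<^sub>R x", symmetric] del: norm_minus_cancel)
    qed
    moreover have GH: "G \<subseteq> H" 
    proof
      fix q assume "q \<in> G"
      then have "q + 0 \<in> H" unfolding H_def using span_0[of "{(x, c)}"] by blast
      then show "q \<in> H" by simp
    qed
    ultimately have "H \<in> A" using sH G0G by (auto simp: A_def admissible_def)
    then have "H = G" using max GH by blast
    moreover have "(x, c) \<in> H"
    proof -
      have "0 + (x, c) \<in> H"
        unfolding H_def using subspace_0[OF sG] span_base[of "(x, c)" "{(x, c)}"] by blast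
      then show ?thesis by simp
    qed
    ultimately show False using no by blast
  qed
  define \<phi> where "\<phi> x = (THE r. (x, r) \<in> G)" for x
  have \<phi>: "(x, \<phi> x) \<in> G" for x
    unfolding \<phi>_def using total uniq by (metis theI)
  have \<phi>_eq: "(x, r) \<in> G \<Longrightarrow> \<phi> x = r" for x r using \<phi> uniq by blast
  have bl: "bounded_linear \<phi>"
  proof (rule bounded_linear_intro[where K = B])
    show "\<phi> (x + y) = \<phi> x + \<phi> y" for x y
      using subspace_add[OF sG \<phi>[of x] \<phi>[of y]] by (intro \<phi>_eq) simp
    show "\<phi> (r *\<^sub>R x) = r *\<^sub>R \<phi> x" for r x
      using subspace_scale[OF sG \<phi>[of x], of r] by (intro \<phi>_eq) simp
    show "norm (\<phi> x) \<le> norm x * B" for x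
      using bG[OF \<phi>[of x]] by (simp add: mult.commute)
  qed
  have "Blinfun \<phi> x = g x" if "x \<in> M" for x
    using that G0G \<phi>_eq by (auto simp: bounded_linear_Blinfun_apply[OF bl] G0_def)
  then show ?thesis by blast
qed

lemma separate_point_from_closed_subspace:
  fixes M :: "'a::real_normed_vector set"
  assumes M: "subspace M" "closed M" and y: "y \<notin> M"
  shows "\<exists>\<psi> :: 'a \<Rightarrow>\<^sub>L real. (\<forall>x\<in>M. \<psi> x = 0) \<and> \<psi> y = 1"
proof -
  obtain d where d: "d > 0" "\<And>x. x \<in> M \<Longrightarrow> d \<le> dist y x"
  proof -
    obtain d where "d > 0" "ball y d \<subseteq> - M"
      using M(2) y open_contains_ball[of "- M"] by (auto simp: open_Compl)
    then show thesis by (intro that[of d]) (auto simp: subset_iff not_less)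
  qed
  define S where "S = {m + t *\<^sub>R y |m t. m \<in> M}"
  define g where "g v = (THE t. v - t *\<^sub>R y \<in> M)" for v
  have g: "g (m + t *\<^sub>R y) = t" if m: "m \<in> M" for m t
    unfolding g_def
  proof (rule the_equality)
    show "m + t *\<^sub>R y - t *\<^sub>R y \<in> M" using m by simp
    fix s assume "m + t *\<^sub>R y - s *\<^sub>R y \<in> M"
    then have "(m + t *\<^sub>R y - s *\<^sub>R y) - m \<in> M" using subspace_diff[OF M(1) _ m] by blast
    then have "(t - s) *\<^sub>R y \<in> M" by (simp add: algebra_simps)
    then have "t - s \<noteq> 0 \<Longrightarrow> y \<in> M" using subspace_scale[OF M(1), of "(t - s) *\<^sub>R y" "1 / (t - s)"] by simp
    then show "s = t" using y by auto
  qed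
  have bound: "\<bar>t\<bar> \<le> (1 / d) * norm (m + t *\<^sub>R y)" if m: "m \<in> M" for m t
  proof (cases "t = 0")
    case False
    have "d \<le> norm (y - (- 1 / t) *\<^sub>R m)"
      using d(2)[OF subspace_scale[OF M(1) m, of "- 1 / t"]] by (simp add: dist_norm)
    then have "\<bar>t\<bar> * d \<le> \<bar>t\<bar> * norm (y - (- 1 / t) *\<^sub>R m)" by (rule mult_left_mono) simp
    also have "\<dots> = norm (t *\<^sub>R (y - (- 1 / t) *\<^sub>R m))" by simp
    also have "t *\<^sub>R (y - (- 1 / t) *\<^sub>R m) = m + t *\<^sub>R y" using False by (simp add: algebra_simps)
    finally show ?thesis using d(1) by (simp add: field_simps)
  qed (use d in simp)
  have "\<exists>\<psi> :: 'a \<Rightarrow>\<^sub>L real. \<forall>x\<in>S. \<psi> x = g x"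
  proof (rule hahn_banach_extension[where B = "1 / d"])
    show "subspace S"
      unfolding subspace_def
    proof (intro conjI ballI allI)
      show "0 \<in> S" using subspace_0[OF M(1)] by (auto simp: S_def intro!: exI[of _ 0])
    next
      fix v w assume "v \<in> S" "w \<in> S"
      then obtain m t m' t' where *: "m \<in> M" "m' \<in> M" "v = m + t *\<^sub>R y" "w = m' + t' *\<^sub>R y" by (auto simp: S_def)
      then have "v + w = (m + m') + (t + t') *\<^sub>R y" by (simp add: algebra_simps)
      then show "v + w \<in> S" using subspace_add[OF M(1)] * unfolding S_def by blast
    next
      fix c v assume "v \<in> S"
      then obtain m t where *: "m \<in> M" "v = m + t *\<^sub>R y" by (auto simp: S_def)
      then have "c *\<^sub>R v = c *\<^sub>R m + (c * t) *\<^sub>R y" by (simp add: algebra_simps)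
      then show "c *\<^sub>R v \<in> S" using subspace_scale[OF M(1)] * unfolding S_def by blast
    qed
  next
    fix v w assume "v \<in> S" "w \<in> S"
    then obtain m t m' t' where *: "m \<in> M" "m' \<in> M" "v = m + t *\<^sub>R y" "w = m' + t' *\<^sub>R y" by (auto simp: S_def)
    then have "v + w = (m + m') + (t + t') *\<^sub>R y" by (simp add: algebra_simps)
    then show "g (v + w) = g v + g w" using g subspace_add[OF M(1)] * by metis
  next
    fix c v assume "v \<in> S"
    then obtain m t where *: "m \<in> M" "v = m + t *\<^sub>R y" by (auto simp: S_def)
    then have "c *\<^sub>R v = c *\<^sub>R m + (c * t) *\<^sub>R y" by (simp add: algebra_simps)
    then show "g (c *\<^sub>R v) = c * g v" using g subspace_scale[OF M(1)] * by metis
  next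
    fix v assume "v \<in> S"
    then obtain m t where *: "m \<in> M" "v = m + t *\<^sub>R y" by (auto simp: S_def)
    then show "\<bar>g v\<bar> \<le> 1 / d * norm v" using g bound by simp
  qed (use d in simp)
  then obtain \<psi> :: "'a \<Rightarrow>\<^sub>L real" where \<psi>: "\<And>x. x \<in> S \<Longrightarrow> \<psi> x = g x" by blast
  have "\<psi> x = 0" if x: "x \<in> M" for x
  proof -
    have "x + 0 *\<^sub>R y \<in> S" using x unfolding S_def by blast
    then show ?thesis using \<psi>[of x] g[OF x, of 0] by simp
  qed
  moreover have "\<psi> y = 1"
  proof -
    have "0 + 1 *\<^sub>R y \<in> S" using subspace_0[OF M(1)] unfolding S_def by blast
    then show ?thesis using \<psi>[of y] g[OF subspace_0[OF M(1)], of 1] by simp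
  qed
  ultimately show ?thesis by blast
qed

lemma dense_extension:
  fixes M :: "'a::real_normed_vector set" and t :: "'a \<Rightarrow> 'b::banach"
  assumes M: "subspace M" and dense: "closure M = UNIV"
    and add: "\<And>x y. x \<in> M \<Longrightarrow> y \<in> M \<Longrightarrow> t (x + y) = t x + t y"
    and scale: "\<And>c x. x \<in> M \<Longrightarrow> t (c *\<^sub>R x) = c *\<^sub>R t x"
    and bound: "\<And>x. x \<in> M \<Longrightarrow> norm (t x) \<le> C * norm x"
  shows "\<exists>T :: 'a \<Rightarrow>\<^sub>L 'b. \<forall>x\<in>M. T x = t x"
proof -
  have lip: "norm (t x - t y) \<le> \<bar>C\<bar> * norm (x - y)" if "x \<in> M" "y \<in> M" for x y
  proof -
    have "t (x - y) = t x - t y"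
      using add[OF that(1) subspace_scale[OF M that(2), of "-1"]] scale[OF that(2), of "-1"] by simp
    moreover have "C * norm (x - y) \<le> \<bar>C\<bar> * norm (x - y)" by (intro mult_right_mono) auto
    ultimately show ?thesis using bound[OF subspace_diff[OF M that]] by simp
  qed
  have uc: "uniformly_continuous_on M t"
    unfolding uniformly_continuous_on_def
  proof (intro allI impI)
    fix e :: real assume "e > 0"
    show "\<exists>d>0. \<forall>x\<in>M. \<forall>x'\<in>M. dist x' x < d \<longrightarrow> dist (t x') (t x) < e"
    proof (intro exI conjI ballI impI)
      show "e / (\<bar>C\<bar> + 1) > 0" using \<open>e > 0\<close> by simp
      fix x x' assume x: "x \<in> M" "x' \<in> M" and d: "dist x' x < e / (\<bar>C\<bar> + 1)"
      have "dist (t x') (t x) \<le> (\<bar>C\<bar> + 1) * dist x' x"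
        unfolding dist_norm distrib_right using lip[OF x(2,1)] norm_ge_zero[of "x' - x"] by linarith
      also have "\<dots> < e" using d by (simp add: field_simps)
      finally show "dist (t x') (t x) < e" .
    qed
  qed
  obtain h where h: "uniformly_continuous_on (closure M) h" and ht: "\<And>x. x \<in> M \<Longrightarrow> t x = h x"
    using uniformly_continuous_on_extension_on_closure[OF uc] by metis
  have cont: "continuous_on UNIV h" using h dense uniformly_continuous_imp_continuous by auto
  then have isc: "isCont h x" for x by (simp add: continuous_on_eq_continuous_at)
  have approx: "\<exists>s. (\<forall>n. s n \<in> M) \<and> s \<longlonglongrightarrow> x" for x
    using dense closure_sequential[of x M] by auto
  have bl: "bounded_linear h"
  proof (rule bounded_linear_intro[where K = C])
    fix x y
    obtain s where s: "\<And>n. s n \<in> M" "s \<longlonglongrightarrow> x" using approx by blast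
    obtain s' where s': "\<And>n. s' n \<in> M" "s' \<longlonglongrightarrow> y" using approx by blast
    have hs: "(\<lambda>n. h (s n)) \<longlonglongrightarrow> h x" "(\<lambda>n. h (s' n)) \<longlonglongrightarrow> h y"
      "(\<lambda>n. h (s n + s' n)) \<longlonglongrightarrow> h (x + y)"
      by (rule isCont_tendsto_compose[OF isc s(2)], rule isCont_tendsto_compose[OF isc s'(2)],
          rule isCont_tendsto_compose[OF isc tendsto_add[OF s(2) s'(2)]])
    have "h (s n + s' n) = h (s n) + h (s' n)" for n
      using s s' add ht subspace_add[OF M] by metis
    then have "(\<lambda>n. h (s n + s' n)) \<longlonglongrightarrow> h x + h y" using tendsto_add[OF hs(1,2)] by simp
    then show "h (x + y) = h x + h y" using hs(3) LIMSEQ_unique by blast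
    show "norm (h x) \<le> norm x * C"
    proof (rule LIMSEQ_le)
      show "(\<lambda>n. norm (h (s n))) \<longlonglongrightarrow> norm (h x)" "(\<lambda>n. norm (s n) * C) \<longlonglongrightarrow> norm x * C"
        using tendsto_norm[OF hs(1)] tendsto_mult_right[OF tendsto_norm[OF s(2)]] by auto
      show "\<exists>N. \<forall>n\<ge>N. norm (h (s n)) \<le> norm (s n) * C"
        using bound s ht by (metis mult.commute)
    qed
    fix r :: real
    have "(\<lambda>n. h (r *\<^sub>R s n)) \<longlonglongrightarrow> h (r *\<^sub>R x)"
      by (rule isCont_tendsto_compose[OF isc tendsto_scaleR[OF tendsto_const s(2)]])
    moreover have "h (r *\<^sub>R s n) = r *\<^sub>R h (s n)" for n
      using s scale ht subspace_scale[OF M] by metis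
    ultimately have "(\<lambda>n. r *\<^sub>R h (s n)) \<longlonglongrightarrow> h (r *\<^sub>R x)" by simp
    moreover have "(\<lambda>n. r *\<^sub>R h (s n)) \<longlonglongrightarrow> r *\<^sub>R h x" by (rule tendsto_scaleR[OF tendsto_const hs(1)])
    ultimately show "h (r *\<^sub>R x) = r *\<^sub>R h x" using LIMSEQ_unique by blast
  qed
  show ?thesis
    using ht by (auto intro!: exI[of _ "Blinfun h"] simp: bounded_linear_Blinfun_apply[OF bl])
qed

lemma subspace_closure:
  fixes S :: "'a::real_normed_vector set"
  assumes S: "subspace S"
  shows "subspace (closure S)"
  unfolding subspace_def
proof (intro conjI ballI allI)
  show "0 \<in> closure S" using subspace_0[OF S] closure_subset by blast
next
  fix x y assume "x \<in> closure S" "y \<in> closure S"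
  then obtain f g where f: "\<And>n. f n \<in> S" "f \<longlonglongrightarrow> x" and g: "\<And>n. g n \<in> S" "g \<longlonglongrightarrow> y"
    unfolding closure_sequential by blast
  then show "x + y \<in> closure S"
    unfolding closure_sequential using subspace_add[OF S] tendsto_add[OF f(2) g(2)]
    by (intro exI[of _ "\<lambda>n. f n + g n"]) auto
next
  fix c x assume "x \<in> closure S"
  then obtain f where f: "\<And>n. f n \<in> S" "f \<longlonglongrightarrow> x" unfolding closure_sequential by blast
  then show "c *\<^sub>R x \<in> closure S"
    unfolding closure_sequential using subspace_scale[OF S] tendsto_scaleR[OF tendsto_const f(2)]
    by (intro exI[of _ "\<lambda>n. c *\<^sub>R f n"]) auto
qed

section \<open>Tauberian and nuclear operators\<close>

lemma tauberian_iff: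
  "tauberian T \<longleftrightarrow> (\<forall>\<xi>. banach_adjoint (banach_adjoint T) \<xi> \<in> range bidual_embedding \<longrightarrow> \<xi> \<in> range bidual_embedding)"
proof -
  have "banach_adjoint (banach_adjoint T) (bidual_embedding x) = bidual_embedding (T x)" for x
    by (rule blinfun_eqI) simp
  then show ?thesis unfolding tauberian_def by auto
qed

lemma bidual_embedding_add: "bidual_embedding (x + y) = bidual_embedding x + bidual_embedding y"
  by (rule blinfun_eqI) (simp add: blinfun.bilinear_simps)

lemma bidual_embedding_diff: "bidual_embedding (x - y) = bidual_embedding x - bidual_embedding y"
  by (rule blinfun_eqI) (simp add: blinfun.bilinear_simps)

lemma banach_adjoint_add: "banach_adjoint (S + T) = banach_adjoint S + banach_adjoint T"
  by (intro blinfun_eqI) (simp add: blinfun.bilinear_simps)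

text \<open>If the second adjoint of \<open>T + K\<close> takes a value in the target, so does that of \<open>T\<close>, because the one of
  \<open>K\<close> always does.\<close>

lemma tauberian_perturbation:
  assumes T: "tauberian T"
    and K: "\<And>\<xi>. banach_adjoint (banach_adjoint K) \<xi> \<in> range bidual_embedding"
  shows "tauberian (T + K)"
  unfolding tauberian_iff
proof (intro allI impI)
  fix \<xi> assume "banach_adjoint (banach_adjoint (T + K)) \<xi> \<in> range bidual_embedding"
  then obtain y where y: "banach_adjoint (banach_adjoint (T + K)) \<xi> = bidual_embedding y" by blast
  obtain z where z: "banach_adjoint (banach_adjoint K) \<xi> = bidual_embedding z" using K by blast
  have "banach_adjoint (banach_adjoint T) \<xi> = bidual_embedding (y - z)"
    using y z by (simp add: banach_adjoint_add blinfun.bilinear_simps bidual_embedding_diff algebra_simps)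
  then show "\<xi> \<in> range bidual_embedding" using T unfolding tauberian_iff by blast
qed

text \<open>The range statement holds because the second adjoint is given by the same series, with values
  \<open>\<xi> (a n)\<close> in place of \<open>a n z\<close>, and this series converges in the target space itself.\<close>

lemma nuclear_operator:
  fixes a :: "nat \<Rightarrow> 'a::banach \<Rightarrow>\<^sub>L real" and b :: "nat \<Rightarrow> 'b::banach"
  assumes sm: "summable (\<lambda>n. norm (a n) * norm (b n))"
  shows "\<exists>K :: 'a \<Rightarrow>\<^sub>L 'b. (\<forall>z. (\<lambda>n. a n z *\<^sub>R b n) sums blinfun_apply K z) \<and>
    (\<forall>\<xi>. banach_adjoint (banach_adjoint K) \<xi> \<in> range bidual_embedding)"
proof -
  define R where "R n = blinfun_scaleR_left (b n) o\<^sub>L a n" for n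
  have R: "R n z = a n z *\<^sub>R b n" for n z by (simp add: R_def)
  have "norm (R n) \<le> norm (a n) * norm (b n)" for n
  proof (rule norm_blinfun_bound)
    show "norm (R n z) \<le> norm (a n) * norm (b n) * norm z" for z
      using mult_right_mono[OF norm_blinfun[of "a n" z], of "norm (b n)"] by (simp add: R ac_simps)
  qed simp
  then have "summable R" using summable_comparison_test'[OF sm] by (metis summable_norm_cancel)
  then have sR: "R sums (\<Sum>n. R n)" by (rule summable_sums)
  define K where "K = (\<Sum>n. R n)"
  have K: "(\<lambda>n. a n z *\<^sub>R b n) sums K z" for z
    using bounded_linear.sums[OF blinfun.bounded_linear_left sR, of z] by (simp add: R K_def)
  have "banach_adjoint (banach_adjoint K) \<xi> = bidual_embedding (\<Sum>n. \<xi> (a n) *\<^sub>R b n)" for \<xi>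
  proof (rule blinfun_eqI)
    fix \<eta> :: "'b \<Rightarrow>\<^sub>L real"
    have "summable (\<lambda>n. norm (\<xi> (a n) *\<^sub>R b n))"
    proof (rule summable_comparison_test'[OF summable_mult[OF sm, of "norm \<xi>"]])
      show "norm (norm (\<xi> (a n) *\<^sub>R b n)) \<le> norm \<xi> * (norm (a n) * norm (b n))" for n
        using mult_right_mono[OF norm_blinfun[of \<xi> "a n"], of "norm (b n)"] by (simp add: ac_simps)
    qed
    then have "(\<lambda>n. \<xi> (a n) *\<^sub>R b n) sums (\<Sum>n. \<xi> (a n) *\<^sub>R b n)"
      by (intro summable_sums) (rule summable_norm_cancel)
    from bounded_linear.sums[OF blinfun.bounded_linear_right this, of \<eta>]
    have 1: "(\<lambda>n. \<xi> (a n) * \<eta> (b n)) sums \<eta> (\<Sum>n. \<xi> (a n) *\<^sub>R b n)"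
      by (simp add: blinfun.bilinear_simps)
    have "(\<lambda>n. \<eta> o\<^sub>L R n) sums (\<eta> o\<^sub>L K)"
      unfolding K_def
      by (rule bounded_linear.sums[OF bounded_bilinear.bounded_linear_right[OF bounded_bilinear_blinfun_compose] sR])
    from bounded_linear.sums[OF blinfun.bounded_linear_right this, of \<xi>]
    have "(\<lambda>n. \<xi> (\<eta> o\<^sub>L R n)) sums \<xi> (\<eta> o\<^sub>L K)" .
    moreover have "\<eta> o\<^sub>L R n = \<eta> (b n) *\<^sub>R a n" for n
      by (rule blinfun_eqI) (simp add: R blinfun.bilinear_simps)
    ultimately have 2: "(\<lambda>n. \<xi> (a n) * \<eta> (b n)) sums \<xi> (\<eta> o\<^sub>L K)"
      by (simp add: blinfun.bilinear_simps mult.commute)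
    show "banach_adjoint (banach_adjoint K) \<xi> \<eta> = bidual_embedding (\<Sum>n. \<xi> (a n) *\<^sub>R b n) \<eta>"
      using sums_unique2[OF 1 2] by (simp add: banach_adjoint.rep_eq)
  qed
  then show ?thesis using K by blast
qed

section \<open>Nuclear perturbations that are injective with dense range\<close>

text \<open>The vectors \<open>x n\<close> are almost annihilated by \<open>T\<close>, and a first nuclear operator makes them vanish
  exactly. The functionals \<open>\<psi> n\<close> see nothing of the range of \<open>T\<close>. A second nuclear operator
  \<open>\<Sum>n. c n * a n z *\<^sub>R b n\<close> is then tested from two sides: \<open>\<psi> m\<close> recovers the value \<open>a m z\<close>, and
  insertion of \<open>x m\<close> recovers the vector \<open>b m\<close>. So the sum is injective if the \<open>a m\<close> are total, it
  has dense range if the \<open>b m\<close> span a dense subspace, and it is not onto because \<open>a m z\<close> cannot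
  exceed a multiple of \<open>norm (a m)\<close>. To reconcile totality with biorthogonality, every member of a total
  sequence of functionals is corrected to vanish on all \<open>x n\<close>, is repeated infinitely often, and gets a
  multiple of \<open>\<phi> n\<close> added that tends to zero; likewise for the vectors.\<close>

lemma injective_dense_range_perturbation:
  fixes T :: "'a::banach \<Rightarrow>\<^sub>L 'b::banach"
    and \<phi> u :: "nat \<Rightarrow> 'a \<Rightarrow>\<^sub>L real" and \<psi> :: "nat \<Rightarrow> 'b \<Rightarrow>\<^sub>L real"
    and x :: "nat \<Rightarrow> 'a" and y v :: "nat \<Rightarrow> 'b"
  assumes \<phi>_norm: "\<And>n. norm (\<phi> n) \<le> 1" and Tx: "summable (\<lambda>n. norm (T (x n)))"
    and \<phi>x: "\<And>n m. \<phi> n (x m) = (if n = m then 1 else 0)"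
    and y_norm: "\<And>n. norm (y n) \<le> 1" and \<psi>T: "\<And>n z. \<psi> n (T z) = 0"
    and \<psi>y: "\<And>n m. \<psi> n (y m) = (if n = m then 1 else 0)"
    and total: "\<And>z. (\<And>j. u j z = 0) \<Longrightarrow> z = 0"
    and u_fin: "\<And>j. finite {m. u j (x m) \<noteq> 0}"
    and dense: "closure (span (range v)) = UNIV"
    and v_fin: "\<And>j. finite {n. \<psi> n (v j) \<noteq> 0}"
  shows "\<exists>K. (\<forall>\<xi>. banach_adjoint (banach_adjoint K) \<xi> \<in> range bidual_embedding) \<and>
    inj (blinfun_apply (T + K)) \<and> \<not> surj (blinfun_apply (T + K)) \<and>
    closure (range (blinfun_apply (T + K))) = UNIV"
proof -
  define \<theta> where "\<theta> j = u j - (\<Sum>m | u j (x m) \<noteq> 0. u j (x m) *\<^sub>R \<phi> m)" for j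
  define w where "w j = v j - (\<Sum>n | \<psi> n (v j) \<noteq> 0. \<psi> n (v j) *\<^sub>R y n)" for j
  have \<theta>x: "\<theta> j (x k) = 0" for j k
  proof -
    have "(\<Sum>m | u j (x m) \<noteq> 0. u j (x m) * \<phi> m (x k)) = (\<Sum>m | u j (x m) \<noteq> 0. if m = k then u j (x k) else 0)"
      by (intro sum.cong) (auto simp: \<phi>x)
    also have "\<dots> = u j (x k)" using u_fin by simp
    finally show ?thesis by (simp add: \<theta>_def blinfun.bilinear_simps)
  qed
  have \<psi>w: "\<psi> k (w j) = 0" for j k
  proof -
    have "(\<Sum>n | \<psi> n (v j) \<noteq> 0. \<psi> n (v j) * \<psi> k (y n)) = (\<Sum>n | \<psi> n (v j) \<noteq> 0. if n = k then \<psi> k (v j) else 0)"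
      by (intro sum.cong) (auto simp: \<psi>y)
    also have "\<dots> = \<psi> k (v j)" using v_fin by simp
    finally show ?thesis by (simp add: w_def blinfun.bilinear_simps)
  qed
  define p where "p n = fst (prod_decode n)" for n
  define a where "a n = \<theta> (p n) + (1/2)^n *\<^sub>R \<phi> n" for n
  define b where "b n = w (p n) + (1/2)^n *\<^sub>R y n" for n
  define c :: "nat \<Rightarrow> real" where "c n = (1/2)^n / ((1 + norm (a n)) * (1 + norm (b n)))" for n
  have pos: "1 + norm (a n) > 0" "1 + norm (b n) > 0" for n by (simp_all add: add_pos_nonneg)
  have c_pos: "c n > 0" for n using pos unfolding c_def by (intro divide_pos_pos mult_pos_pos) auto
  have half: "summable (\<lambda>n. (1/2::real)^n)" by (rule summable_geometric) simp
  have ax: "a n (x m) = (if n = m then (1/2)^m else 0)" for n m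
    by (simp add: a_def blinfun.bilinear_simps \<theta>x \<phi>x)
  have \<psi>b: "\<psi> n (b m) = (if n = m then (1/2)^m else 0)" for n m
    by (simp add: b_def blinfun.bilinear_simps \<psi>w \<psi>y)
  have "summable (\<lambda>n. norm (\<phi> n) * norm (- T (x n)))"
  proof (rule summable_comparison_test'[OF Tx])
    show "norm (norm (\<phi> n) * norm (- T (x n))) \<le> norm (T (x n))" for n
      using mult_right_mono[OF \<phi>_norm, of "norm (T (x n))"] by simp
  qed
  from nuclear_operator[OF this] obtain K1 where K1: "\<And>z. (\<lambda>n. \<phi> n z *\<^sub>R (- T (x n))) sums blinfun_apply K1 z"
    and K1_range: "\<And>\<xi>. banach_adjoint (banach_adjoint K1) \<xi> \<in> range bidual_embedding" by blast
  have "summable (\<lambda>n. norm (c n *\<^sub>R a n) * norm (b n))"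
  proof (rule summable_comparison_test'[OF half])
    fix n
    have "norm (a n) * norm (b n) \<le> (1 + norm (a n)) * (1 + norm (b n))" by (intro mult_mono) auto
    then have "(1/2)^n * (norm (a n) * norm (b n)) \<le> (1/2)^n * ((1 + norm (a n)) * (1 + norm (b n)))"
      by (intro mult_left_mono) auto
    then show "norm (norm (c n *\<^sub>R a n) * norm (b n)) \<le> (1/2)^n"
      using c_pos[of n] pos[of n] by (simp add: c_def divide_le_eq ac_simps)
  qed
  from nuclear_operator[OF this] obtain K2 where K2: "\<And>z. (\<lambda>n. (c n *\<^sub>R a n) z *\<^sub>R b n) sums blinfun_apply K2 z"
    and K2_range: "\<And>\<xi>. banach_adjoint (banach_adjoint K2) \<xi> \<in> range bidual_embedding" by blast
  define K where "K = K1 + K2"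
  have single: "f sums f m" if "\<And>n. n \<noteq> m \<Longrightarrow> f n = 0" for f :: "nat \<Rightarrow> 'c::real_normed_vector" and m
  proof -
    have "(\<lambda>n. if n = m then f n else 0) = f" using that by auto
    then show ?thesis using sums_single[of m f] by simp
  qed
  have K_range: "banach_adjoint (banach_adjoint K) \<xi> \<in> range bidual_embedding" for \<xi>
  proof -
    obtain y1 y2 where "banach_adjoint (banach_adjoint K1) \<xi> = bidual_embedding y1"
      "banach_adjoint (banach_adjoint K2) \<xi> = bidual_embedding y2" using K1_range K2_range by blast
    then have "banach_adjoint (banach_adjoint K) \<xi> = bidual_embedding (y1 + y2)"
      by (simp add: K_def banach_adjoint_add blinfun.bilinear_simps bidual_embedding_add)
    then show ?thesis by blast
  qed
  have K1x: "K1 (x m) = - T (x m)" for m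
  proof -
    have "(\<lambda>n. \<phi> n (x m) *\<^sub>R (- T (x n))) sums (\<phi> m (x m) *\<^sub>R (- T (x m)))"
      by (rule single[of m "\<lambda>n. \<phi> n (x m) *\<^sub>R (- T (x n))"]) (simp add: \<phi>x)
    from sums_unique2[OF this K1] show ?thesis by (simp add: \<phi>x)
  qed
  have \<psi>K1: "\<psi> k (K1 z) = 0" for k z
  proof -
    have "(\<lambda>n. \<psi> k (\<phi> n z *\<^sub>R (- T (x n)))) sums \<psi> k (K1 z)"
      by (rule bounded_linear.sums[OF blinfun.bounded_linear_right K1])
    then have "(\<lambda>n. 0) sums \<psi> k (K1 z)" by (simp add: blinfun.bilinear_simps \<psi>T)
    then show ?thesis using sums_unique2 sums_zero by blast
  qed
  have K2x: "K2 (x m) = (c m * (1/2)^m) *\<^sub>R b m" for m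
  proof -
    have "(\<lambda>n. (c n *\<^sub>R a n) (x m) *\<^sub>R b n) sums ((c m *\<^sub>R a m) (x m) *\<^sub>R b m)"
      by (rule single[of m "\<lambda>n. (c n *\<^sub>R a n) (x m) *\<^sub>R b n"]) (simp add: ax blinfun.bilinear_simps)
    from sums_unique2[OF this K2] show ?thesis by (simp add: ax blinfun.bilinear_simps)
  qed
  have \<psi>K2: "\<psi> m (K2 z) = c m * (1/2)^m * a m z" for m z
  proof -
    have 1: "(\<lambda>n. \<psi> m ((c n *\<^sub>R a n) z *\<^sub>R b n)) sums \<psi> m (K2 z)"
      by (rule bounded_linear.sums[OF blinfun.bounded_linear_right K2])
    have "(\<lambda>n. \<psi> m ((c n *\<^sub>R a n) z *\<^sub>R b n)) sums (\<psi> m ((c m *\<^sub>R a m) z *\<^sub>R b m))"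
      by (rule single[of m "\<lambda>n. \<psi> m ((c n *\<^sub>R a n) z *\<^sub>R b n)"]) (simp add: \<psi>b blinfun.bilinear_simps)
    from sums_unique2[OF 1 this] show ?thesis by (simp add: \<psi>b blinfun.bilinear_simps)
  qed
  have TKx: "(T + K) (x m) = (c m * (1/2)^m) *\<^sub>R b m" for m
    by (simp add: K_def blinfun.bilinear_simps K1x K2x)
  have \<psi>TK: "\<psi> m ((T + K) z) = c m * (1/2)^m * a m z" for m z
    by (simp add: K_def blinfun.bilinear_simps \<psi>K1 \<psi>K2 \<psi>T)
  \<comment> \<open>along \<open>\<nu> j\<close> the enumeration \<open>p\<close> stays at \<open>j\<close>\<close>
  define \<nu> where "\<nu> j k = prod_encode (j, k)" for j k :: nat
  have p\<nu>: "p (\<nu> j k) = j" for j k by (simp add: p_def \<nu>_def)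
  have \<nu>_tends: "(\<lambda>k. (1/2::real)^(\<nu> j k)) \<longlonglongrightarrow> 0" for j
  proof (rule tendsto_sandwich[of "\<lambda>_. 0"])
    show "\<forall>\<^sub>F k in sequentially. (1/2::real)^(\<nu> j k) \<le> (1/2)^k"
      by (intro always_eventually allI power_decreasing) (auto simp: \<nu>_def le_prod_encode_2)
    show "(\<lambda>k. (1/2::real)^k) \<longlonglongrightarrow> 0" by (rule LIMSEQ_power_zero) simp
  qed auto
  have kernel: "z = 0" if z: "(T + K) z = 0" for z
  proof -
    have az: "a m z = 0" for m using \<psi>TK[of m z] c_pos[of m] by (simp add: z)
    have \<theta>z: "\<theta> j z = 0" for j
    proof -
      have eq: "\<theta> j z = - ((1/2)^(\<nu> j k) * \<phi> (\<nu> j k) z)" for k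
        using az[of "\<nu> j k"] by (simp add: a_def p\<nu> blinfun.bilinear_simps)
      have "(\<lambda>k. (1/2)^(\<nu> j k) * \<phi> (\<nu> j k) z) \<longlonglongrightarrow> 0"
      proof (rule Lim_null_comparison)
        show "\<forall>\<^sub>F k in sequentially. norm ((1/2)^(\<nu> j k) * \<phi> (\<nu> j k) z) \<le> (1/2)^(\<nu> j k) * norm z"
        proof (intro always_eventually allI)
          fix k
          have "\<bar>\<phi> (\<nu> j k) z\<bar> \<le> 1 * norm z"
            using norm_blinfun[of "\<phi> (\<nu> j k)" z] mult_right_mono[OF \<phi>_norm[of "\<nu> j k"], of "norm z"] by simp
          then show "norm ((1/2)^(\<nu> j k) * \<phi> (\<nu> j k) z) \<le> (1/2)^(\<nu> j k) * norm z"
            by (simp add: abs_mult mult_left_mono)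
        qed
        show "(\<lambda>k. (1/2)^(\<nu> j k) * norm z) \<longlonglongrightarrow> 0" using tendsto_mult_left_zero[OF \<nu>_tends] by simp
      qed
      from tendsto_minus[OF this] have "(\<lambda>k. \<theta> j z) \<longlonglongrightarrow> 0"
        by (simp only: eq[symmetric] minus_zero)
      then show ?thesis by (simp add: LIMSEQ_const_iff)
    qed
    have "\<phi> n z = 0" for n using az[of n] by (simp add: a_def \<theta>z blinfun.bilinear_simps)
    then have "u j z = 0" for j using \<theta>z[of j] by (simp add: \<theta>_def blinfun.bilinear_simps)
    then show ?thesis by (rule total)
  qed
  have "inj (blinfun_apply (T + K))"
  proof (rule injI)
    fix z z' assume "(T + K) z = (T + K) z'"
    then have "(T + K) (z - z') = 0" by (simp only: blinfun.diff_right right_minus_eq)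
    then show "z = z'" using kernel by fastforce
  qed
  moreover have "closure (range (blinfun_apply (T + K))) = UNIV"
  proof -
    define R where "R = closure (range (blinfun_apply (T + K)))"
    have "subspace (range (blinfun_apply (T + K)))"
      by (rule linear_subspace_image[OF _ subspace_UNIV]) (simp add: blinfun.bounded_linear_right bounded_linear.linear)
    then have sR: "subspace R" unfolding R_def by (rule subspace_closure)
    have cR: "closed R" by (simp add: R_def)
    have bR: "b m \<in> R" for m
    proof -
      have "(c m * (1/2)^m) *\<^sub>R b m \<in> R" using closure_subset[of "range (blinfun_apply (T + K))"] TKx[of m, symmetric]
        unfolding R_def by (auto intro: subsetD)
      from subspace_scale[OF sR this, of "inverse (c m * (1/2)^m)"]
      have "(inverse (c m * (1/2)^m) * (c m * (1/2)^m)) *\<^sub>R b m \<in> R" by (simp only: scaleR_scaleR)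
      moreover have "inverse (c m * (1/2)^m) * (c m * (1/2)^m) = 1" using c_pos[of m] by (intro left_inverse) simp
      ultimately show ?thesis by simp
    qed
    have wR: "w j \<in> R" for j
    proof (rule closed_sequentially[OF cR])
      show "b (\<nu> j k) \<in> R" for k by (rule bR)
      have "(\<lambda>k. (1/2)^(\<nu> j k) *\<^sub>R y (\<nu> j k)) \<longlonglongrightarrow> 0"
      proof (rule Lim_null_comparison[OF _ \<nu>_tends])
        show "\<forall>\<^sub>F k in sequentially. norm ((1/2)^(\<nu> j k) *\<^sub>R y (\<nu> j k)) \<le> (1/2)^(\<nu> j k)"
          using y_norm by (intro always_eventually allI) (simp add: mult_left_le)
      qed
      from tendsto_add[OF tendsto_const[of "w j"] this] show "(\<lambda>k. b (\<nu> j k)) \<longlonglongrightarrow> w j"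
        by (simp add: b_def p\<nu>)
    qed
    have yR: "y n \<in> R" for n
    proof -
      have "(1/2)^n *\<^sub>R y n \<in> R" using subspace_diff[OF sR bR[of n] wR[of "p n"]] by (simp add: b_def)
      from subspace_scale[OF sR this, of "2^n"] show ?thesis by (simp add: power_one_over)
    qed
    have "v j = w j + (\<Sum>n | \<psi> n (v j) \<noteq> 0. \<psi> n (v j) *\<^sub>R y n)" for j by (simp add: w_def)
    moreover have "w j + (\<Sum>n | \<psi> n (v j) \<noteq> 0. \<psi> n (v j) *\<^sub>R y n) \<in> R" for j
      by (intro subspace_add[OF sR] subspace_sum[OF sR] subspace_scale[OF sR] wR yR)
    ultimately have "v j \<in> R" for j by metis
    then have "span (range v) \<subseteq> R" by (intro span_minimal sR) auto
    then have "closure (span (range v)) \<subseteq> R" by (rule closure_minimal[OF _ cR])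
    then show ?thesis using dense by (auto simp: R_def)
  qed
  moreover have "\<not> surj (blinfun_apply (T + K))"
  proof
    assume surj: "surj (blinfun_apply (T + K))"
    \<comment> \<open>a preimage \<open>z\<close> of \<open>\<Sum>n. t n *\<^sub>R y n\<close> would satisfy \<open>a n z = n * (1 + norm (a n))\<close> for all \<open>n\<close>\<close>
    define t where "t n = real n * (c n * (1/2)^n * (1 + norm (a n)))" for n
    have t_bound: "norm (t n *\<^sub>R y n) \<le> real n * (1/2)^n" for n
    proof -
      have "c n * (1 + norm (a n)) = (1/2)^n / (1 + norm (b n))" using pos[of n] by (simp add: c_def)
      also have "\<dots> \<le> 1" using pos[of n] power_le_one[of "1/2::real" n] by (simp add: divide_le_eq) (smt (verit) norm_ge_zero)
      finally have "c n * (1 + norm (a n)) \<le> 1" .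
      then have "real n * (1/2)^n * (c n * (1 + norm (a n))) \<le> real n * (1/2)^n * 1"
        by (rule mult_left_mono) simp
      then have "t n \<le> real n * (1/2)^n" by (simp add: t_def ac_simps)
      moreover have "t n \<ge> 0" using c_pos[of n] pos[of n] by (simp add: t_def)
      ultimately show ?thesis using mult_mono[OF _ y_norm[of n], of "t n" "real n * (1/2)^n"] by simp
    qed
    have "summable (\<lambda>n. real n * (1/2)^n)"
    proof (rule summable_comparison_test'[OF sums_summable[OF geometric_deriv_sums[of "1/2::real"]]])
      show "norm (real n * (1/2)^n) \<le> of_nat (Suc n) * (1/2)^n" for n by (simp add: mult_right_mono)
    qed simp
    then have "summable (\<lambda>n. t n *\<^sub>R y n)"
      by (rule summable_comparison_test') (rule t_bound)
    then have sy: "(\<lambda>n. t n *\<^sub>R y n) sums (\<Sum>n. t n *\<^sub>R y n)" by (rule summable_sums)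
    obtain z where z: "(T + K) z = (\<Sum>n. t n *\<^sub>R y n)" using surj by (metis surjD)
    have "a m z = real m * (1 + norm (a m))" for m
    proof -
      have "(\<lambda>n. \<psi> m (t n *\<^sub>R y n)) sums \<psi> m ((T + K) z)"
        unfolding z by (rule bounded_linear.sums[OF blinfun.bounded_linear_right sy])
      moreover have "(\<lambda>n. \<psi> m (t n *\<^sub>R y n)) sums \<psi> m (t m *\<^sub>R y m)"
        by (rule single[of m "\<lambda>n. \<psi> m (t n *\<^sub>R y n)"]) (simp add: \<psi>y blinfun.bilinear_simps)
      ultimately have "\<psi> m ((T + K) z) = t m" using sums_unique2 by (fastforce simp: \<psi>y blinfun.bilinear_simps)
      then have "c m * (1/2)^m * a m z = c m * (1/2)^m * (real m * (1 + norm (a m)))"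
        unfolding \<psi>TK by (simp add: t_def ac_simps)
      then show ?thesis using c_pos[of m] by simp
    qed
    moreover have "\<bar>a m z\<bar> \<le> (1 + norm (a m)) * norm z" for m
      using norm_blinfun[of "a m" z] norm_ge_zero[of z] unfolding distrib_right real_norm_def by linarith
    ultimately have "real m * (1 + norm (a m)) \<le> norm z * (1 + norm (a m))" for m
      using pos[of m] by (metis abs_le_D1 mult.commute)
    then have "real m \<le> norm z" for m using pos(1)[of m] by (metis mult_le_cancel_right_pos)
    then show False using reals_Archimedean2[of "norm z"] by (meson not_le)
  qed
  ultimately show ?thesis using K_range by blast
qed

section \<open>Expansion of random permutations\<close>

text \<open>The probability that a random permutation maps \<open>S\<close> into \<open>T\<close> is at most
  \<open>(card T / card A) ^ card S\<close>. Choosing the image of one point of \<open>S\<close> leaves a random permutation of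
  the remaining points with one value of \<open>T\<close> used up.\<close>

lemma card_permutes_image_subset:
  assumes "finite S" "finite A" "S \<subseteq> A" "T \<subseteq> A"
  shows "card {p. p permutes A \<and> p ` S \<subseteq> T} * card A ^ card S \<le> card T ^ card S * fact (card A)"
  using assms
proof (induction S arbitrary: A T rule: finite_induct)
  case empty
  then show ?case by (simp add: card_permutations)
next
  case (insert a S)
  define A' where "A' = A - {a}"
  define T' where "T' b = Transposition.transpose a b ` T - {a}" for b
  define Q where "Q b = {q. q permutes A' \<and> q ` S \<subseteq> T' b}" for b
  have aA: "a \<in> A" and fA': "finite A'" and SA': "S \<subseteq> A'" and fT: "finite T"
    using insert.prems insert.hyps finite_subset by (auto simp: A'_def)
  have A: "insert a A' = A" using aA by (auto simp: A'_def)
  have cA: "card A = Suc (card A')" using fA' A by (metis A'_def Diff_iff card_insert_disjoint singletonI)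
  have sub: "{p. p permutes A \<and> p ` insert a S \<subseteq> T} \<subseteq> (\<lambda>(b, q). Transposition.transpose a b \<circ> q) ` (SIGMA b:T. Q b)"
  proof
    fix p assume "p \<in> {p. p permutes A \<and> p ` insert a S \<subseteq> T}"
    then have p: "p permutes A" and pT: "p a \<in> T" "p ` S \<subseteq> T" by auto
    define q where "q = Transposition.transpose a (p a) \<circ> p"
    have "q permutes A'" using permutes_insert_lemma[of p a A'] p A by (simp add: q_def)
    moreover have "q x \<in> T' (p a)" if "x \<in> S" for x
    proof -
      have "x \<noteq> a" using that insert.hyps by auto
      then have "p x \<noteq> p a" using permutes_inj[OF p] by (auto dest: injD)
      then have "q x \<noteq> a" by (auto simp: q_def transpose_eq_iff)
      then show ?thesis using that pT by (auto simp: q_def T'_def)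
    qed
    moreover have "p = Transposition.transpose a (p a) \<circ> q" by (simp add: q_def fun_eq_iff)
    ultimately show "p \<in> (\<lambda>(b, q). Transposition.transpose a b \<circ> q) ` (SIGMA b:T. Q b)"
      using pT(1) by (auto simp: Q_def image_iff intro!: bexI[of _ "(p a, q)"])
  qed
  have finQ: "finite (Q b)" for b
    using finite_subset[OF _ finite_permutations[OF fA']] by (auto simp: Q_def)
  have Q_le: "card (Q b) * card A ^ card S \<le> card T ^ card S * fact (card A')" if b: "b \<in> T" for b
  proof -
    have cT': "card (T' b) = card T - 1"
    proof -
      have "a \<in> Transposition.transpose a b ` T" using b by (metis imageI transpose_apply_second)
      moreover have "card (Transposition.transpose a b ` T) = card T" by (rule card_image, rule inj_on_inverseI[of _ "Transposition.transpose a b"]) simp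
      ultimately show ?thesis using fT by (simp add: T'_def)
    qed
    have T'A: "T' b \<subseteq> A'"
    proof
      fix y assume "y \<in> T' b"
      then obtain x where "x \<in> T" "y = Transposition.transpose a b x" "y \<noteq> a" by (auto simp: T'_def)
      then show "y \<in> A'" using b insert.prems aA
        by (auto simp: A'_def Transposition.transpose_def split: if_splits)
    qed
    have IH: "card (Q b) * card A' ^ card S \<le> card (T' b) ^ card S * fact (card A')"
      unfolding Q_def by (rule insert.IH[OF fA' SA' T'A])
    have "card T \<le> card A" using insert.prems card_mono by blast
    then have le: "(card T - 1) * card A \<le> card T * card A'"
      unfolding cA by (cases "card T") (auto simp: algebra_simps)
    have "card (Q b) * card A ^ card S * card A' ^ card S = (card (Q b) * card A' ^ card S) * card A ^ card S"
      by simp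
    also have "\<dots> \<le> (card (T' b) ^ card S * fact (card A')) * card A ^ card S" using IH by (rule mult_right_mono) simp
    also have "\<dots> = ((card T - 1) * card A) ^ card S * fact (card A')" by (simp add: cT' power_mult_distrib)
    also have "\<dots> \<le> (card T * card A') ^ card S * fact (card A')"
      using le by (intro mult_right_mono power_mono) auto
    finally have ineq: "card (Q b) * card A ^ card S * card A' ^ card S \<le> card T ^ card S * fact (card A') * card A' ^ card S"
      by (simp add: power_mult_distrib ac_simps)
    have "card A' ^ card S > 0"
    proof (cases "S = {}")
      case False
      then have "A' \<noteq> {}" using SA' by blast
      then show ?thesis using fA' by (simp add: card_gt_0_iff)
    qed simp
    then show ?thesis using ineq by (simp only: mult_le_cancel2)
  qed
  have "card {p. p permutes A \<and> p ` insert a S \<subseteq> T} \<le> card (SIGMA b:T. Q b)"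
    by (rule surj_card_le[OF _ sub]) (use fT finQ in auto)
  also have "\<dots> = (\<Sum>b\<in>T. card (Q b))" by (rule card_SigmaI) (use fT finQ in auto)
  finally have "card {p. p permutes A \<and> p ` insert a S \<subseteq> T} * card A ^ card S
      \<le> (\<Sum>b\<in>T. card (Q b) * card A ^ card S)"
    unfolding sum_distrib_right[symmetric] by (rule mult_right_mono) simp
  also have "\<dots> \<le> (\<Sum>b\<in>T. card T ^ card S * fact (card A'))" by (rule sum_mono) (rule Q_le)
  also have "\<dots> = card T ^ card (insert a S) * fact (card A')" using insert.hyps by simp
  finally have "card {p. p permutes A \<and> p ` insert a S \<subseteq> T} * card A ^ card S * card A
      \<le> card T ^ card (insert a S) * fact (card A') * card A" by (rule mult_right_mono) simp
  then show ?case using insert.hyps by (simp add: cA algebra_simps)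
qed

lemma binomial_upper_bound:
  assumes "k > 0"
  shows "real (n choose k) \<le> (3 * real n / real k) ^ k"
proof -
  have "(\<Sum>i\<in>{k}. real k ^ i /\<^sub>R fact i) \<le> exp (real k)"
    unfolding exp_def by (rule sum_le_suminf) (auto intro: summable_exp)
  also have "exp (real k) = exp 1 ^ k" by (simp add: exp_of_nat_mult[symmetric])
  also have "\<dots> \<le> 3 ^ k" using exp_le by (intro power_mono) auto
  finally have k: "real k ^ k \<le> 3 ^ k * fact k" by (simp add: divide_simps)
  have "real (n choose k) * fact k = real ((n choose k) * fact k)" by simp
  also have "\<dots> \<le> real (n ^ k)" using binomial_fact_pow by (intro of_nat_mono) simp
  finally have n: "real (n choose k) * fact k \<le> real n ^ k" by simp
  have "real (n choose k) * real k ^ k \<le> real (n choose k) * (3 ^ k * fact k)"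
    using k by (rule mult_left_mono) simp
  also have "\<dots> = 3 ^ k * (real (n choose k) * fact k)" by simp
  also have "\<dots> \<le> 3 ^ k * real n ^ k" using n by (rule mult_left_mono) simp
  finally show ?thesis using assms by (simp add: power_divide power_mult_distrib pos_le_divide_eq)
qed

definition perm_tuples :: "nat \<Rightarrow> (nat \<Rightarrow> nat \<Rightarrow> nat) set"
  where "perm_tuples n = {..<5} \<rightarrow>\<^sub>E {p. p permutes {..<n}}"

text \<open>The degree \<open>5\<close>, the expansion factor \<open>3\<close> and the density \<open>1 / 5832\<close> are tied together: the factor has
  to exceed half of the degree and stay below the degree minus one, and \<open>5832 = 8 * 729\<close> makes the union
  bound in \<open>few_nonexpanding\<close> a geometric series with ratio \<open>1 / 8\<close>.\<close>

definition expanding :: "nat \<Rightarrow> (nat \<Rightarrow> nat \<Rightarrow> nat) \<Rightarrow> bool"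
  where "expanding n \<pi> \<longleftrightarrow> (\<forall>S\<subseteq>{..<n}. 5832 * card S \<le> n \<longrightarrow> 3 * card S \<le> card (\<Union>c<5. \<pi> c ` S))"

lemma finite_perm_tuples: "finite (perm_tuples n)"
  unfolding perm_tuples_def by (intro finite_PiE finite_permutations) auto

lemma card_perm_tuples: "card (perm_tuples n) = fact n ^ 5"
  unfolding perm_tuples_def by (simp add: card_PiE card_permutations)

lemma perm_tuples_permutes: "\<pi> \<in> perm_tuples n \<Longrightarrow> c < 5 \<Longrightarrow> \<pi> c permutes {..<n}"
  by (auto simp: perm_tuples_def)

text \<open>Union bound over the sets \<open>S\<close> of size \<open>s\<close> and the sets \<open>T\<close> of size \<open>3 * s\<close> that could contain all five
  images. The number of pairs is at most \<open>(3 * n / s) ^ s * (n / s) ^ (3 * s)\<close>, the probability for a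
  pair at most \<open>(3 * s / n) ^ (5 * s)\<close>, and the product is \<open>(729 * s / n) ^ s\<close>.\<close>

lemma few_nonexpanding: "7 * card {\<pi> \<in> perm_tuples n. \<not> expanding n \<pi>} \<le> card (perm_tuples n)"
proof -
  define E where "E S T = {\<pi> \<in> perm_tuples n. \<forall>c<5. \<pi> c ` S \<subseteq> T}" for S T
  define m where "m = n div 5832"
  define B where "B s = (\<Union>S\<in>{S. S \<subseteq> {..<n} \<and> card S = s}. \<Union>T\<in>{T. T \<subseteq> {..<n} \<and> card T = 3 * s}. E S T)" for s
  have finE: "finite (E S T)" for S T using finite_perm_tuples by (simp add: E_def)
  have fin: "finite {S. S \<subseteq> {..<n} \<and> card S = s}" for s :: nat
    by (rule finite_subset[of _ "Pow {..<n}"]) auto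
  have sub: "{\<pi> \<in> perm_tuples n. \<not> expanding n \<pi>} \<subseteq> (\<Union>s\<in>{1..m}. B s)"
  proof
    fix \<pi> assume "\<pi> \<in> {\<pi> \<in> perm_tuples n. \<not> expanding n \<pi>}"
    then obtain S where \<pi>: "\<pi> \<in> perm_tuples n" and S: "S \<subseteq> {..<n}" "5832 * card S \<le> n"
      and small: "card (\<Union>c<5. \<pi> c ` S) < 3 * card S"
      by (auto simp: expanding_def not_le)
    have "(\<Union>c<5. \<pi> c ` S) \<subseteq> {..<n}"
      using S(1) permutes_in_image[OF perm_tuples_permutes[OF \<pi>]] by blast
    from exists_subset_between[OF _ _ this, of "3 * card S"] small S(2)
    obtain T where T: "(\<Union>c<5. \<pi> c ` S) \<subseteq> T" "T \<subseteq> {..<n}" "card T = 3 * card S" by auto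
    then have "\<pi> \<in> E S T" using \<pi> by (auto simp: E_def)
    then have "\<pi> \<in> B (card S)" using S T unfolding B_def by blast
    moreover have "card S \<in> {1..m}" using small S(2) by (simp add: m_def less_eq_div_iff_mult_less_eq mult.commute)
    ultimately show "\<pi> \<in> (\<Union>s\<in>{1..m}. B s)" by blast
  qed
  have B_bound: "real (card (B s)) \<le> (1/8) ^ s * fact n ^ 5" if s: "s \<in> {1..m}" for s
  proof -
    have s0: "s > 0" and sn: "5832 * s \<le> n"
      using s by (auto simp: m_def less_eq_div_iff_mult_less_eq mult.commute)
    then have n0: "n > 0" by simp
    define q where "q = (3 * real s / real n) ^ s * fact n"
    have E_le: "real (card (E S T)) \<le> q ^ 5" if S: "S \<subseteq> {..<n}" "card S = s" and T: "T \<subseteq> {..<n}" "card T = 3 * s" for S T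
    proof -
      have finS: "finite S" using S(1) finite_subset by blast
      have "E S T \<subseteq> {..<5} \<rightarrow>\<^sub>E {p. p permutes {..<n} \<and> p ` S \<subseteq> T}"
        by (auto simp: E_def perm_tuples_def PiE_iff extensional_def image_subset_iff)
      moreover have fP: "finite {p. p permutes {..<n} \<and> p ` S \<subseteq> T}"
        by (rule finite_subset[OF _ finite_permutations[of "{..<n}"]]) auto
      ultimately have "card (E S T) \<le> card ({..<5::nat} \<rightarrow>\<^sub>E {p. p permutes {..<n} \<and> p ` S \<subseteq> T})"
        by (intro card_mono finite_PiE) auto
      also have "\<dots> = card {p. p permutes {..<n} \<and> p ` S \<subseteq> T} ^ 5" by (simp add: card_PiE)
      finally have "real (card (E S T)) \<le> real (card {p. p permutes {..<n} \<and> p ` S \<subseteq> T}) ^ 5"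
        by (metis of_nat_le_iff of_nat_power)
      also have "\<dots> \<le> q ^ 5"
      proof (rule power_mono)
        have "card {p. p permutes {..<n} \<and> p ` S \<subseteq> T} * n ^ s \<le> (3 * s) ^ s * fact n"
          using card_permutes_image_subset[OF finS, of "{..<n}" T] S T by simp
        then have "real (card {p. p permutes {..<n} \<and> p ` S \<subseteq> T}) * real n ^ s \<le> (3 * real s) ^ s * fact n"
          by (metis (mono_tags, lifting) of_nat_fact of_nat_le_iff of_nat_mult of_nat_numeral of_nat_power)
        then show "real (card {p. p permutes {..<n} \<and> p ` S \<subseteq> T}) \<le> q"
          using n0 by (simp add: q_def power_divide pos_le_divide_eq)
      qed simp
      finally show ?thesis .
    qed
    have "card (B s) \<le> (\<Sum>S\<in>{S. S \<subseteq> {..<n} \<and> card S = s}. card (\<Union>T\<in>{T. T \<subseteq> {..<n} \<and> card T = 3 * s}. E S T))"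
      unfolding B_def by (rule card_UN_le[OF fin])
    also have "\<dots> \<le> (\<Sum>S\<in>{S. S \<subseteq> {..<n} \<and> card S = s}. \<Sum>T\<in>{T. T \<subseteq> {..<n} \<and> card T = 3 * s}. card (E S T))"
      by (intro sum_mono card_UN_le fin)
    finally have "real (card (B s)) \<le> (\<Sum>S\<in>{S. S \<subseteq> {..<n} \<and> card S = s}. \<Sum>T\<in>{T. T \<subseteq> {..<n} \<and> card T = 3 * s}. real (card (E S T)))"
      by (metis (mono_tags, lifting) of_nat_le_iff of_nat_sum sum.cong)
    also have "\<dots> \<le> (\<Sum>S\<in>{S. S \<subseteq> {..<n} \<and> card S = s}. \<Sum>T\<in>{T. T \<subseteq> {..<n} \<and> card T = 3 * s}. q ^ 5)"
      by (intro sum_mono E_le) auto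
    also have "\<dots> = real (n choose s) * (real (n choose (3 * s)) * q ^ 5)"
      using n_subsets[of "{..<n}"] by simp
    also have "\<dots> \<le> (3 * real n / real s) ^ s * ((3 * real n / real (3 * s)) ^ (3 * s) * q ^ 5)"
      using s0 by (intro mult_mono binomial_upper_bound mult_nonneg_nonneg) (auto simp: q_def)
    also have "\<dots> = (3 * real n / real s * (real n / real s) ^ 3 * (3 * real s / real n) ^ 5) ^ s * fact n ^ 5"
    proof -
      have "A ^ s * (B ^ (3 * s) * (D ^ s * f) ^ 5) = (A * B ^ 3 * D ^ 5) ^ s * f ^ 5" for A B D f :: real
      proof -
        have "(D ^ s) ^ 5 = (D ^ 5) ^ s" "B ^ (3 * s) = (B ^ 3) ^ s"
          by (metis mult.commute power_mult)+
        then show ?thesis by (simp only: power_mult_distrib mult.assoc)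
      qed
      moreover have "3 * real n / real (3 * s) = real n / real s" by simp
      ultimately show ?thesis by (simp only: q_def)
    qed
    also have "3 * real n / real s * (real n / real s) ^ 3 * (3 * real s / real n) ^ 5 = 729 * real s / real n"
      using s0 n0 by (simp add: field_simps power_numeral_reduce)
    also have "(729 * real s / real n) ^ s * fact n ^ 5 \<le> (1/8) ^ s * fact n ^ 5"
    proof (intro mult_right_mono power_mono)
      have "5832 * real s \<le> real n" using sn by (metis of_nat_le_iff of_nat_mult of_nat_numeral)
      then show "729 * real s / real n \<le> 1/8" using n0 by (simp add: divide_simps)
    qed auto
    finally show ?thesis .
  qed
  have finB: "finite (B s)" for s unfolding B_def using finE fin by blast
  have "real (card {\<pi> \<in> perm_tuples n. \<not> expanding n \<pi>}) \<le> real (card (\<Union>s\<in>{1..m}. B s))"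
    using card_mono[OF _ sub] finB by simp
  also have "\<dots> \<le> (\<Sum>s\<in>{1..m}. real (card (B s)))"
    using card_UN_le[of "{1..m}" B] by (metis finite_atLeastAtMost of_nat_le_iff of_nat_sum)
  also have "\<dots> \<le> (\<Sum>s\<in>{1..m}. (1/8) ^ s * fact n ^ 5)" by (rule sum_mono[OF B_bound])
  also have "\<dots> = (\<Sum>s\<in>{1..m}. (1/8) ^ s) * fact n ^ 5" by (rule sum_distrib_right[symmetric])
  also have "\<dots> \<le> 1/7 * fact n ^ 5"
  proof (rule mult_right_mono)
    have "7 * (\<Sum>s\<in>{1..m}. (1/8::real) ^ s) = 1 - (1/8) ^ m"
      by (induction m) (simp_all add: algebra_simps)
    moreover have "(1/8::real) ^ m \<ge> 0" by simp
    ultimately show "(\<Sum>s\<in>{1..m}. (1/8::real) ^ s) \<le> 1/7" by linarith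
  qed simp
  finally have "7 * real (card {\<pi> \<in> perm_tuples n. \<not> expanding n \<pi>}) \<le> fact n ^ 5" by simp
  then have "real (7 * card {\<pi> \<in> perm_tuples n. \<not> expanding n \<pi>}) \<le> real (card (perm_tuples n))"
    by (simp add: card_perm_tuples)
  then show ?thesis by (rule of_nat_le_iff[THEN iffD1])
qed

text \<open>Restriction to the index set keeps the inverse of a tuple inside the extensional function space
  \<open>perm_tuples\<close>.\<close>

definition invs :: "(nat \<Rightarrow> nat \<Rightarrow> nat) \<Rightarrow> nat \<Rightarrow> nat \<Rightarrow> nat"
  where "invs \<pi> = restrict (\<lambda>c. inv (\<pi> c)) {..<5}"

lemma few_nonexpanding_inverse: "7 * card {\<pi> \<in> perm_tuples n. \<not> expanding n (invs \<pi>)} \<le> card (perm_tuples n)"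
proof -
  have invs_in: "invs \<pi> \<in> perm_tuples n" if "\<pi> \<in> perm_tuples n" for \<pi>
    using that permutes_inv by (auto simp: invs_def perm_tuples_def PiE_iff)
  have invs_invs: "invs (invs \<pi>) = \<pi>" if "\<pi> \<in> perm_tuples n" for \<pi>
  proof
    fix c show "invs (invs \<pi>) c = \<pi> c"
      using that permutes_inv_inv[of "\<pi> c" "{..<n}"]
      by (cases "c < 5") (auto simp: invs_def perm_tuples_def PiE_iff extensional_def)
  qed
  have "inj_on invs {\<pi> \<in> perm_tuples n. \<not> expanding n (invs \<pi>)}"
    by (rule inj_on_inverseI[of _ invs]) (simp add: invs_invs)
  moreover have "invs ` {\<pi> \<in> perm_tuples n. \<not> expanding n (invs \<pi>)} \<subseteq> {\<pi> \<in> perm_tuples n. \<not> expanding n \<pi>}"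
    using invs_in by auto
  ultimately have "card {\<pi> \<in> perm_tuples n. \<not> expanding n (invs \<pi>)} \<le> card {\<pi> \<in> perm_tuples n. \<not> expanding n \<pi>}"
    using finite_perm_tuples by (intro card_inj_on_le) auto
  then show ?thesis using few_nonexpanding[of n] by linarith
qed

section \<open>The bipartite graph of a tuple of permutations\<close>

definition verts :: "nat \<Rightarrow> (nat \<times> bool) set"
  where "verts n = {..<n} \<times> UNIV"

text \<open>The two copies of \<open>{..<n}\<close> are the sides of a bipartite graph, and \<open>nbr \<pi> c v\<close> is the neighbour of
  \<open>v\<close> along the edge of colour \<open>c\<close>. This makes each colour an involution.\<close>

definition nbr :: "(nat \<Rightarrow> nat \<Rightarrow> nat) \<Rightarrow> nat \<Rightarrow> nat \<times> bool \<Rightarrow> nat \<times> bool"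
  where "nbr \<pi> c v = (if snd v then (inv (\<pi> c) (fst v), False) else (\<pi> c (fst v), True))"

lemma finite_verts [simp]: "finite (verts n)" and card_verts: "card (verts n) = 2 * n"
  by (simp_all add: verts_def card_cartesian_product)

lemma nbr_nbr:
  assumes "\<pi> c permutes A"
  shows "nbr \<pi> c (nbr \<pi> c v) = v"
  using permutes_inverses[OF assms] by (cases v) (auto simp: nbr_def)

lemma nbr_in_verts:
  assumes "\<pi> c permutes {..<n}"
  shows "nbr \<pi> c v \<in> verts n \<longleftrightarrow> v \<in> verts n"
  using permutes_in_image[OF assms] permutes_in_image[OF permutes_inv[OF assms]]
  by (cases v) (auto simp: nbr_def verts_def)

lemma nbr_expanding:
  assumes \<pi>: "\<pi> \<in> perm_tuples n" and e: "expanding n \<pi>" "expanding n (invs \<pi>)"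
    and S: "S \<subseteq> verts n" "5832 * card S \<le> n"
  shows "3 * card S \<le> card (\<Union>c<5. nbr \<pi> c ` S)"
proof -
  define A where "A b = {x. (x, b) \<in> S}" for b
  define N where "N b = (if b then (\<Union>c<5. \<pi> c ` A False) else (\<Union>c<5. invs \<pi> c ` A True))" for b
  have finS: "finite S" using S(1) finite_subset[of S "verts n"] by simp
  have finA: "finite (A b)" for b
    by (rule finite_subset[OF _ finite_imageI[OF finS, of fst]]) (force simp: A_def)
  have finN: "finite (N b)" for b by (simp add: N_def finA)
  have split: "X = (\<lambda>x. (x, True)) ` {x. (x, True) \<in> X} \<union> (\<lambda>x. (x, False)) ` {x. (x, False) \<in> X}"
    for X :: "(nat \<times> bool) set"
  proof -
    have "z \<in> X \<longleftrightarrow> z \<in> (\<lambda>x. (x, True)) ` {x. (x, True) \<in> X} \<union> (\<lambda>x. (x, False)) ` {x. (x, False) \<in> X}" for z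
      by (cases z; cases "snd z") auto
    then show ?thesis by blast
  qed
  have card_split: "card X = card {x. (x, True) \<in> X} + card {x. (x, False) \<in> X}"
    if "finite {x. (x, True) \<in> X}" "finite {x. (x, False) \<in> X}" for X :: "(nat \<times> bool) set"
    by (subst split, subst card_Un_disjoint) (use that in \<open>auto simp: card_image inj_on_def\<close>)
  have cS: "card S = card (A True) + card (A False)"
    using card_split[of S] finA by (simp add: A_def)
  have N: "{x. (x, b) \<in> (\<Union>c<5. nbr \<pi> c ` S)} = N b" for b
    by (cases b) (force simp: N_def A_def nbr_def invs_def image_iff)+
  have "card (\<Union>c<5. nbr \<pi> c ` S) = card (N True) + card (N False)"
    using card_split[of "\<Union>c<5. nbr \<pi> c ` S"] finN unfolding N by simp
  moreover have "A b \<subseteq> {..<n}" for b using S(1) by (auto simp: A_def verts_def)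
  then have "3 * card (A False) \<le> card (N True)" "3 * card (A True) \<le> card (N False)"
    using e S(2) cS by (simp_all add: expanding_def N_def)
  ultimately show ?thesis using cS by simp
qed

section \<open>Random permutations have few short cycles\<close>

text \<open>Relabelling \<open>(a, b)\<close> and \<open>(a', b)\<close> as each other, but only as endpoints of edges of colour \<open>c\<close>.\<close>

definition switch :: "nat \<Rightarrow> nat \<Rightarrow> nat \<Rightarrow> bool \<Rightarrow> (nat \<Rightarrow> nat \<Rightarrow> nat) \<Rightarrow> nat \<Rightarrow> nat \<Rightarrow> nat"
  where "switch c a a' b \<pi> = \<pi>(c := if b then Transposition.transpose a a' \<circ> \<pi> c else \<pi> c \<circ> Transposition.transpose a a')"

lemma switch_switch [simp]: "switch c a a' b (switch c a a' b \<pi>) = \<pi>"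
  by (auto simp: switch_def fun_eq_iff)

lemma switch_perm_tuples:
  assumes "\<pi> \<in> perm_tuples n" "c < 5" "a < n" "a' < n"
  shows "switch c a a' b \<pi> \<in> perm_tuples n"
proof -
  have t: "Transposition.transpose a a' permutes {..<n}" using assms by (intro permutes_swap_id) auto
  have "(if b then Transposition.transpose a a' \<circ> \<pi> c else \<pi> c \<circ> Transposition.transpose a a') permutes {..<n}"
    using permutes_compose[OF t perm_tuples_permutes[OF assms(1,2)]] permutes_compose[OF perm_tuples_permutes[OF assms(1,2)] t] by simp
  then show ?thesis using assms by (auto simp: switch_def perm_tuples_def PiE_iff extensional_def)
qed

lemma nbr_switch_other: "c' \<noteq> c \<Longrightarrow> nbr (switch c a a' b \<pi>) c' v = nbr \<pi> c' v"
  by (simp add: nbr_def switch_def)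

lemma nbr_switch:
  assumes p: "\<pi> c permutes A"
  shows "nbr (switch c a a' b \<pi>) c v
    = Transposition.transpose (a, b) (a', b) (nbr \<pi> c (Transposition.transpose (a, b) (a', b) v))"
proof -
  have bij: "bij (\<pi> c)" using p by (rule permutes_bij)
  have bt: "bij (Transposition.transpose a a')" by simp
  have it: "inv (Transposition.transpose a a' \<circ> \<pi> c) = inv (\<pi> c) \<circ> Transposition.transpose a a'"
    "inv (\<pi> c \<circ> Transposition.transpose a a') = Transposition.transpose a a' \<circ> inv (\<pi> c)"
    using o_inv_distrib[OF bt bij] o_inv_distrib[OF bij bt] by simp_all
  have tp: "Transposition.transpose (a, e) (a', e) (x, d) = (if d = e then (Transposition.transpose a a' x, d) else (x, d))" for x d e
    by (auto simp: Transposition.transpose_def)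
  show ?thesis
    by (cases v; cases "snd v"; cases b) (simp_all add: nbr_def switch_def it tp)
qed

definition traj :: "(nat \<Rightarrow> nat \<Rightarrow> nat) \<Rightarrow> nat list \<Rightarrow> nat \<times> bool \<Rightarrow> nat \<Rightarrow> nat \<times> bool"
  where "traj \<pi> u z j = fold (nbr \<pi>) (take j u) z"

lemma traj_0 [simp]: "traj \<pi> u z 0 = z" by (simp add: traj_def)

lemma traj_Suc: "j < length u \<Longrightarrow> traj \<pi> u z (Suc j) = nbr \<pi> (u ! j) (traj \<pi> u z j)"
  by (simp add: traj_def take_Suc_conv_app_nth)

lemma traj_in_verts:
  assumes "\<pi> \<in> perm_tuples n" "set u \<subseteq> {..<5}" "z \<in> verts n" "j \<le> length u"
  shows "traj \<pi> u z j \<in> verts n"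
  using assms(4)
proof (induction j)
  case (Suc j)
  then have "u ! j \<in> set u" by simp
  then have "\<pi> (u ! j) permutes {..<n}" using assms(1,2) perm_tuples_permutes by auto
  then show ?case using Suc by (simp add: traj_Suc nbr_in_verts)
qed (simp add: assms)

text \<open>Only edges of colour \<open>u ! l\<close> at \<open>(a, b)\<close> and \<open>(a', b)\<close> have moved. An earlier step along the one
  at \<open>(a, b)\<close> would have started or ended at the position of time \<open>l\<close>, which is excluded since the walk
  has not met itself yet and consecutive colours differ; \<open>(a', b)\<close> has not been visited.\<close>

lemma traj_switch:
  assumes \<pi>: "\<pi> \<in> perm_tuples n" and u: "set u \<subseteq> {..<5}" "distinct_adj u" and l: "Suc l \<le> length u"
    and inj: "inj_on (traj \<pi> u z) {..l}" and x: "traj \<pi> u z (Suc l) = (a, b)"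
    and a': "(a', b) \<notin> traj \<pi> u z ` {..l}" and j: "j \<le> l"
  shows "traj (switch (u ! l) a a' b \<pi>) u z j = traj \<pi> u z j"
  using j
proof (induction j)
  case (Suc j)
  define c where "c = u ! l"
  have perm: "\<pi> (u ! i) permutes {..<n}" if "i < length u" for i
    using that u(1) perm_tuples_permutes[OF \<pi>] by (meson lessThan_iff nth_mem subset_iff)
  have pc: "\<pi> c permutes {..<n}" using perm l by (simp add: c_def)
  note invol = nbr_nbr[of \<pi> c, OF pc]
  have jl: "j < length u" "j < l" using Suc l by auto
  have IH: "traj (switch (u ! l) a a' b \<pi>) u z j = traj \<pi> u z j" using Suc by simp
  have step: "traj \<pi> u z (Suc j) = nbr \<pi> (u ! j) (traj \<pi> u z j)" using jl by (simp add: traj_Suc)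
  have last: "(a, b) = nbr \<pi> c (traj \<pi> u z l)" using x l by (simp add: traj_Suc c_def)
  show ?case
  proof (cases "u ! j = c")
    case False
    then show ?thesis using IH step jl by (simp add: traj_Suc nbr_switch_other c_def)
  next
    case True
    have ne_a': "traj \<pi> u z i \<noteq> (a', b)" if "i \<le> l" for i using a' that by (metis atMost_iff imageI)
    have "traj \<pi> u z (Suc j) \<noteq> (a, b)"
    proof
      assume "traj \<pi> u z (Suc j) = (a, b)"
      then have "traj \<pi> u z j = traj \<pi> u z l" using step last True invol by metis
      then show False using inj jl by (auto dest: inj_onD)
    qed
    moreover have "traj \<pi> u z j \<noteq> (a, b)"
    proof
      assume "traj \<pi> u z j = (a, b)"
      then have "traj \<pi> u z (Suc j) = traj \<pi> u z l" using step last True invol by metis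
      then have "Suc j = l" using inj jl by (auto dest: inj_onD)
      then have "u ! j \<noteq> u ! l" using distinct_adj_nth[OF u(2), of j] l by auto
      then show False using True by (simp add: c_def)
    qed
    ultimately show ?thesis
      using IH step jl True ne_a'[of j] ne_a'[of "Suc j"] nbr_switch[of \<pi> c, OF pc]
      by (simp add: traj_Suc c_def[symmetric])
  qed
qed simp

text \<open>Switching: if the walk first meets itself at time \<open>l + 1\<close>, its last edge can be redirected to any of
  at least \<open>n - (l + 1)\<close> fresh vertices. The new tuple together with the time at which the meeting
  point had been visited determines the old tuple, so the tuples with a collision are rare.\<close>

lemma few_collisions_at:
  assumes u: "set u \<subseteq> {..<5}" "distinct_adj u" and l: "Suc l \<le> length u" and z: "z \<in> verts n"
  shows "card {\<pi> \<in> perm_tuples n. inj_on (traj \<pi> u z) {..l} \<and> traj \<pi> u z (Suc l) \<in> traj \<pi> u z ` {..l}} * (n - Suc l)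
    \<le> Suc l * card (perm_tuples n)"
proof -
  define A where "A = {\<pi> \<in> perm_tuples n. inj_on (traj \<pi> u z) {..l} \<and> traj \<pi> u z (Suc l) \<in> traj \<pi> u z ` {..l}}"
  define C where "C \<pi> = {..<n} - fst ` traj \<pi> u z ` {..l}" for \<pi>
  define x where "x \<pi> = traj \<pi> u z (Suc l)" for \<pi>
  define k where "k \<pi> = (SOME k. k \<le> l \<and> traj \<pi> u z k = x \<pi>)" for \<pi>
  define new where "new \<pi> a' = switch (u ! l) (fst (x \<pi>)) a' (snd (x \<pi>)) \<pi>" for \<pi> a'
  define \<Phi> where "\<Phi> = (\<lambda>(\<pi>, a'). (new \<pi> a', k \<pi>))"
  have c5: "u ! l < 5" using u(1) l by (meson Suc_le_lessD lessThan_iff nth_mem subset_iff)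
  have finA: "finite A" using finite_perm_tuples by (simp add: A_def)
  have k: "k \<pi> \<le> l" "traj \<pi> u z (k \<pi>) = x \<pi>" if "\<pi> \<in> A" for \<pi>
  proof -
    have "\<exists>k. k \<le> l \<and> traj \<pi> u z k = x \<pi>" using that by (auto simp: A_def x_def)
    from someI_ex[OF this] show "k \<pi> \<le> l" "traj \<pi> u z (k \<pi>) = x \<pi>" by (auto simp: k_def)
  qed
  have old: "traj (new \<pi> a') u z j = traj \<pi> u z j" if "\<pi> \<in> A" "a' \<in> C \<pi>" "j \<le> l" for \<pi> a' j
    unfolding new_def
  proof (rule traj_switch[OF _ u l])
    show "(a', snd (x \<pi>)) \<notin> traj \<pi> u z ` {..l}" 
    proof
      assume "(a', snd (x \<pi>)) \<in> traj \<pi> u z ` {..l}"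
      then have "a' \<in> fst ` traj \<pi> u z ` {..l}" by (metis fst_conv imageI)
      then show False using that(2) by (simp add: C_def)
    qed
  qed (use that in \<open>auto simp: A_def x_def\<close>)
  have last: "traj (new \<pi> a') u z (Suc l) = (a', snd (x \<pi>))" if "\<pi> \<in> A" "a' \<in> C \<pi>" for \<pi> a'
  proof -
    have pc: "\<pi> (u ! l) permutes {..<n}" using that(1) c5 perm_tuples_permutes by (auto simp: A_def)
    have xl: "x \<pi> = nbr \<pi> (u ! l) (traj \<pi> u z l)" using l by (simp add: x_def traj_Suc)
    have "snd (x \<pi>) \<noteq> snd (traj \<pi> u z l)" unfolding xl by (simp add: nbr_def)
    then have "Transposition.transpose (fst (x \<pi>), snd (x \<pi>)) (a', snd (x \<pi>)) (traj \<pi> u z l) = traj \<pi> u z l"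
      by (intro transpose_apply_other) auto
    then show ?thesis
      using l old[OF that order_refl] nbr_switch[of \<pi> "u ! l", OF pc] xl[symmetric]
      by (simp add: traj_Suc new_def)
  qed
  have "card (SIGMA \<pi>:A. C \<pi>) \<le> card (perm_tuples n \<times> {..l})"
  proof (rule card_inj_on_le)
    show "inj_on \<Phi> (SIGMA \<pi>:A. C \<pi>)"
    proof (rule inj_onI, clarify)
      fix \<pi>1 a1 \<pi>2 a2
      assume A1: "\<pi>1 \<in> A" "a1 \<in> C \<pi>1" and A2: "\<pi>2 \<in> A" "a2 \<in> C \<pi>2" and eq: "\<Phi> (\<pi>1, a1) = \<Phi> (\<pi>2, a2)"
      have n: "new \<pi>1 a1 = new \<pi>2 a2" and kk: "k \<pi>1 = k \<pi>2" using eq by (auto simp: \<Phi>_def)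
      have a: "a1 = a2" using last[OF A1] last[OF A2] n by simp
      have "x \<pi>1 = x \<pi>2"
        using k[OF A1(1)] k[OF A2(1)] old[OF A1, of "k \<pi>1"] old[OF A2, of "k \<pi>1"] kk n by simp
      then have "\<pi>1 = \<pi>2" using n a unfolding new_def by (metis switch_switch)
      then show "\<pi>1 = \<pi>2 \<and> a1 = a2" using a by simp
    qed
    show "\<Phi> ` (SIGMA \<pi>:A. C \<pi>) \<subseteq> perm_tuples n \<times> {..l}"
    proof (rule image_subsetI)
      fix q assume "q \<in> (SIGMA \<pi>:A. C \<pi>)"
      then obtain \<pi> a' where q: "q = (\<pi>, a')" and A: "\<pi> \<in> A" "a' \<in> C \<pi>" by blast
      have "x \<pi> \<in> verts n" using A(1) traj_in_verts[OF _ u(1) z l] by (auto simp: A_def x_def)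
      then have "new \<pi> a' \<in> perm_tuples n"
        unfolding new_def using A c5 by (intro switch_perm_tuples) (auto simp: A_def C_def verts_def)
      then show "\<Phi> q \<in> perm_tuples n \<times> {..l}" using k[OF A(1)] by (simp add: \<Phi>_def q)
    qed
    show "finite (perm_tuples n \<times> {..l})" using finite_perm_tuples by simp
  qed
  moreover have "card (SIGMA \<pi>:A. C \<pi>) = (\<Sum>\<pi>\<in>A. card (C \<pi>))"
    using finA by (intro card_SigmaI) (auto simp: C_def)
  moreover have "(\<Sum>\<pi>\<in>A. n - Suc l) \<le> (\<Sum>\<pi>\<in>A. card (C \<pi>))"
  proof (rule sum_mono)
    fix \<pi>
    have "card (fst ` traj \<pi> u z ` {..l}) \<le> Suc l"
      using card_image_le[of "{..l}" "fst \<circ> traj \<pi> u z"] by (simp add: image_comp)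
    then show "n - Suc l \<le> card (C \<pi>)"
      unfolding C_def using diff_card_le_card_Diff[of "fst ` traj \<pi> u z ` {..l}" "{..<n}"] by simp
  qed
  ultimately have "card A * (n - Suc l) \<le> card (perm_tuples n) * Suc l" by (simp add: card_cartesian_product)
  then show ?thesis by (simp add: A_def mult.commute)
qed

text \<open>A closed walk has a first time at which it meets itself.\<close>

lemma few_fixed:
  assumes u: "set u \<subseteq> {..<5}" "distinct_adj u" "u \<noteq> []" and z: "z \<in> verts n"
  shows "card {\<pi> \<in> perm_tuples n. fold (nbr \<pi>) u z = z} * (n - length u) \<le> length u * length u * card (perm_tuples n)"
proof -
  define A where "A l = {\<pi> \<in> perm_tuples n. inj_on (traj \<pi> u z) {..l} \<and> traj \<pi> u z (Suc l) \<in> traj \<pi> u z ` {..l}}" for l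
  have "{\<pi> \<in> perm_tuples n. fold (nbr \<pi>) u z = z} \<subseteq> (\<Union>l<length u. A l)"
  proof
    fix \<pi> assume "\<pi> \<in> {\<pi> \<in> perm_tuples n. fold (nbr \<pi>) u z = z}"
    then have \<pi>: "\<pi> \<in> perm_tuples n" and fixed: "traj \<pi> u z (length u) = traj \<pi> u z 0" by (auto simp: traj_def)
    have ninj: "\<not> inj_on (traj \<pi> u z) {..length u}"
    proof
      assume "inj_on (traj \<pi> u z) {..length u}"
      from inj_onD[OF this fixed] show False using u(3) by simp
    qed
    define m where "m = (LEAST m. \<not> inj_on (traj \<pi> u z) {..m})"
    have m: "\<not> inj_on (traj \<pi> u z) {..m}" unfolding m_def by (rule LeastI[of _ "length u"]) (rule ninj)
    have m_le: "m \<le> length u" unfolding m_def by (rule Least_le) (rule ninj)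
    obtain l where l: "m = Suc l" using m by (cases m) auto
    have inj: "inj_on (traj \<pi> u z) {..l}"
      using not_less_Least[of l "\<lambda>m. \<not> inj_on (traj \<pi> u z) {..m}"] l by (auto simp: m_def[symmetric])
    have "traj \<pi> u z (Suc l) \<in> traj \<pi> u z ` {..l}"
      using m inj unfolding l atMost_Suc by (auto simp: inj_on_insert)
    then show "\<pi> \<in> (\<Union>l<length u. A l)" using \<pi> inj m_le l by (auto simp: A_def)
  qed
  then have "card {\<pi> \<in> perm_tuples n. fold (nbr \<pi>) u z = z} \<le> card (\<Union>l<length u. A l)"
    using finite_perm_tuples by (intro card_mono) (auto simp: A_def)
  also have "\<dots> \<le> (\<Sum>l<length u. card (A l))" by (rule card_UN_le) simp
  finally have "card {\<pi> \<in> perm_tuples n. fold (nbr \<pi>) u z = z} * (n - length u) \<le> (\<Sum>l<length u. card (A l) * (n - length u))"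
    unfolding sum_distrib_right[symmetric] by (rule mult_right_mono) simp
  also have "\<dots> \<le> (\<Sum>l<length u. length u * card (perm_tuples n))"
  proof (rule sum_mono)
    fix l assume l: "l \<in> {..<length u}"
    then have "card (A l) * (n - length u) \<le> card (A l) * (n - Suc l)" by (intro mult_left_mono) auto
    also have "\<dots> \<le> Suc l * card (perm_tuples n)"
      unfolding A_def using l by (intro few_collisions_at u z) auto
    also have "\<dots> \<le> length u * card (perm_tuples n)" using l by (intro mult_right_mono) auto
    finally show "card (A l) * (n - length u) \<le> length u * card (perm_tuples n)" .
  qed
  also have "\<dots> = length u * length u * card (perm_tuples n)" by simp
  finally show ?thesis .
qed

text \<open>The two failures of expansion have probability at most \<open>1 / 7\<close> each; by Markov's inequality a large
  number of short cycles has probability at most \<open>1 / 4\<close> for large \<open>n\<close>.\<close>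

lemma exists_good_permutations:
  fixes \<epsilon> :: real
  assumes U: "finite U" "\<And>u. u \<in> U \<Longrightarrow> set u \<subseteq> {..<5} \<and> distinct_adj u \<and> u \<noteq> []" and \<epsilon>: "\<epsilon> > 0"
  shows "\<exists>n\<ge>N. \<exists>\<pi>\<in>perm_tuples n. expanding n \<pi> \<and> expanding n (invs \<pi>) \<and>
    real (card {z \<in> verts n. \<exists>u\<in>U. fold (nbr \<pi>) u z = z}) \<le> \<epsilon> * real n"
proof -
  define L where "L = (\<Sum>u\<in>U. length u)"
  have L: "length u \<le> L" if "u \<in> U" for u unfolding L_def using member_le_sum[OF that, of length] U(1) by simp
  define C where "C = 8 * real (card U) * real L * real L / \<epsilon>"
  obtain n where n: "n \<ge> N" "n > L" "C \<le> real (n - L)"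
  proof -
    obtain k where k: "C \<le> real k" using real_arch_simple by blast
    show thesis by (rule that[of "N + Suc L + k"]) (use k in auto)
  qed
  define F where "F \<pi> = {z \<in> verts n. \<exists>u\<in>U. fold (nbr \<pi>) u z = z}" for \<pi>
  define B where "B = {\<pi> \<in> perm_tuples n. \<epsilon> * real n < real (card (F \<pi>))}"
  have nL: "real (n - L) > 0" using n by simp
  have sum_F: "(\<Sum>\<pi>\<in>perm_tuples n. real (card (F \<pi>))) * real (n - L) \<le> 2 * real n * real (card U) * real L * real L * real (card (perm_tuples n))"
  proof -
    have F_le: "card (F \<pi>) \<le> (\<Sum>u\<in>U. \<Sum>z\<in>verts n. if fold (nbr \<pi>) u z = z then 1 else 0)" for \<pi>
    proof -
      have "F \<pi> = (\<Union>u\<in>U. {z \<in> verts n. fold (nbr \<pi>) u z = z})" by (auto simp: F_def)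
      then have "card (F \<pi>) \<le> (\<Sum>u\<in>U. card {z \<in> verts n. fold (nbr \<pi>) u z = z})"
        using card_UN_le[OF U(1)] by simp
      then show ?thesis by (simp add: sum.If_cases Int_def)
    qed
    have "(\<Sum>\<pi>\<in>perm_tuples n. card (F \<pi>)) \<le> (\<Sum>\<pi>\<in>perm_tuples n. \<Sum>u\<in>U. \<Sum>z\<in>verts n. if fold (nbr \<pi>) u z = z then 1 else 0)"
      by (rule sum_mono[OF F_le])
    also have "\<dots> = (\<Sum>u\<in>U. \<Sum>z\<in>verts n. \<Sum>\<pi>\<in>perm_tuples n. if fold (nbr \<pi>) u z = z then 1 else 0)"
      by (subst sum.swap, rule sum.cong[OF refl], rule sum.swap)
    also have "\<dots> = (\<Sum>u\<in>U. \<Sum>z\<in>verts n. card {\<pi> \<in> perm_tuples n. fold (nbr \<pi>) u z = z})"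
      using finite_perm_tuples by (simp add: sum.If_cases Int_def)
    finally have "(\<Sum>\<pi>\<in>perm_tuples n. card (F \<pi>)) * (n - L) \<le> (\<Sum>u\<in>U. \<Sum>z\<in>verts n. card {\<pi> \<in> perm_tuples n. fold (nbr \<pi>) u z = z} * (n - L))"
      unfolding sum_distrib_right[symmetric] by (rule mult_right_mono) simp
    also have "\<dots> \<le> (\<Sum>u\<in>U. \<Sum>z\<in>verts n. L * L * card (perm_tuples n))"
    proof (intro sum_mono)
      fix u z assume uz: "u \<in> U" "z \<in> verts n"
      have "card {\<pi> \<in> perm_tuples n. fold (nbr \<pi>) u z = z} * (n - L) \<le> card {\<pi> \<in> perm_tuples n. fold (nbr \<pi>) u z = z} * (n - length u)"
        using L[OF uz(1)] by (intro mult_left_mono) auto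
      also have "\<dots> \<le> length u * length u * card (perm_tuples n)" using few_fixed U(2)[OF uz(1)] uz(2) by blast
      also have "\<dots> \<le> L * L * card (perm_tuples n)" using L[OF uz(1)] by (intro mult_mono) auto
      finally show "card {\<pi> \<in> perm_tuples n. fold (nbr \<pi>) u z = z} * (n - L) \<le> L * L * card (perm_tuples n)" .
    qed
    also have "\<dots> = 2 * n * card U * L * L * card (perm_tuples n)" by (simp add: card_verts)
    finally have "real ((\<Sum>\<pi>\<in>perm_tuples n. card (F \<pi>)) * (n - L)) \<le> real (2 * n * card U * L * L * card (perm_tuples n))"
      by (rule of_nat_mono)
    then show ?thesis by simp
  qed
  have "4 * real (card B) \<le> real (card (perm_tuples n))"
  proof -
    have "real (card B) * (\<epsilon> * real n) = (\<Sum>\<pi>\<in>B. \<epsilon> * real n)" by simp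
    also have "\<dots> \<le> (\<Sum>\<pi>\<in>B. real (card (F \<pi>)))" by (rule sum_mono) (auto simp: B_def)
    also have "\<dots> \<le> (\<Sum>\<pi>\<in>perm_tuples n. real (card (F \<pi>)))"
      by (rule sum_mono2[OF finite_perm_tuples]) (auto simp: B_def)
    finally have "real (card B) * (\<epsilon> * real n) * real (n - L) \<le> (\<Sum>\<pi>\<in>perm_tuples n. real (card (F \<pi>))) * real (n - L)"
      by (rule mult_right_mono) simp
    also note sum_F
    also have "2 * real n * real (card U) * real L * real L * real (card (perm_tuples n)) = C * \<epsilon> * real n * real (card (perm_tuples n)) / 4"
      using \<epsilon> by (simp add: C_def)
    also have "\<dots> \<le> real (n - L) * \<epsilon> * real n * real (card (perm_tuples n)) / 4"
      using n(3) \<epsilon> by (intro divide_right_mono mult_right_mono) auto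
    finally have "(4 * real (card B)) * (\<epsilon> * real n * real (n - L)) \<le> real (card (perm_tuples n)) * (\<epsilon> * real n * real (n - L))"
      by (simp add: ac_simps)
    moreover have "\<epsilon> * real n * real (n - L) > 0" using \<epsilon> n nL by simp
    ultimately show ?thesis by (rule mult_right_le_imp_le)
  qed
  then have B: "4 * card B \<le> card (perm_tuples n)" by linarith
  have pos: "card (perm_tuples n) > 0" by (simp add: card_perm_tuples)
  have "\<exists>\<pi>\<in>perm_tuples n. \<pi> \<notin> B \<and> expanding n \<pi> \<and> expanding n (invs \<pi>)"
  proof (rule ccontr)
    assume "\<not> ?thesis"
    then have "perm_tuples n \<subseteq> B \<union> ({\<pi> \<in> perm_tuples n. \<not> expanding n \<pi>} \<union> {\<pi> \<in> perm_tuples n. \<not> expanding n (invs \<pi>)})" by blast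
    then have "card (perm_tuples n) \<le> card (B \<union> ({\<pi> \<in> perm_tuples n. \<not> expanding n \<pi>} \<union> {\<pi> \<in> perm_tuples n. \<not> expanding n (invs \<pi>)}))"
      using finite_perm_tuples by (intro card_mono) (auto simp: B_def)
    also have "\<dots> \<le> card B + (card {\<pi> \<in> perm_tuples n. \<not> expanding n \<pi>} + card {\<pi> \<in> perm_tuples n. \<not> expanding n (invs \<pi>)})"
      by (rule order_trans[OF card_Un_le add_left_mono[OF card_Un_le]])
    finally show False using B few_nonexpanding[of n] few_nonexpanding_inverse[of n] pos by linarith
  qed
  then obtain \<pi> where "\<pi> \<in> perm_tuples n" "\<pi> \<notin> B" "expanding n \<pi>" "expanding n (invs \<pi>)" by blast
  then show ?thesis using n(1) by (auto simp: B_def F_def not_less)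
qed

section \<open>Expansion bounds sums over neighbours from below\<close>

text \<open>For an indicator function this is the expansion property. In general \<open>g\<close> is peeled off in layers: the
  least positive value is subtracted on the whole support, which lowers the maximum over the
  neighbours of every vertex adjacent to the support by at least the same amount.\<close>

lemma sum_Max_expanding:
  fixes g :: "'a \<Rightarrow> real" and \<rho> :: "nat \<Rightarrow> 'a \<Rightarrow> 'a"
  assumes Z: "finite Z" and mem: "\<And>c v. c < 5 \<Longrightarrow> v \<in> Z \<Longrightarrow> \<rho> c v \<in> Z"
    and invol: "\<And>c v. c < 5 \<Longrightarrow> v \<in> Z \<Longrightarrow> \<rho> c (\<rho> c v) = v"
    and expand: "\<And>S. S \<subseteq> Z \<Longrightarrow> card S \<le> m \<Longrightarrow> 3 * card S \<le> card (\<Union>c<5. \<rho> c ` S)"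
    and g: "\<And>v. v \<in> Z \<Longrightarrow> g v \<ge> 0" and supp: "card {v \<in> Z. g v \<noteq> 0} \<le> m"
  shows "3 * sum g Z \<le> (\<Sum>v\<in>Z. Max ((\<lambda>c. g (\<rho> c v)) ` {..<5}))"
  using g supp
proof (induction "card {v \<in> Z. g v \<noteq> 0}" arbitrary: g rule: less_induct)
  case less
  define S where "S = {v \<in> Z. g v \<noteq> 0}"
  have finS: "finite S" using Z by (simp add: S_def)
  have ne: "(\<lambda>c. h (\<rho> c v)) ` {..<5::nat} \<noteq> {}" for h :: "'a \<Rightarrow> real" and v by (simp add: lessThan_empty_iff)
  have Max_ge0: "0 \<le> Max ((\<lambda>c. h (\<rho> c v)) ` {..<5})" if "v \<in> Z" "\<And>v. v \<in> Z \<Longrightarrow> 0 \<le> h v" for h v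
  proof -
    have "0 \<le> h (\<rho> 0 v)" using that mem by simp
    also have "\<dots> \<le> Max ((\<lambda>c. h (\<rho> c v)) ` {..<5})" by (rule Max_ge) auto
    finally show ?thesis .
  qed
  show ?case
  proof (cases "S = {}")
    case True
    then have "sum g Z = 0" by (intro sum.neutral) (auto simp: S_def)
    then show ?thesis using sum_nonneg[of Z "\<lambda>v. Max ((\<lambda>c. g (\<rho> c v)) ` {..<5})"] Max_ge0[of _ g] less.prems(1) by simp
  next
    case False
    define a where "a = Min (g ` S)"
    have a_le: "a \<le> g v" if "v \<in> S" for v unfolding a_def using that finS by simp
    have a_in: "a \<in> g ` S" unfolding a_def using finS False by (intro Min_in) auto
    then have a_pos: "a > 0" using less.prems(1) by (force simp: S_def)
    define g' where "g' v = (if v \<in> S then g v - a else 0)" for v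
    have g'0: "0 \<le> g' v" for v using a_le by (simp add: g'_def)
    have sub: "{v \<in> Z. g' v \<noteq> 0} \<subset> S"
      using a_in by (force simp: g'_def S_def)
    then have smaller: "card {v \<in> Z. g' v \<noteq> 0} < card S" using finS psubset_card_mono by blast
    have IH: "3 * sum g' Z \<le> (\<Sum>v\<in>Z. Max ((\<lambda>c. g' (\<rho> c v)) ` {..<5}))"
      using less.hyps[OF _ g'0] smaller less.prems(2) by (simp add: S_def)
    define N where "N = (\<Union>c<5. \<rho> c ` S)"
    have NZ: "N \<subseteq> Z" using mem by (auto simp: N_def S_def)
    have "3 * card S \<le> card N"
      unfolding N_def using less.prems(2) by (intro expand) (auto simp: S_def)
    then have cN: "3 * real (card S) \<le> real (card N)" by linarith
    have "sum g Z = sum g' Z + a * real (card S)"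
    proof -
      have "g v = g' v + (if v \<in> S then a else 0)" if "v \<in> Z" for v using that by (auto simp: g'_def S_def)
      then have "sum g Z = sum g' Z + (\<Sum>v\<in>Z. if v \<in> S then a else 0)" by (simp add: sum.distrib)
      also have "(\<Sum>v\<in>Z. if v \<in> S then a else 0) = a * real (card S)"
        using Z by (simp add: sum.If_cases S_def Int_def conj_ac mult.commute)
      finally show ?thesis .
    qed
    then have "3 * sum g Z = 3 * sum g' Z + a * (3 * real (card S))" by simp
    also have "\<dots> \<le> (\<Sum>v\<in>Z. Max ((\<lambda>c. g' (\<rho> c v)) ` {..<5})) + a * real (card N)"
      using IH cN a_pos by (intro add_mono mult_left_mono) auto
    also have "a * real (card N) = (\<Sum>v\<in>Z. if v \<in> N then a else 0)"
      using Z NZ by (simp add: sum.If_cases Int_absorb1 Int_absorb2 mult.commute)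
    also have "(\<Sum>v\<in>Z. Max ((\<lambda>c. g' (\<rho> c v)) ` {..<5})) + \<dots>
        = (\<Sum>v\<in>Z. Max ((\<lambda>c. g' (\<rho> c v)) ` {..<5}) + (if v \<in> N then a else 0))"
      by (rule sum.distrib[symmetric])
    also have "\<dots> \<le> (\<Sum>v\<in>Z. Max ((\<lambda>c. g (\<rho> c v)) ` {..<5}))"
    proof (rule sum_mono)
      fix v assume v: "v \<in> Z"
      have "Max ((\<lambda>c. g' (\<rho> c v)) ` {..<5}) \<in> (\<lambda>c. g' (\<rho> c v)) ` {..<5}" using ne by (intro Max_in) auto
      then obtain c where c: "c < 5" and Mc: "Max ((\<lambda>c. g' (\<rho> c v)) ` {..<5}) = g' (\<rho> c v)" by auto
      have up: "g (\<rho> d v) \<le> Max ((\<lambda>c. g (\<rho> c v)) ` {..<5})" if "d < 5" for d using that by (intro Max_ge) auto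
      show "Max ((\<lambda>c. g' (\<rho> c v)) ` {..<5}) + (if v \<in> N then a else 0) \<le> Max ((\<lambda>c. g (\<rho> c v)) ` {..<5})"
      proof (cases "\<rho> c v \<in> S")
        case True
        then show ?thesis using up[OF c] a_pos unfolding Mc by (auto simp: g'_def)
      next
        case False
        have "(if v \<in> N then a else 0) \<le> Max ((\<lambda>c. g (\<rho> c v)) ` {..<5})"
        proof (cases "v \<in> N")
          case True
          then obtain d w where d: "d < 5" "w \<in> S" "v = \<rho> d w" by (auto simp: N_def)
          then have "\<rho> d v = w" using invol by (auto simp: S_def)
          then show ?thesis using up[OF d(1)] a_le[OF d(2)] True by simp
        next
          case False
          then show ?thesis using Max_ge0[OF v less.prems(1)] by simp
        qed
        then show ?thesis unfolding Mc using False by (simp add: g'_def)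
      qed
    qed
    finally show ?thesis .
  qed
qed

text \<open>At each vertex the modulus of the sum is at least twice the largest modulus minus the sum of all
  moduli. Summation gives at least \<open>2 * 3 - 5 = 1\<close> times the norm of \<open>f\<close>.\<close>

lemma expanding_lower_bound:
  fixes f :: "'a \<Rightarrow> real" and \<rho> :: "nat \<Rightarrow> 'a \<Rightarrow> 'a"
  assumes Z: "finite Z" and mem: "\<And>c v. c < 5 \<Longrightarrow> v \<in> Z \<Longrightarrow> \<rho> c v \<in> Z"
    and invol: "\<And>c v. c < 5 \<Longrightarrow> v \<in> Z \<Longrightarrow> \<rho> c (\<rho> c v) = v"
    and expand: "\<And>S. S \<subseteq> Z \<Longrightarrow> card S \<le> m \<Longrightarrow> 3 * card S \<le> card (\<Union>c<5. \<rho> c ` S)"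
    and supp: "card {v \<in> Z. f v \<noteq> 0} \<le> m"
  shows "(\<Sum>v\<in>Z. \<bar>f v\<bar>) \<le> (\<Sum>v\<in>Z. \<bar>\<Sum>c<5. f (\<rho> c v)\<bar>)"
proof -
  define g where "g v = \<bar>f v\<bar>" for v
  have 1: "3 * sum g Z \<le> (\<Sum>v\<in>Z. Max ((\<lambda>c. g (\<rho> c v)) ` {..<5}))"
    using supp by (intro sum_Max_expanding[OF Z mem invol expand, where m = m]) (auto simp: g_def)
  have 2: "(\<Sum>v\<in>Z. \<Sum>c<5. g (\<rho> c v)) = 5 * sum g Z"
  proof -
    have "(\<Sum>v\<in>Z. g (\<rho> c v)) = sum g Z" if "c < 5" for c
      by (rule sum.reindex_bij_witness[of _ "\<rho> c" "\<rho> c"]) (use that mem invol in auto)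
    then show ?thesis by (subst sum.swap) simp
  qed
  have "2 * Max ((\<lambda>c. g (\<rho> c v)) ` {..<5}) - (\<Sum>c<5. g (\<rho> c v)) \<le> \<bar>\<Sum>c<5. f (\<rho> c v)\<bar>" for v
  proof -
    have "Max ((\<lambda>c. g (\<rho> c v)) ` {..<5}) \<in> (\<lambda>c. g (\<rho> c v)) ` {..<5}"
      by (intro Max_in) (auto simp: lessThan_empty_iff)
    then obtain c where c: "c < 5" and Mc: "Max ((\<lambda>c. g (\<rho> c v)) ` {..<5}) = g (\<rho> c v)" by auto
    have "(\<Sum>c<5. f (\<rho> c v)) = f (\<rho> c v) + (\<Sum>d\<in>{..<5} - {c}. f (\<rho> d v))"
      using c by (intro sum.remove) auto
    moreover have "(\<Sum>c<5. g (\<rho> c v)) = g (\<rho> c v) + (\<Sum>d\<in>{..<5} - {c}. g (\<rho> d v))"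
      using c by (intro sum.remove) auto
    moreover have "\<bar>\<Sum>d\<in>{..<5} - {c}. f (\<rho> d v)\<bar> \<le> (\<Sum>d\<in>{..<5} - {c}. g (\<rho> d v))"
      unfolding g_def by (rule sum_abs)
    ultimately show ?thesis unfolding Mc g_def[of "\<rho> c v"] by linarith
  qed
  then have "(\<Sum>v\<in>Z. 2 * Max ((\<lambda>c. g (\<rho> c v)) ` {..<5}) - (\<Sum>c<5. g (\<rho> c v))) \<le> (\<Sum>v\<in>Z. \<bar>\<Sum>c<5. f (\<rho> c v)\<bar>)"
    by (rule sum_mono)
  then show ?thesis using 1 2 by (simp add: sum_subtractf sum_distrib_left[symmetric] g_def)
qed

section \<open>Averages over finite cubes\<close>

definition avg :: "'i set \<Rightarrow> ('i set \<Rightarrow> real) \<Rightarrow> real"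
  where "avg K F = (\<Sum>D\<in>Pow K. F D) / 2 ^ card K"

definition depends_on :: "'i set \<Rightarrow> ('i set \<Rightarrow> 'b) \<Rightarrow> bool"
  where "depends_on K F \<longleftrightarrow> (\<forall>D. F D = F (D \<inter> K))"

lemma depends_onD: "depends_on K F \<Longrightarrow> F (D \<inter> K) = F D"
  by (simp add: depends_on_def)

lemma depends_on_mono: "depends_on K F \<Longrightarrow> K \<subseteq> L \<Longrightarrow> depends_on L F"
  unfolding depends_on_def by (metis Int_absorb1 Int_assoc Int_commute)

lemma depends_on_comp: "depends_on K F \<Longrightarrow> depends_on K (\<lambda>D. h (F D))"
  unfolding depends_on_def by metis

lemma depends_on_vimage: "depends_on K F \<Longrightarrow> depends_on (\<theta> ` K) (\<lambda>D. F (\<theta> -` D))"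
proof -
  assume F: "depends_on K F"
  have "\<theta> -` D \<inter> K = \<theta> -` (D \<inter> \<theta> ` K) \<inter> K" for D by auto
  then show ?thesis using F unfolding depends_on_def by metis
qed

lemma avg_mono: "(\<And>D. D \<subseteq> K \<Longrightarrow> F D \<le> G D) \<Longrightarrow> avg K F \<le> avg K G"
  unfolding avg_def by (intro divide_right_mono sum_mono) auto

lemma avg_const [simp]: "finite K \<Longrightarrow> avg K (\<lambda>_. c) = c"
  by (simp add: avg_def card_Pow)

lemma avg_add: "avg K (\<lambda>D. F D + G D) = avg K F + avg K G"
  by (simp add: avg_def sum.distrib add_divide_distrib)

lemma avg_mult: "avg K (\<lambda>D. c * F D) = c * avg K F"
  by (simp add: avg_def sum_distrib_left)

lemma avg_sum: "avg K (\<lambda>D. \<Sum>i\<in>S. F i D) = (\<Sum>i\<in>S. avg K (F i))"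
  unfolding avg_def by (subst sum.swap) (simp add: sum_divide_distrib)

lemma avg_nonneg: "(\<And>D. D \<subseteq> K \<Longrightarrow> 0 \<le> F D) \<Longrightarrow> 0 \<le> avg K F"
  unfolding avg_def by (intro divide_nonneg_nonneg sum_nonneg) auto

lemma avg_disjoint:
  assumes fin: "finite A" "finite B" and disj: "A \<inter> B = {}"
  shows "avg (A \<union> B) (\<lambda>D. F (D \<inter> A) * G (D \<inter> B)) = avg A F * avg B G"
proof -
  have "(\<Sum>D\<in>Pow (A \<union> B). F (D \<inter> A) * G (D \<inter> B)) = (\<Sum>(X, Y)\<in>Pow A \<times> Pow B. F X * G Y)"
    by (rule sum.reindex_bij_witness[of _ "\<lambda>(X, Y). X \<union> Y" "\<lambda>D. (D \<inter> A, D \<inter> B)"])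
      (use disj in \<open>auto simp: Int_Un_distrib2 Int_absorb2\<close>)
  also have "\<dots> = (\<Sum>X\<in>Pow A. F X) * (\<Sum>Y\<in>Pow B. G Y)"
    by (simp add: sum_product sum.cartesian_product)
  finally show ?thesis
    using fin disj by (simp add: avg_def card_Un_disjoint power_add)
qed

lemma avg_superset:
  assumes F: "depends_on A F" and A: "A \<subseteq> K" and K: "finite K"
  shows "avg K F = avg A F"
proof -
  have "avg (A \<union> (K - A)) (\<lambda>D. F (D \<inter> A) * 1) = avg A F * avg (K - A) (\<lambda>_. 1)"
    using finite_subset[OF A K] K by (intro avg_disjoint[where G = "\<lambda>_. 1"]) auto
  then show ?thesis using A K by (simp add: depends_onD[OF F] Un_absorb1)
qed

lemma avg_image:
  assumes F: "depends_on K F" and inj: "inj_on \<theta> K"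
  shows "avg (\<theta> ` K) (\<lambda>D. F (\<theta> -` D)) = avg K F"
proof -
  have F_eq: "F (\<theta> -` (\<theta> ` D)) = F D" if "D \<subseteq> K" for D
  proof -
    have "\<theta> -` (\<theta> ` D) \<inter> K = D" using that inj by (auto dest: inj_onD)
    then show ?thesis using depends_onD[OF F] by metis
  qed
  have "(\<Sum>D\<in>Pow (\<theta> ` K). F (\<theta> -` D)) = (\<Sum>D\<in>Pow K. F (\<theta> -` (\<theta> ` D)))"
    unfolding image_Pow_surj[OF refl, symmetric]
    by (rule sum.reindex[unfolded o_def]) (rule inj_on_image_Pow[OF inj])
  then show ?thesis by (simp add: avg_def F_eq card_image[OF inj])
qed

lemma avg_vimage:
  assumes F: "depends_on K F" and inj: "inj_on \<theta> K" and W: "\<theta> ` K \<subseteq> W" "finite W"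
  shows "avg W (\<lambda>D. F (\<theta> -` D)) = avg K F"
  using avg_superset[OF depends_on_vimage[OF F] W] avg_image[OF F inj] by simp

lemma avg_vimage_independent:
  assumes F: "depends_on K F" and G: "depends_on L G" and inj: "inj_on \<theta> K" "inj_on \<theta>' L"
    and W: "\<theta> ` K \<subseteq> W" "\<theta>' ` L \<subseteq> W" "finite W" and disj: "\<theta> ` K \<inter> \<theta>' ` L = {}"
  shows "avg W (\<lambda>D. F (\<theta> -` D) * G (\<theta>' -` D)) = avg K F * avg L G"
proof -
  let ?A = "\<theta> ` K" and ?B = "\<theta>' ` L"
  have dF: "depends_on ?A (\<lambda>D. F (\<theta> -` D))" and dG: "depends_on ?B (\<lambda>D. G (\<theta>' -` D))"
    using F G by (auto intro: depends_on_vimage)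
  have "depends_on (?A \<union> ?B) (\<lambda>D. F (\<theta> -` D) * G (\<theta>' -` D))"
    using depends_on_mono[OF dF, of "?A \<union> ?B"] depends_on_mono[OF dG, of "?A \<union> ?B"]
    unfolding depends_on_def by simp
  then have "avg W (\<lambda>D. F (\<theta> -` D) * G (\<theta>' -` D)) = avg (?A \<union> ?B) (\<lambda>D. F (\<theta> -` D) * G (\<theta>' -` D))"
    using W by (intro avg_superset) auto
  also have "\<dots> = avg (?A \<union> ?B) (\<lambda>D. F (\<theta> -` (D \<inter> ?A)) * G (\<theta>' -` (D \<inter> ?B)))"
    using depends_onD[OF dF] depends_onD[OF dG] by simp
  also have "\<dots> = avg ?A (\<lambda>D. F (\<theta> -` D)) * avg ?B (\<lambda>D. G (\<theta>' -` D))"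
    using W finite_subset disj by (intro avg_disjoint) blast+
  finally show ?thesis using avg_image[OF F inj(1)] avg_image[OF G inj(2)] by simp
qed

section \<open>Words and walks\<close>

text \<open>Words over five letters in which neighbouring letters differ are the vertices of the \<open>5\<close>-regular
  tree, the first letter of a word being the first step of the walk from the root.\<close>

definition reduced :: "nat list \<Rightarrow> bool"
  where "reduced w \<longleftrightarrow> distinct_adj w \<and> set w \<subseteq> {..<5}"

text \<open>The position of a vertex as seen from the neighbour of the root along colour \<open>c\<close>: walks that start
  with \<open>c\<close> get shorter, all others longer.\<close>

definition word_nbr :: "nat \<Rightarrow> nat list \<Rightarrow> nat list"
  where "word_nbr c w = (if w \<noteq> [] \<and> hd w = c then tl w else c # w)"

lemma reduced_word_nbr: "c < 5 \<Longrightarrow> reduced w \<Longrightarrow> reduced (word_nbr c w)"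
  by (cases w) (auto simp: word_nbr_def reduced_def distinct_adj_Cons)

lemma word_nbr_word_nbr: "reduced w \<Longrightarrow> word_nbr c (word_nbr c w) = w"
  by (cases w) (auto simp: word_nbr_def reduced_def distinct_adj_Cons)

text \<open>This equivariance is what makes functions on the tree and functions on a graph comparable: reading
  labels along \<open>word_nbr c w\<close> from \<open>v\<close> is reading them along \<open>w\<close> from the neighbour of \<open>v\<close>.\<close>

lemma fold_word_nbr:
  assumes "\<And>v. \<rho> c (\<rho> c v) = v"
  shows "fold \<rho> (word_nbr c w) v = fold \<rho> w (\<rho> c v)"
  by (cases w) (auto simp: word_nbr_def assms)

lemma fold_rev:
  assumes "\<And>c v. c \<in> set w \<Longrightarrow> \<rho> c (\<rho> c v) = v"
  shows "fold \<rho> (rev w) (fold \<rho> w v) = v"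
  using assms by (induction w arbitrary: v) auto

lemma common_prefix_split:
  assumes "w \<noteq> w'"
  shows "\<exists>p a b. w = p @ a \<and> w' = p @ b \<and> (a \<noteq> [] \<or> b \<noteq> []) \<and> (a \<noteq> [] \<longrightarrow> b \<noteq> [] \<longrightarrow> hd a \<noteq> hd b)"
  using assms
proof (induction w arbitrary: w')
  case Nil
  then show ?case by (intro exI[of _ "[]"] exI[of _ w']) auto
next
  case (Cons x w)
  show ?case
  proof (cases "w' \<noteq> [] \<and> hd w' = x")
    case True
    then obtain v where v: "w' = x # v" by (cases w') auto
    with Cons.prems have "w \<noteq> v" by simp
    from Cons.IH[OF this] obtain p a b where "w = p @ a" "v = p @ b" "a \<noteq> [] \<or> b \<noteq> []" "a \<noteq> [] \<longrightarrow> b \<noteq> [] \<longrightarrow> hd a \<noteq> hd b"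
      by blast
    then show ?thesis unfolding v by (intro exI[of _ "x # p"] exI[of _ a] exI[of _ b]) auto
  next
    case False
    then show ?thesis by (intro exI[of _ "[]"] exI[of _ "x # w"] exI[of _ w']) auto
  qed
qed

lemma reduced_append: "reduced (p @ a) \<Longrightarrow> reduced a"
  by (induction p) (auto simp: reduced_def distinct_adj_Cons)

text \<open>After removal of the common beginning of the two words, one walks back along the first and then
  forward along the second.\<close>

lemma coincidence_gives_closed_walk:
  assumes \<rho>: "\<And>c v. c < 5 \<Longrightarrow> \<rho> c (\<rho> c v) = v" and w: "reduced w" "reduced w'" "w \<noteq> w'"
    and eq: "fold \<rho> w v = fold \<rho> w' v"
  shows "\<exists>u. reduced u \<and> u \<noteq> [] \<and> length u \<le> length w + length w' \<and> fold \<rho> u (fold \<rho> w v) = fold \<rho> w v"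
proof -
  obtain p a b where ab: "w = p @ a" "w' = p @ b" "a \<noteq> [] \<or> b \<noteq> []" "a \<noteq> [] \<longrightarrow> b \<noteq> [] \<longrightarrow> hd a \<noteq> hd b"
    using common_prefix_split[OF w(3)] by blast
  have r: "reduced a" "reduced b" using w ab reduced_append by blast+
  have "reduced (rev a @ b)"
    using r ab(4) by (cases "a = []"; cases "b = []") (auto simp: reduced_def distinct_adj_append_iff last_rev)
  moreover have "fold \<rho> (rev a @ b) (fold \<rho> w v) = fold \<rho> w v"
  proof -
    have "fold \<rho> (rev a) (fold \<rho> a (fold \<rho> p v)) = fold \<rho> p v"
      by (rule fold_rev) (use r \<rho> in \<open>auto simp: reduced_def\<close>)
    then show ?thesis using eq by (simp add: ab)
  qed
  ultimately show ?thesis using ab by (intro exI[of _ "rev a @ b"]) auto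
qed

text \<open>The second component distinguishes the infinitely many labels at one vertex of the tree.\<close>

definition label_nbr :: "nat \<Rightarrow> nat list \<times> nat \<Rightarrow> nat list \<times> nat"
  where "label_nbr c k = (word_nbr c (fst k), snd k)"

section \<open>Transfer from finite graphs to the tree\<close>

text \<open>Label a good random graph randomly and let \<open>f v\<close> be the value of \<open>F\<close> at the labels seen from the
  vertex \<open>v\<close>. At all vertices with a tree-like neighbourhood \<open>f v\<close> has the distribution of \<open>F\<close>, and the
  sum of \<open>f\<close> over the neighbours of \<open>v\<close> that of \<open>G\<close>. If the support of \<open>f\<close> is small enough,
  \<open>expanding_lower_bound\<close> applies; in the opposite case the factor \<open>5832 * N / n\<close>, with \<open>N\<close> the size of
  the support, is at least one. Adding the two bounds and averaging over the labels leads to the mean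
  of \<open>\<bar>f v\<bar>\<close> times the indicator of \<open>f v' \<noteq> 0\<close>, which factorises for most pairs \<open>v\<close>, \<open>v'\<close> because they see
  disjoint sets of labels. All errors disappear as the graph grows.\<close>

lemma small_support_bound_cylinder:
  fixes F :: "(nat list \<times> nat) set \<Rightarrow> real"
  assumes K: "finite K" "\<And>k. k \<in> K \<Longrightarrow> reduced (fst k)" and F: "depends_on K F"
  defines "K' \<equiv> (\<Union>c<5. label_nbr c ` K)"
    and "G \<equiv> (\<lambda>D. \<Sum>c<5. F (label_nbr c -` D))"
    and "p \<equiv> avg K (\<lambda>D. if F D \<noteq> 0 then 1 else 0)"
  shows "avg K (\<lambda>D. \<bar>F D\<bar>) \<le> avg K' (\<lambda>D. \<bar>G D\<bar>) + 11664 * p * avg K (\<lambda>D. \<bar>F D\<bar>)"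
proof -
  define A where "A = avg K (\<lambda>D. \<bar>F D\<bar>)"
  define B where "B = avg K' (\<lambda>D. \<bar>G D\<bar>)"
  define R where "R = (\<Sum>D\<in>Pow K. \<bar>F D\<bar>)"
  have R: "\<bar>F D\<bar> \<le> R" for D
  proof -
    have "\<bar>F (D \<inter> K)\<bar> \<le> R" unfolding R_def using K(1) by (intro member_le_sum[of _ _ "\<lambda>D. \<bar>F D\<bar>"]) auto
    then show ?thesis by (simp add: depends_onD[OF F])
  qed
  have R0: "0 \<le> R" using R[of "{}"] by linarith
  have A0: "0 \<le> A" unfolding A_def by (rule avg_nonneg) simp
  have p0: "0 \<le> p" unfolding p_def by (rule avg_nonneg) simp
  have finK': "finite K'" using K(1) by (simp add: K'_def)
  have redK': "reduced (fst k)" if "k \<in> K'" for k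
    using that K(2) reduced_word_nbr by (auto simp: K'_def label_nbr_def)
  have depG: "depends_on K' G"
  proof -
    have "depends_on K' (\<lambda>D. F (label_nbr c -` D))" if "c < 5" for c
      by (rule depends_on_mono[OF depends_on_vimage[OF F]]) (use that in \<open>auto simp: K'_def\<close>)
    then show ?thesis unfolding G_def depends_on_def by (intro allI sum.cong refl) (metis lessThan_iff)
  qed
  define Q where "Q = fst ` (K \<union> K')"
  have finQ: "finite Q" using K(1) finK' by (simp add: Q_def)
  have redQ: "reduced w" if "w \<in> Q" for w using that K(2) redK' by (auto simp: Q_def)
  define M where "M = 2 * (\<Sum>w\<in>Q. length w)"
  have lenQ: "2 * length w \<le> M" if "w \<in> Q" for w
    unfolding M_def using member_le_sum[OF that, of length] finQ by simp
  define U where "U = {u. reduced u \<and> u \<noteq> [] \<and> length u \<le> M}"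
  have finU: "finite U"
    by (rule finite_subset[OF _ finite_lists_length_le[of "{..<5}" M]]) (auto simp: U_def reduced_def)
  have approx: "A \<le> B + 11664 * p * A + \<epsilon> * (A / 2 + 20000 * R)" if \<epsilon>: "\<epsilon> > 0" for \<epsilon>
  proof -
    \<comment> \<open>a vertex is bad if one of \<open>card Q\<close> walks leads from it to a closed walk\<close>
    define \<epsilon>' where "\<epsilon>' = \<epsilon> / (real (card Q) + 1)"
    have \<epsilon>': "\<epsilon>' > 0" using \<epsilon> by (simp add: \<epsilon>'_def add_nonneg_pos)
    obtain N0 where N0: "real (card K * card K) / \<epsilon> \<le> real N0" using real_arch_simple by blast
    obtain n \<pi> where n: "n \<ge> Suc N0" and \<pi>: "\<pi> \<in> perm_tuples n" "expanding n \<pi>" "expanding n (invs \<pi>)"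
      and few: "real (card {z \<in> verts n. \<exists>u\<in>U. fold (nbr \<pi>) u z = z}) \<le> \<epsilon>' * real n"
      using exists_good_permutations[OF finU _ \<epsilon>', of "Suc N0"] by (auto simp: U_def reduced_def)
    define \<rho> where "\<rho> = nbr \<pi>"
    define Z where "Z = verts n"
    define C where "C = {z \<in> Z. \<exists>u\<in>U. fold \<rho> u z = z}"
    have n0: "real n > 0" using n by simp
    have finZ: "finite Z" and cZ: "card Z = 2 * n" by (simp_all add: Z_def card_verts)
    have inv: "\<rho> c (\<rho> c v) = v" if "c < 5" for c v
      unfolding \<rho>_def using nbr_nbr[of \<pi> c "{..<n}"] perm_tuples_permutes[OF \<pi>(1) that] by simp
    have mem: "\<rho> c v \<in> Z \<longleftrightarrow> v \<in> Z" if "c < 5" for c v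
      unfolding \<rho>_def Z_def using nbr_in_verts[of \<pi> c n] perm_tuples_permutes[OF \<pi>(1) that] by simp
    have fold_mem: "fold \<rho> w v \<in> Z \<longleftrightarrow> v \<in> Z" if "set w \<subseteq> {..<5}" for w v
      using that by (induction w arbitrary: v) (auto simp: mem)
    have fold_inj: "v = v'" if "set w \<subseteq> {..<5}" "fold \<rho> w v = fold \<rho> w v'" for w v v'
      using fold_rev[of w \<rho>] inv that by (metis lessThan_iff subset_iff)
    define \<Theta> where "\<Theta> v k = (fold \<rho> (fst k) v, snd k)" for v and k :: "nat list \<times> nat"
    have \<Theta>_tau: "\<Theta> v (label_nbr c k) = \<Theta> (\<rho> c v) k" if "c < 5" for v c k
      using fold_word_nbr[of \<rho> c] inv[OF that] by (simp add: \<Theta>_def label_nbr_def)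
    define W where "W = Z \<times> snd ` (K \<union> K')"
    have finW: "finite W" using finZ K(1) finK' by (simp add: W_def)
    have \<Theta>_W: "\<Theta> v ` (K \<union> K') \<subseteq> W" if "v \<in> Z" for v
    proof (rule image_subsetI)
      fix k assume k: "k \<in> K \<union> K'"
      then have "reduced (fst k)" using redQ by (simp add: Q_def)
      then have "fold \<rho> (fst k) v \<in> Z" using that fold_mem by (simp add: reduced_def)
      then show "\<Theta> v k \<in> W" using k by (simp add: \<Theta>_def W_def)
    qed
    define bad where "bad = {v \<in> Z. \<not> inj_on (\<Theta> v) (K \<union> K')}"
    have finbad: "finite bad" using finZ by (simp add: bad_def)
    have card_bad: "real (card bad) \<le> \<epsilon> * real n"
    proof -
      have "bad \<subseteq> (\<Union>w\<in>Q. {v \<in> Z. fold \<rho> w v \<in> C})"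
      proof
        fix v assume "v \<in> bad"
        then obtain k k' where v: "v \<in> Z" and k: "k \<in> K \<union> K'" "k' \<in> K \<union> K'" "k \<noteq> k'" "\<Theta> v k = \<Theta> v k'"
          by (auto simp: bad_def inj_on_def)
        have w: "fst k \<in> Q" "fst k' \<in> Q" "fst k \<noteq> fst k'" "fold \<rho> (fst k) v = fold \<rho> (fst k') v"
          using k by (auto simp: Q_def \<Theta>_def prod_eq_iff)
        obtain u where u: "reduced u" "u \<noteq> []" "length u \<le> length (fst k) + length (fst k')"
          "fold \<rho> u (fold \<rho> (fst k) v) = fold \<rho> (fst k) v"
          using coincidence_gives_closed_walk[of \<rho> "fst k" "fst k'" v] inv redQ w by metis
        then have "u \<in> U" using lenQ[OF w(1)] lenQ[OF w(2)] by (auto simp: U_def)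
        then have "fold \<rho> (fst k) v \<in> C"
          using u v fold_mem redQ[OF w(1)] by (auto simp: C_def reduced_def)
        then show "v \<in> (\<Union>w\<in>Q. {v \<in> Z. fold \<rho> w v \<in> C})" using v w(1) by blast
      qed
      then have "card bad \<le> card (\<Union>w\<in>Q. {v \<in> Z. fold \<rho> w v \<in> C})"
        using finQ finZ by (intro card_mono) auto
      also have "\<dots> \<le> (\<Sum>w\<in>Q. card {v \<in> Z. fold \<rho> w v \<in> C})" by (rule card_UN_le[OF finQ])
      also have "\<dots> \<le> (\<Sum>w\<in>Q. card C)"
      proof (rule sum_mono)
        fix w assume "w \<in> Q"
        then have "set w \<subseteq> {..<5}" using redQ by (simp add: reduced_def)
        then show "card {v \<in> Z. fold \<rho> w v \<in> C} \<le> card C"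
          using fold_inj finZ by (intro card_inj_on_le[of "fold \<rho> w"]) (auto simp: inj_on_def C_def)
      qed
      finally have "card bad \<le> card Q * card C" by simp
      then have "real (card bad) \<le> real (card Q * card C)" by (rule of_nat_mono)
      then have "real (card bad) \<le> real (card Q) * real (card C)" by simp
      also have "\<dots> \<le> real (card Q) * (\<epsilon>' * real n)"
        using few by (intro mult_left_mono) (auto simp: C_def Z_def \<rho>_def)
      also have "\<dots> \<le> (real (card Q) + 1) * (\<epsilon>' * real n)"
        using \<epsilon>' by (intro mult_right_mono) auto
      also have "\<dots> = \<epsilon> * real n" by (simp add: \<epsilon>'_def add_nonneg_eq_0_iff)
      finally show ?thesis .
    qed
    define f where "f \<omega> v = F (\<Theta> v -` \<omega>)" for \<omega> v
    define s where "s \<omega> v = (if f \<omega> v \<noteq> 0 then 1 else (0::real))" for \<omega> v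
    have G_eq: "G (\<Theta> v -` \<omega>) = (\<Sum>c<5. f \<omega> (\<rho> c v))" for v \<omega>
      unfolding G_def f_def vimage_def by (intro sum.cong refl) (simp add: \<Theta>_tau)
    \<comment> \<open>\<open>s \<omega>\<close> is the indicator of the support; its double sum with \<open>f\<close> is the size of the support times the norm\<close>
    have pointwise: "(\<Sum>v\<in>Z. \<bar>f \<omega> v\<bar>) \<le> (\<Sum>v\<in>Z. \<bar>G (\<Theta> v -` \<omega>)\<bar>)
        + (5832 / real n) * (\<Sum>v\<in>Z. \<Sum>v'\<in>Z. \<bar>f \<omega> v\<bar> * s \<omega> v')" for \<omega>
    proof -
      define N where "N = card {v \<in> Z. f \<omega> v \<noteq> 0}"
      have sN: "(\<Sum>v\<in>Z. s \<omega> v) = real N"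
        using finZ by (simp add: s_def N_def sum.If_cases Int_def)
      have prod: "(\<Sum>v\<in>Z. \<Sum>v'\<in>Z. \<bar>f \<omega> v\<bar> * s \<omega> v') = (\<Sum>v\<in>Z. \<bar>f \<omega> v\<bar>) * real N"
        unfolding sN[symmetric] by (rule sum_product[symmetric])
      show ?thesis
      proof (cases "5832 * N \<le> n")
        case True
        have "(\<Sum>v\<in>Z. \<bar>f \<omega> v\<bar>) \<le> (\<Sum>v\<in>Z. \<bar>\<Sum>c<5. f \<omega> (\<rho> c v)\<bar>)"
        proof (rule expanding_lower_bound[where m = "n div 5832"])
          fix S assume "S \<subseteq> Z" "card S \<le> n div 5832"
          then show "3 * card S \<le> card (\<Union>c<5. \<rho> c ` S)"
            unfolding \<rho>_def using nbr_expanding[OF \<pi>] by (simp add: Z_def less_eq_div_iff_mult_less_eq mult.commute)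
        next
          show "card {v \<in> Z. f \<omega> v \<noteq> 0} \<le> n div 5832"
            using True by (simp add: N_def less_eq_div_iff_mult_less_eq mult.commute)
        qed (use finZ mem inv in auto)
        then show ?thesis unfolding prod G_eq using n0 sum_nonneg[of Z "\<lambda>v. \<bar>f \<omega> v\<bar>"] by (simp add: add_increasing2)
      next
        case False
        then have "real n \<le> 5832 * real N" by linarith
        then have "1 \<le> 5832 * real N / real n" using n0 by (simp add: pos_le_divide_eq)
        then have "(\<Sum>v\<in>Z. \<bar>f \<omega> v\<bar>) * 1 \<le> (\<Sum>v\<in>Z. \<bar>f \<omega> v\<bar>) * (5832 * real N / real n)"
          by (intro mult_left_mono sum_nonneg) auto
        moreover have "0 \<le> (\<Sum>v\<in>Z. \<bar>G (\<Theta> v -` \<omega>)\<bar>)" by (rule sum_nonneg) simp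
        moreover have "(\<Sum>v\<in>Z. \<bar>f \<omega> v\<bar>) * (5832 * real N / real n) = (5832 / real n) * ((\<Sum>v\<in>Z. \<bar>f \<omega> v\<bar>) * real N)"
          by simp
        ultimately show ?thesis unfolding prod by linarith
      qed
    qed
    have good: "inj_on (\<Theta> v) K" "inj_on (\<Theta> v) K'" if "v \<in> Z - bad" for v
      using that by (auto simp: bad_def intro: inj_on_subset)
    have ZW: "\<Theta> v ` K \<subseteq> W" "\<Theta> v ` K' \<subseteq> W" if "v \<in> Z" for v using \<Theta>_W[OF that] by auto
    have lower: "(2 * real n - real (card bad)) * A \<le> (\<Sum>v\<in>Z. avg W (\<lambda>\<omega>. \<bar>f \<omega> v\<bar>))"
    proof -
      have "real (card (Z - bad)) = 2 * real n - real (card bad)"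
        using finbad cZ card_mono[OF finZ, of bad] by (subst card_Diff_subset) (auto simp: bad_def of_nat_diff)
      then have "(2 * real n - real (card bad)) * A = (\<Sum>v\<in>Z - bad. A)" by simp
      also have "\<dots> = (\<Sum>v\<in>Z - bad. avg W (\<lambda>\<omega>. \<bar>f \<omega> v\<bar>))"
      proof (rule sum.cong[OF refl])
        fix v assume v: "v \<in> Z - bad"
        show "A = avg W (\<lambda>\<omega>. \<bar>f \<omega> v\<bar>)"
          unfolding A_def f_def
          using avg_vimage[OF depends_on_comp[OF F, of abs] good(1)[OF v] _ finW] ZW v by simp
      qed
      also have "\<dots> \<le> (\<Sum>v\<in>Z. avg W (\<lambda>\<omega>. \<bar>f \<omega> v\<bar>))"
        using finZ by (intro sum_mono2 avg_nonneg) auto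
      finally show ?thesis .
    qed
    have upper: "(\<Sum>v\<in>Z. avg W (\<lambda>\<omega>. \<bar>G (\<Theta> v -` \<omega>)\<bar>)) \<le> 2 * real n * B + real (card bad) * (5 * R)"
    proof -
      have "avg W (\<lambda>\<omega>. \<bar>G (\<Theta> v -` \<omega>)\<bar>) \<le> B + (if v \<in> bad then 5 * R else 0)" if v: "v \<in> Z" for v
      proof (cases "v \<in> bad")
        case True
        have "\<bar>G D\<bar> \<le> 5 * R" for D
        proof -
          have "\<bar>G D\<bar> \<le> (\<Sum>c<5::nat. \<bar>F (label_nbr c -` D)\<bar>)" unfolding G_def by (rule sum_abs)
          also have "\<dots> \<le> (\<Sum>c<5::nat. R)" by (intro sum_mono R)
          finally show ?thesis by simp
        qed
        then have "avg W (\<lambda>\<omega>. \<bar>G (\<Theta> v -` \<omega>)\<bar>) \<le> avg W (\<lambda>_. 5 * R)" by (intro avg_mono)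
        moreover have "0 \<le> B" unfolding B_def by (rule avg_nonneg) simp
        ultimately show ?thesis using True finW by simp
      next
        case False
        then show ?thesis
          unfolding B_def
          using avg_vimage[OF depends_on_comp[OF depG, of abs] good(2)[of v] _ finW] ZW v by simp
      qed
      then have "(\<Sum>v\<in>Z. avg W (\<lambda>\<omega>. \<bar>G (\<Theta> v -` \<omega>)\<bar>)) \<le> (\<Sum>v\<in>Z. B + (if v \<in> bad then 5 * R else 0))"
        by (rule sum_mono)
      also have "\<dots> = 2 * real n * B + real (card bad) * (5 * R)"
        using finZ cZ by (simp add: sum.distrib sum.If_cases bad_def Int_def conj_ac)
      finally show ?thesis .
    qed
    have pairs: "(\<Sum>v\<in>Z. \<Sum>v'\<in>Z. avg W (\<lambda>\<omega>. \<bar>f \<omega> v\<bar> * s \<omega> v'))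
        \<le> (2 * real n) * (2 * real n) * (p * A) + R * (4 * real n * real (card bad) + 2 * real n * real (card K * card K))"
    proof -
      define X where "X v = {v' \<in> Z. \<exists>q\<in>K \<times> K. \<Theta> v (fst q) = \<Theta> v' (snd q)}" for v
      have card_X: "card (X v) \<le> card K * card K" for v
      proof -
        have "X v = (\<Union>q\<in>K \<times> K. {v' \<in> Z. \<Theta> v (fst q) = \<Theta> v' (snd q)})"
          unfolding X_def by blast
        then have "card (X v) \<le> (\<Sum>q\<in>K \<times> K. card {v' \<in> Z. \<Theta> v (fst q) = \<Theta> v' (snd q)})"
          using card_UN_le[of "K \<times> K" "\<lambda>q. {v' \<in> Z. \<Theta> v (fst q) = \<Theta> v' (snd q)}"] K(1) by simp
        also have "\<dots> \<le> (\<Sum>q\<in>K \<times> K. 1)"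
        proof (rule sum_mono)
          fix q assume "q \<in> K \<times> K"
          then have "snd q \<in> K" by (rule mem_Times_iff[THEN iffD1, THEN conjunct2])
          then have "set (fst (snd q)) \<subseteq> {..<5}" using K(2)[of "snd q"] by (simp add: reduced_def)
          then have "v1 = v2" if "\<Theta> v1 (snd q) = \<Theta> v2 (snd q)" for v1 v2
            using that fold_inj[of "fst (snd q)" v1 v2] by (simp add: \<Theta>_def)
          then have "\<forall>v1\<in>{v' \<in> Z. \<Theta> v (fst q) = \<Theta> v' (snd q)}. \<forall>v2\<in>{v' \<in> Z. \<Theta> v (fst q) = \<Theta> v' (snd q)}. v1 = v2"
            by simp
          then show "card {v' \<in> Z. \<Theta> v (fst q) = \<Theta> v' (snd q)} \<le> 1"
            using card_le_Suc0_iff_eq[of "{v' \<in> Z. \<Theta> v (fst q) = \<Theta> v' (snd q)}"] finZ by simp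
        qed
        finally show ?thesis by (simp add: card_cartesian_product)
      qed
      have ptw: "avg W (\<lambda>\<omega>. \<bar>f \<omega> v\<bar> * s \<omega> v') \<le> p * A + R * ((if v \<in> bad then 1 else 0) + (if v' \<in> bad then 1 else 0) + (if v' \<in> X v then 1 else 0))"
        if v: "v \<in> Z" "v' \<in> Z" for v v'
      proof (cases "v \<in> bad \<or> v' \<in> bad \<or> v' \<in> X v")
        case True
        have "\<bar>f \<omega> v\<bar> * s \<omega> v' \<le> R" for \<omega> using R R0 by (simp add: s_def f_def)
        then have "avg W (\<lambda>\<omega>. \<bar>f \<omega> v\<bar> * s \<omega> v') \<le> avg W (\<lambda>_. R)" by (intro avg_mono)
        then have "avg W (\<lambda>\<omega>. \<bar>f \<omega> v\<bar> * s \<omega> v') \<le> R" using finW by simp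
        also have "\<dots> \<le> R * ((if v \<in> bad then 1 else 0) + (if v' \<in> bad then 1 else 0) + (if v' \<in> X v then 1 else 0))"
          using True R0 by (auto intro: mult_left_mono[of 1, simplified])
        also have "\<dots> \<le> p * A + \<dots>" using p0 A0 by simp
        finally show ?thesis .
      next
        case False
        have "\<Theta> v k \<noteq> \<Theta> v' k'" if "k \<in> K" "k' \<in> K" for k k'
          using False v that by (fastforce simp: X_def)
        then have "\<Theta> v ` K \<inter> \<Theta> v' ` K = {}" by blast
        then have "avg W (\<lambda>\<omega>. \<bar>f \<omega> v\<bar> * s \<omega> v') = A * p"
          unfolding f_def s_def A_def p_def
          using avg_vimage_independent[OF depends_on_comp[OF F, of abs] depends_on_comp[OF F, of "\<lambda>x. if x \<noteq> 0 then 1 else 0"]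
              good(1)[of v] good(1)[of v'] ZW(1)[OF v(1)] ZW(1)[OF v(2)] finW] v False by simp
        then show ?thesis using False by simp
      qed
      have "(\<Sum>v\<in>Z. \<Sum>v'\<in>Z. avg W (\<lambda>\<omega>. \<bar>f \<omega> v\<bar> * s \<omega> v'))
          \<le> (\<Sum>v\<in>Z. \<Sum>v'\<in>Z. p * A + R * ((if v \<in> bad then 1 else 0) + (if v' \<in> bad then 1 else 0) + (if v' \<in> X v then 1 else 0)))"
        by (intro sum_mono ptw)
      also have "\<dots> = (2 * real n) * (2 * real n) * (p * A)
          + R * (2 * real n * real (card bad) + 2 * real n * real (card bad) + (\<Sum>v\<in>Z. real (card (X v))))"
      proof -
        have "(\<Sum>v\<in>Z. if v \<in> bad then 1 else 0::real) = real (card bad)"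
          using finZ by (simp add: sum.If_cases bad_def Int_def conj_ac)
        moreover have "(\<Sum>v'\<in>Z. if v' \<in> X v then 1 else 0::real) = real (card (X v))" for v
          using finZ by (simp add: sum.If_cases X_def Int_def conj_ac)
        ultimately show ?thesis
          using cZ by (simp add: sum.distrib sum_distrib_left[symmetric] distrib_left)
      qed
      also have "\<dots> \<le> (2 * real n) * (2 * real n) * (p * A)
          + R * (2 * real n * real (card bad) + 2 * real n * real (card bad) + (\<Sum>v\<in>Z. real (card K * card K)))"
        using R0 card_X by (intro add_left_mono mult_left_mono sum_mono of_nat_mono) auto
      finally show ?thesis using cZ by (simp add: algebra_simps)
    qed
    have "(2 * real n - real (card bad)) * A \<le> avg W (\<lambda>\<omega>. \<Sum>v\<in>Z. \<bar>f \<omega> v\<bar>)"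
      using lower by (simp add: avg_sum)
    also have "\<dots> \<le> avg W (\<lambda>\<omega>. (\<Sum>v\<in>Z. \<bar>G (\<Theta> v -` \<omega>)\<bar>) + (5832 / real n) * (\<Sum>v\<in>Z. \<Sum>v'\<in>Z. \<bar>f \<omega> v\<bar> * s \<omega> v'))"
      by (rule avg_mono) (rule pointwise)
    also have "\<dots> = (\<Sum>v\<in>Z. avg W (\<lambda>\<omega>. \<bar>G (\<Theta> v -` \<omega>)\<bar>)) + (5832 / real n) * (\<Sum>v\<in>Z. \<Sum>v'\<in>Z. avg W (\<lambda>\<omega>. \<bar>f \<omega> v\<bar> * s \<omega> v'))"
      by (simp only: avg_add avg_mult avg_sum)
    also have "\<dots> \<le> (2 * real n * B + real (card bad) * (5 * R))
        + (5832 / real n) * ((2 * real n) * (2 * real n) * (p * A) + R * (4 * real n * real (card bad) + 2 * real n * real (card K * card K)))"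
      using n0 by (intro add_mono upper mult_left_mono pairs) auto
    also have "\<dots> = 2 * real n * (B + 11664 * p * A) + real (card bad) * (23333 * R) + 11664 * R * real (card K * card K)"
      using n0 by (simp add: field_simps)
    also have "\<dots> \<le> 2 * real n * (B + 11664 * p * A) + (\<epsilon> * real n) * (23333 * R) + 11664 * R * (\<epsilon> * real n)"
    proof (intro add_mono mult_left_mono mult_right_mono card_bad order_refl)
      have "real (card K * card K) \<le> \<epsilon> * real N0" using N0 \<epsilon> by (simp add: pos_divide_le_eq mult.commute)
      also have "\<dots> \<le> \<epsilon> * real n" using n \<epsilon> by (intro mult_left_mono) auto
      finally show "real (card K * card K) \<le> \<epsilon> * real n" .
    qed (use R0 p0 A0 in auto)
    finally have "2 * real n * A \<le> 2 * real n * (B + 11664 * p * A) + \<epsilon> * real n * (34997 * R) + real (card bad) * A"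
      by (simp add: algebra_simps)
    also have "\<dots> \<le> 2 * real n * (B + 11664 * p * A) + \<epsilon> * real n * (40000 * R) + (\<epsilon> * real n) * A"
      using R0 A0 \<epsilon> n0 by (intro add_mono mult_left_mono mult_right_mono card_bad) auto
    also have "\<dots> = 2 * real n * (B + 11664 * p * A + \<epsilon> * (A / 2 + 20000 * R))" by (simp add: algebra_simps)
    finally show ?thesis using n0 by simp
  qed
  have "A \<le> B + 11664 * p * A"
  proof (rule field_le_epsilon)
    fix e :: real assume e: "e > 0"
    define q where "q = A / 2 + 20000 * R + 1"
    have q: "q > 0" using A0 R0 by (simp add: q_def add_nonneg_pos)
    have "A \<le> B + 11664 * p * A + (e / q) * (A / 2 + 20000 * R)" using e q by (intro approx) simp
    also have "(e / q) * (A / 2 + 20000 * R) \<le> (e / q) * q" using e q by (intro mult_left_mono) (auto simp: q_def)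
    also have "(e / q) * q = e" using q by simp
    finally show "A \<le> B + 11664 * p * A + e" by simp
  qed
  then show ?thesis by (simp add: A_def B_def)
qed

section \<open>Binary digits\<close>

definition digits :: "real \<Rightarrow> nat set"
  where "digits x = {k. odd \<lfloor>2 ^ Suc k * x\<rfloor>}"

primrec bin_val :: "nat \<Rightarrow> nat set \<Rightarrow> nat"
  where "bin_val 0 D = 0"
  | "bin_val (Suc m) D = 2 * bin_val m D + (if m \<in> D then 1 else 0)"

lemma bin_val_digits:
  assumes "0 \<le> x" "x < 1"
  shows "int (bin_val m (digits x)) = \<lfloor>2 ^ m * x\<rfloor>"
proof (induction m)
  case 0
  then show ?case using assms by (simp add: floor_eq_iff)
next
  case (Suc m)
  define y where "y = 2 ^ m * x"
  have y: "2 ^ Suc m * x = 2 * y" by (simp add: y_def)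
  have "\<lfloor>2 * y\<rfloor> = 2 * \<lfloor>y\<rfloor> \<or> \<lfloor>2 * y\<rfloor> = 2 * \<lfloor>y\<rfloor> + 1" by linarith
  then have "\<lfloor>2 * y\<rfloor> = 2 * \<lfloor>y\<rfloor> + (if odd \<lfloor>2 * y\<rfloor> then 1 else 0)" by auto
  then show ?case using Suc by (auto simp: digits_def y y_def[symmetric] simp del: power_Suc split: if_splits)
qed

lemma bin_val_less: "bin_val m D < 2 ^ m"
  by (induction m) auto

lemma bin_val_cong: "(\<And>k. k < m \<Longrightarrow> k \<in> D \<longleftrightarrow> k \<in> D') \<Longrightarrow> bin_val m D = bin_val m D'"
  by (induction m) auto

lemma bin_val_inj: "bin_val m D = bin_val m D' \<Longrightarrow> k < m \<Longrightarrow> k \<in> D \<longleftrightarrow> k \<in> D'"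
proof (induction m)
  case (Suc m)
  have "m \<in> D \<longleftrightarrow> m \<in> D'" "bin_val m D = bin_val m D'"
    using Suc.prems(1) by (auto split: if_splits) presburger+
  then show ?case using Suc by (cases "k = m") auto
qed simp

lemma bij_bin_val: "bij_betw (bin_val m) (Pow {..<m}) {..<2 ^ m}"
proof -
  have inj: "inj_on (bin_val m) (Pow {..<m})"
    by (rule inj_onI) (use bin_val_inj in blast)
  moreover have "bin_val m ` Pow {..<m} = {..<2 ^ m}"
  proof (rule card_subset_eq)
    show "card (bin_val m ` Pow {..<m}) = card {..<2 ^ m::nat}"
      by (simp add: card_image[OF inj] card_Pow)
  qed (auto simp: bin_val_less)
  ultimately show ?thesis by (simp add: bij_betw_def)
qed

lemma depends_on_bin_val: "depends_on {..<m} (\<lambda>D. H (bin_val m D))"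
  unfolding depends_on_def by (intro allI arg_cong[of _ _ H] bin_val_cong) auto

lemma depends_on_factors:
  assumes F: "depends_on {..<m} F"
  shows "\<exists>H. \<forall>D. F D = H (bin_val m D)"
proof (intro exI allI)
  fix D
  have "the_inv_into (Pow {..<m}) (bin_val m) (bin_val m (D \<inter> {..<m})) = D \<inter> {..<m}"
    using bij_bin_val by (intro the_inv_into_f_f) (auto simp: bij_betw_def)
  moreover have "bin_val m (D \<inter> {..<m}) = bin_val m D" by (rule bin_val_cong) auto
  ultimately show "F D = (\<lambda>j. F (the_inv_into (Pow {..<m}) (bin_val m) j)) (bin_val m D)"
    using depends_onD[OF F, of D] by simp
qed

lemma emeasure_leb01: "emeasure leb01 {0<..<1} = 1"
  by (subst emeasure_restrict_space) auto

lemma finite_measure_leb01: "finite_measure leb01"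
  by (rule finite_measureI) (simp add: emeasure_leb01)

lemma measure_leb01: "A \<subseteq> {0<..<1} \<Longrightarrow> measure leb01 A = measure lebesgue A"
  by (rule measure_restrict_space) auto

lemma sets_leb01: "A \<in> sets leb01 \<longleftrightarrow> A \<subseteq> {0<..<1} \<and> A \<in> sets lebesgue"
  by (subst sets_restrict_space_iff) auto

text \<open>The binary digits of a uniformly distributed number are independent fair bits.\<close>

lemma digits_integral:
  assumes F: "depends_on {..<m} F"
  shows "integrable leb01 (\<lambda>x. F (digits x))" "(LINT x|leb01. F (digits x)) = avg {..<m} F"
proof -
  obtain H where H: "\<And>D. F D = H (bin_val m D)" using depends_on_factors[OF F] by blast
  define A where "A j = {0<..<1} \<inter> {real j / 2 ^ m..<(real j + 1) / 2 ^ m}" for j :: nat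
  have A_meas: "A j \<in> sets leb01" for j by (auto simp: sets_leb01 A_def)
  have in_A: "x \<in> A j \<longleftrightarrow> bin_val m (digits x) = j" if "x \<in> {0<..<1}" for x j
  proof -
    have "bin_val m (digits x) = j \<longleftrightarrow> \<lfloor>2 ^ m * x\<rfloor> = int j" using bin_val_digits[of x m] that by auto
    also have "\<dots> \<longleftrightarrow> x \<in> A j" using that by (auto simp: A_def floor_eq_iff field_simps)
    finally show ?thesis by simp
  qed
  have eq: "F (digits x) = (\<Sum>j<2 ^ m. H j * indicator (A j) x)" if "x \<in> space leb01" for x
  proof -
    have "(\<Sum>j<2 ^ m. H j * indicator (A j) x) = (\<Sum>j<2 ^ m. if j = bin_val m (digits x) then H j else 0)"
      using in_A[of x] that by (intro sum.cong) (auto simp: indicator_def)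
    then show ?thesis by (simp add: H bin_val_less)
  qed
  have m_A: "measure leb01 (A j) = 1 / 2 ^ m" if j: "j < 2 ^ m" for j
  proof -
    have "real j + 1 \<le> 2 ^ m" using j by (metis Suc_leI of_nat_Suc of_nat_le_iff of_nat_numeral of_nat_power add.commute)
    then have top: "(real j + 1) / 2 ^ m \<le> 1" by simp
    have "measure lebesgue (A j) = measure lebesgue {real j / 2 ^ m..<(real j + 1) / 2 ^ m}"
    proof (cases "j = 0")
      case True
      moreover have "x < 1" if "x < 1 / 2 ^ m" for x :: real
        by (rule less_le_trans[OF that]) simp
      ultimately have "A j = {0<..<1 / 2 ^ m}" by (auto simp: A_def)
      then show ?thesis using True by simp
    next
      case False
      then have "0 < real j / 2 ^ m" by simp
      moreover have "x < 1" if "x < (real j + 1) / 2 ^ m" for x :: real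
        by (rule less_le_trans[OF that top])
      ultimately have "A j = {real j / 2 ^ m..<(real j + 1) / 2 ^ m}" by (auto simp: A_def)
      then show ?thesis by simp
    qed
    also have "\<dots> = 1 / 2 ^ m" by (simp add: divide_right_mono diff_divide_distrib[symmetric])
    finally show ?thesis by (simp add: measure_leb01 A_def)
  qed
  have int: "integrable leb01 (\<lambda>x. H j * indicator (A j) x :: real)" for j
    using A_meas finite_measure.emeasure_finite[OF finite_measure_leb01]
    by (intro integrable_mult_right integrable_real_indicator) (auto simp: less_top[symmetric])
  show "integrable leb01 (\<lambda>x. F (digits x))"
    by (subst Bochner_Integration.integrable_cong[OF refl eq], assumption, rule Bochner_Integration.integrable_sum, rule int)
  have "(LINT x|leb01. F (digits x)) = (LINT x|leb01. (\<Sum>j<2 ^ m. H j * indicator (A j) x))"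
    by (rule Bochner_Integration.integral_cong[OF refl eq])
  also have "\<dots> = (\<Sum>j<2 ^ m. LINT x|leb01. H j * indicator (A j) x)"
    by (rule Bochner_Integration.integral_sum) (rule int)
  also have "\<dots> = (\<Sum>j<2 ^ m. H j / 2 ^ m)"
    using A_meas sets.Int_space_eq2[OF A_meas] by (intro sum.cong refl) (simp add: m_A)
  also have "\<dots> = avg {..<m} F"
    using sum.reindex_bij_betw[OF bij_bin_val[of m], of H] by (simp add: avg_def H sum_divide_distrib)
  finally show "(LINT x|leb01. F (digits x)) = avg {..<m} F" .
qed

text \<open>A measurable set is approximated from outside by an open set, and an open set from inside by the
  dyadic intervals of a fixed length that it contains.\<close>

lemma digits_dense_indicator:
  assumes A: "A \<in> sets leb01" and e: "e > 0"
  shows "\<exists>m G. depends_on {..<m} G \<and> (\<forall>D. G D \<in> {0, 1 :: real}) \<and>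
    (LINT x|leb01. \<bar>indicator A x - G (digits x)\<bar>) < e"
proof -
  interpret finite_measure leb01 by (rule finite_measure_leb01)
  have A': "A \<subseteq> {0<..<1}" "A \<in> sets lebesgue" using A by (auto simp: sets_leb01)
  obtain T where T: "open T" "A \<subseteq> T" "T - A \<in> lmeasurable" "emeasure lebesgue (T - A) < ennreal (e / 2)"
    using sets_lebesgue_outer_open[OF A'(2), of "e / 2"] e by auto
  define U where "U = T \<inter> {0<..<1}"
  have U: "U \<in> sets leb01" "A \<subseteq> U" "open U" using T A' by (auto simp: U_def sets_leb01 lborelD)
  have fin: "emeasure leb01 B < \<infinity>" for B using emeasure_finite by (simp add: less_top[symmetric])
  have "(LINT x|leb01. \<bar>indicator A x - indicator U x :: real\<bar>) = (LINT x|leb01. indicator (U - A) x)"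
    using U(2) by (intro Bochner_Integration.integral_cong) (auto simp: indicator_def)
  also have "\<dots> = measure leb01 (U - A)"
  proof -
    have "(U - A) \<inter> space leb01 = U - A" by (auto simp: U_def)
    then show ?thesis by simp
  qed
  also have "\<dots> = measure lebesgue (U - A)" by (rule measure_leb01) (auto simp: U_def)
  also have "\<dots> \<le> measure lebesgue (T - A)"
    using T(3) U A' by (intro measure_mono_fmeasurable) (auto simp: U_def sets_leb01)
  also have "\<dots> < e / 2"
    using T(3,4) e by (subst (asm) emeasure_eq_measure2) (auto simp: ennreal_less_iff)
  finally have AU: "(LINT x|leb01. \<bar>indicator A x - indicator U x :: real\<bar>) < e / 2" .
  define H where "H m j = (if {real j / 2 ^ m..(real j + 1) / 2 ^ m} \<subseteq> U then 1 else 0 :: real)" for m j :: nat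
  define G where "G m D = H m (bin_val m D)" for m D
  have dG: "depends_on {..<m} (G m)" for m unfolding G_def by (rule depends_on_bin_val)
  have near: "\<bar>x - y\<bar> \<le> 1 / 2 ^ m" and in_int: "x \<in> {real (bin_val m (digits x)) / 2 ^ m..(real (bin_val m (digits x)) + 1) / 2 ^ m}"
    if x: "x \<in> {0<..<1}" and y: "y \<in> {real (bin_val m (digits x)) / 2 ^ m..(real (bin_val m (digits x)) + 1) / 2 ^ m}" for x y m
  proof -
    define j where "j = bin_val m (digits x)"
    have "int j = \<lfloor>2 ^ m * x\<rfloor>" using bin_val_digits[of x m] x by (simp add: j_def)
    then have "real j \<le> 2 ^ m * x" "2 ^ m * x < real j + 1" by linarith+
    then have *: "real j / 2 ^ m \<le> x" "x \<le> (real j + 1) / 2 ^ m" by (auto simp: field_simps)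
    then show "x \<in> {real (bin_val m (digits x)) / 2 ^ m..(real (bin_val m (digits x)) + 1) / 2 ^ m}" by (simp add: j_def)
    show "\<bar>x - y\<bar> \<le> 1 / 2 ^ m" using y * unfolding j_def[symmetric] atLeastAtMost_iff add_divide_distrib by linarith
  qed
  have lim: "(\<lambda>m. \<bar>indicator U x - G m (digits x)\<bar>) \<longlonglongrightarrow> 0" if x: "x \<in> space leb01" for x
  proof (rule tendsto_eventually)
    show "\<forall>\<^sub>F m in sequentially. \<bar>indicator U x - G m (digits x)\<bar> = 0"
    proof (cases "x \<in> U")
      case True
      then obtain r where r: "r > 0" "ball x r \<subseteq> U" using U(3) openE by blast
      have "(\<lambda>m. (1 / 2 :: real) ^ m) \<longlonglongrightarrow> 0" by (rule LIMSEQ_power_zero) simp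
      then have "\<forall>\<^sub>F m in sequentially. (1 / 2 :: real) ^ m < r" using r(1) by (rule order_tendstoD)
      then show ?thesis
      proof eventually_elim
        case (elim m)
        have "{real (bin_val m (digits x)) / 2 ^ m..(real (bin_val m (digits x)) + 1) / 2 ^ m} \<subseteq> ball x r"
          using near[of x _ m] x elim by (fastforce simp: dist_real_def power_one_over)
        then show ?case using True r(2) by (auto simp: G_def H_def)
      qed
    next
      case False
      have "G m (digits x) = 0" for m
      proof -
        define j where "j = bin_val m (digits x)"
        have "real j / 2 ^ m \<in> {real j / 2 ^ m..(real j + 1) / 2 ^ m}" by (simp add: divide_right_mono)
        then show ?thesis using in_int[of x "real j / 2 ^ m" m] x False by (auto simp: G_def H_def j_def)
      qed
      then show ?thesis using False by simp
    qed
  qed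
  have intG: "integrable leb01 (\<lambda>x. G m (digits x))" for m by (rule digits_integral(1)[OF dG])
  have intU: "integrable leb01 (indicator U :: real \<Rightarrow> real)" using U(1) fin by (intro integrable_real_indicator)
  have intA: "integrable leb01 (indicator A :: real \<Rightarrow> real)" using A fin by (intro integrable_real_indicator)
  have "(\<lambda>m. LINT x|leb01. \<bar>indicator U x - G m (digits x)\<bar>) \<longlonglongrightarrow> (LINT x|leb01. 0)"
  proof (rule integral_dominated_convergence[where w = "\<lambda>_. 1"])
    show "AE x in leb01. (\<lambda>m. \<bar>indicator U x - G m (digits x)\<bar>) \<longlonglongrightarrow> 0" using lim by (intro AE_I2)
    show "AE x in leb01. norm \<bar>indicator U x - G m (digits x)\<bar> \<le> 1" for m
      by (intro AE_I2) (auto simp: G_def H_def indicator_def)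
    show "(\<lambda>x. \<bar>indicator U x - G m (digits x)\<bar>) \<in> borel_measurable leb01" for m
      using intU intG by (intro borel_measurable_abs borel_measurable_diff borel_measurable_integrable)
  qed auto
  then have "\<forall>\<^sub>F m in sequentially. (LINT x|leb01. \<bar>indicator U x - G m (digits x)\<bar>) < e / 2"
    using e by (intro order_tendstoD(2)) auto
  then obtain m where m: "(LINT x|leb01. \<bar>indicator U x - G m (digits x)\<bar>) < e / 2"
    by (meson eventually_happens trivial_limit_sequentially)
  have "(LINT x|leb01. \<bar>indicator A x - G m (digits x)\<bar>)
      \<le> (LINT x|leb01. \<bar>indicator A x - indicator U x\<bar> + \<bar>indicator U x - G m (digits x)\<bar>)"
    using intA intU intG by (intro integral_mono) auto
  also have "\<dots> = (LINT x|leb01. \<bar>indicator A x - indicator U x\<bar>) + (LINT x|leb01. \<bar>indicator U x - G m (digits x)\<bar>)"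
    using intA intU intG by (intro Bochner_Integration.integral_add) auto
  finally have "(LINT x|leb01. \<bar>indicator A x - G m (digits x)\<bar>) < e" using AU m by simp
  then show ?thesis using dG[of m] by (intro exI[of _ m] exI[of _ "G m"]) (auto simp: G_def H_def)
qed

lemma integral_abs_diff_tendsto_0:
  fixes f :: "'a \<Rightarrow> real"
  assumes s: "\<And>i. integrable M (s i)" and f: "integrable M f"
    and lim: "\<And>x. x \<in> space M \<Longrightarrow> (\<lambda>i. s i x) \<longlonglongrightarrow> f x"
    and dom: "\<And>i x. x \<in> space M \<Longrightarrow> norm (s i x) \<le> 2 * norm (f x)"
  shows "(\<lambda>i. LINT x|M. \<bar>s i x - f x\<bar>) \<longlonglongrightarrow> 0"
proof -
  have "(\<lambda>i. LINT x|M. \<bar>s i x - f x\<bar>) \<longlonglongrightarrow> (LINT x|M. 0)"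
  proof (rule integral_dominated_convergence[where w = "\<lambda>x. 3 * \<bar>f x\<bar>"])
    show "AE x in M. (\<lambda>i. \<bar>s i x - f x\<bar>) \<longlonglongrightarrow> 0"
    proof (intro AE_I2)
      fix x assume "x \<in> space M"
      from tendsto_rabs[OF tendsto_diff[OF lim[OF this] tendsto_const[of "f x"]]]
      show "(\<lambda>i. \<bar>s i x - f x\<bar>) \<longlonglongrightarrow> 0" by simp
    qed
    show "AE x in M. norm \<bar>s i x - f x\<bar> \<le> 3 * \<bar>f x\<bar>" for i
    proof (intro AE_I2)
      fix x assume "x \<in> space M"
      from dom[OF this, of i] show "norm \<bar>s i x - f x\<bar> \<le> 3 * \<bar>f x\<bar>" by simp
    qed
  qed (use s f in auto)
  then show ?thesis by simp
qed

lemma digits_dense: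
  assumes f: "integrable leb01 f"
  shows "\<forall>e>0. \<exists>m F. depends_on {..<m} F \<and> (LINT x|leb01. \<bar>f x - F (digits x)\<bar>) < (e::real)"
  using f
proof (induct rule: integrable_induct)
  case (base A c)
  show ?case
  proof (intro allI impI)
    fix e :: real assume e: "e > 0"
    then obtain m G where G: "depends_on {..<m} G" "(LINT x|leb01. \<bar>indicator A x - G (digits x)\<bar>) < e / (\<bar>c\<bar> + 1)"
      using digits_dense_indicator[OF base(1), of "e / (\<bar>c\<bar> + 1)"] by auto
    have "(LINT x|leb01. \<bar>indicator A x *\<^sub>R c - c * G (digits x)\<bar>) = (LINT x|leb01. \<bar>c\<bar> * \<bar>indicator A x - G (digits x)\<bar>)"
      by (intro Bochner_Integration.integral_cong refl) (simp add: abs_mult[symmetric] algebra_simps)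
    also have "\<dots> = \<bar>c\<bar> * (LINT x|leb01. \<bar>indicator A x - G (digits x)\<bar>)" by simp
    also have "\<dots> \<le> (\<bar>c\<bar> + 1) * (LINT x|leb01. \<bar>indicator A x - G (digits x)\<bar>)"
      by (intro mult_right_mono Bochner_Integration.integral_nonneg) auto
    also have "\<dots> < e" using G(2) by (simp add: pos_less_divide_eq mult.commute add_nonneg_pos)
    finally show "\<exists>m F. depends_on {..<m} F \<and> (LINT x|leb01. \<bar>indicator A x *\<^sub>R c - F (digits x)\<bar>) < e"
      using depends_on_comp[OF G(1), of "\<lambda>y. c * y"] by (intro exI[of _ m] exI[of _ "\<lambda>D. c * G D"]) auto
  qed
next
  case (add f g)
  show ?case
  proof (intro allI impI)
    fix e :: real assume e: "e > 0"
    then obtain m F n G where F: "depends_on {..<m} F" "(LINT x|leb01. \<bar>f x - F (digits x)\<bar>) < e / 2"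
      and G: "depends_on {..<n} G" "(LINT x|leb01. \<bar>g x - G (digits x)\<bar>) < e / 2"
      using add(2)[rule_format, of "e / 2"] add(4)[rule_format, of "e / 2"] by auto
    note iF = digits_integral(1)[OF F(1)] and iG = digits_integral(1)[OF G(1)]
    have "(LINT x|leb01. \<bar>f x + g x - (F (digits x) + G (digits x))\<bar>)
        \<le> (LINT x|leb01. \<bar>f x - F (digits x)\<bar> + \<bar>g x - G (digits x)\<bar>)"
      using add iF iG by (intro integral_mono) auto
    also have "\<dots> = (LINT x|leb01. \<bar>f x - F (digits x)\<bar>) + (LINT x|leb01. \<bar>g x - G (digits x)\<bar>)"
      using add iF iG by (intro Bochner_Integration.integral_add) auto
    finally have "(LINT x|leb01. \<bar>f x + g x - (F (digits x) + G (digits x))\<bar>) < e" using F G by simp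
    moreover have "depends_on {..<max m n} (\<lambda>D. F D + G D)"
      using depends_on_mono[OF F(1), of "{..<max m n}"] depends_on_mono[OF G(1), of "{..<max m n}"]
      unfolding depends_on_def by simp
    ultimately show "\<exists>m H. depends_on {..<m} H \<and> (LINT x|leb01. \<bar>f x + g x - H (digits x)\<bar>) < e"
      by (intro exI[of _ "max m n"] exI[of _ "\<lambda>D. F D + G D"]) auto
  qed
next
  case (lim f s)
  show ?case
  proof (intro allI impI)
    fix e :: real assume e: "e > 0"
    have "(\<lambda>i. LINT x|leb01. \<bar>s i x - f x\<bar>) \<longlonglongrightarrow> 0"
      by (rule integral_abs_diff_tendsto_0[OF lim(1,5,3,4)])
    then have "(\<lambda>i. LINT x|leb01. \<bar>f x - s i x\<bar>) \<longlonglongrightarrow> 0" by (simp only: abs_minus_commute)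
    then have "\<forall>\<^sub>F i in sequentially. (LINT x|leb01. \<bar>f x - s i x\<bar>) < e / 2"
      using e by (intro order_tendstoD(2)) auto
    then obtain i where i: "(LINT x|leb01. \<bar>f x - s i x\<bar>) < e / 2"
      by (meson eventually_happens trivial_limit_sequentially)
    obtain m F where F: "depends_on {..<m} F" "(LINT x|leb01. \<bar>s i x - F (digits x)\<bar>) < e / 2"
      using lim(2)[rule_format, of "e / 2" i] e by auto
    have "(LINT x|leb01. \<bar>f x - F (digits x)\<bar>) \<le> (LINT x|leb01. \<bar>f x - s i x\<bar> + \<bar>s i x - F (digits x)\<bar>)"
      using lim(1,5) digits_integral(1)[OF F(1)] by (intro integral_mono) auto
    also have "\<dots> = (LINT x|leb01. \<bar>f x - s i x\<bar>) + (LINT x|leb01. \<bar>s i x - F (digits x)\<bar>)"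
      using lim(1,5) digits_integral(1)[OF F(1)] by (intro Bochner_Integration.integral_add) auto
    finally show "\<exists>m F. depends_on {..<m} F \<and> (LINT x|leb01. \<bar>f x - F (digits x)\<bar>) < e" using F i by force
  qed
qed

section \<open>Functionals and densities on the unit interval\<close>

abbreviation mk :: "(real \<Rightarrow> real) \<Rightarrow> L1" where "mk \<equiv> abs_L1"

lemma L1_cases: obtains f where "integrable leb01 f" "x = mk f"
proof
  show "integrable leb01 (rep_L1 x)"
    using Quotient3_rep_reflp[OF Quotient3_L1, of x] by (simp add: L1_rel_def)
  show "x = mk (rep_L1 x)" using Quotient3_abs_rep[OF Quotient3_L1, of x] by simp
qed

lemma norm_mk: "integrable leb01 f \<Longrightarrow> norm (mk f) = (LINT x|leb01. \<bar>f x\<bar>)"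
  by (simp add: norm_L1.abs_eq L1_rel_def eq_onp_def)

lemma mk_add: "integrable leb01 f \<Longrightarrow> integrable leb01 g \<Longrightarrow> mk f + mk g = mk (\<lambda>x. f x + g x)"
  by (simp add: plus_L1.abs_eq L1_rel_def eq_onp_def)

lemma mk_diff: "integrable leb01 f \<Longrightarrow> integrable leb01 g \<Longrightarrow> mk f - mk g = mk (\<lambda>x. f x - g x)"
  by (simp add: minus_L1.abs_eq L1_rel_def eq_onp_def)

lemma mk_scaleR: "integrable leb01 f \<Longrightarrow> c *\<^sub>R mk f = mk (\<lambda>x. c * f x)"
  by (simp add: scaleR_L1.abs_eq L1_rel_def eq_onp_def)

lemma mk_zero: "mk (\<lambda>_. 0) = 0"
  by (simp add: zero_L1_def)

lemma integrable_bounded_mult: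
  fixes f g :: "real \<Rightarrow> real"
  assumes f: "integrable leb01 f" and g: "g \<in> borel_measurable leb01" "\<And>x. \<bar>g x\<bar> \<le> B"
  shows "integrable leb01 (\<lambda>x. g x * f x)"
proof (rule Bochner_Integration.integrable_bound)
  show "integrable leb01 (\<lambda>x. B * f x)" using f by simp
  have "0 \<le> B" using g(2)[of 0] by linarith
  then show "AE x in leb01. norm (g x * f x) \<le> norm (B * f x)"
    using g(2) by (intro AE_I2) (simp add: abs_mult mult_right_mono)
qed (use f g in auto)

lemma abs_integral_bounded_mult_le:
  fixes f g :: "real \<Rightarrow> real"
  assumes f: "integrable leb01 f" and g: "g \<in> borel_measurable leb01" "\<And>x. \<bar>g x\<bar> \<le> B"
  shows "(LINT x|leb01. \<bar>g x * f x\<bar>) \<le> B * (LINT x|leb01. \<bar>f x\<bar>)"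
proof -
  have "(LINT x|leb01. \<bar>g x * f x\<bar>) \<le> (LINT x|leb01. B * \<bar>f x\<bar>)"
    using f integrable_bounded_mult[OF f g] g(2)
    by (intro integral_mono integrable_abs) (auto simp: abs_mult mult_right_mono)
  then show ?thesis by simp
qed

definition bdd_fun :: "(real \<Rightarrow> real) \<Rightarrow> bool"
  where "bdd_fun g \<longleftrightarrow> g \<in> borel_measurable leb01 \<and> (\<exists>B. \<forall>x. \<bar>g x\<bar> \<le> B)"

lemma bdd_fun_indicator: "A \<in> sets leb01 \<Longrightarrow> bdd_fun (indicator A)"
  unfolding bdd_fun_def by (intro conjI borel_measurable_indicator exI[of _ 1]) (auto simp: indicator_def)

lemma integrable_bdd_fun: "bdd_fun g \<Longrightarrow> integrable leb01 f \<Longrightarrow> integrable leb01 (\<lambda>x. g x * f x)"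
  unfolding bdd_fun_def using integrable_bounded_mult by blast

lift_definition mult_L1 :: "(real \<Rightarrow> real) \<Rightarrow> L1 \<Rightarrow> L1"
  is "\<lambda>g f x. if bdd_fun g then g x * f x else 0"
proof -
  fix g f1 f2 :: "real \<Rightarrow> real"
  assume "L1_rel f1 f2"
  then show "L1_rel (\<lambda>x. if bdd_fun g then g x * f1 x else 0) (\<lambda>x. if bdd_fun g then g x * f2 x else 0)"
    by (cases "bdd_fun g") (auto simp: L1_rel_def integrable_bdd_fun elim: eventually_mono)
qed

lift_definition pair_L1 :: "(real \<Rightarrow> real) \<Rightarrow> L1 \<Rightarrow> real"
  is "\<lambda>g f. if bdd_fun g then LINT x|leb01. g x * f x else 0"
  unfolding L1_rel_def
  by (auto intro!: integral_cong_AE simp: bdd_fun_def elim: eventually_mono)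

lemma mult_L1_mk: "bdd_fun g \<Longrightarrow> integrable leb01 f \<Longrightarrow> mult_L1 g (mk f) = mk (\<lambda>x. g x * f x)"
  by (subst mult_L1.abs_eq) (auto simp: L1_rel_def)

lemma pair_L1_mk: "bdd_fun g \<Longrightarrow> integrable leb01 f \<Longrightarrow> pair_L1 g (mk f) = (LINT x|leb01. g x * f x)"
  by (subst pair_L1.abs_eq) (auto simp: L1_rel_def)

lemma norm_mult_L1_le:
  assumes "bdd_fun g" "\<And>x. \<bar>g x\<bar> \<le> B"
  shows "norm (mult_L1 g x) \<le> B * norm x"
proof -
  obtain f where f: "integrable leb01 f" "x = mk f" by (rule L1_cases)
  then show ?thesis
    using abs_integral_bounded_mult_le[OF f(1) _ assms(2)] assms(1)
    by (simp add: mult_L1_mk norm_mk integrable_bdd_fun) (auto simp: bdd_fun_def)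
qed

lemma abs_pair_L1_le:
  assumes "bdd_fun g" "\<And>x. \<bar>g x\<bar> \<le> B"
  shows "\<bar>pair_L1 g x\<bar> \<le> B * norm x"
proof -
  obtain f where f: "integrable leb01 f" "x = mk f" by (rule L1_cases)
  have "\<bar>pair_L1 g x\<bar> \<le> (LINT x|leb01. \<bar>g x * f x\<bar>)"
    using assms(1) f integral_abs_bound by (simp add: pair_L1_mk)
  also have "\<dots> \<le> B * norm x"
    using abs_integral_bounded_mult_le[OF f(1) _ assms(2)] assms(1) f by (auto simp: norm_mk bdd_fun_def)
  finally show ?thesis .
qed

lemma bounded_linear_mult_L1: "bdd_fun g \<Longrightarrow> bounded_linear (mult_L1 g)"
proof -
  assume g: "bdd_fun g"
  then obtain B where B: "\<And>x. \<bar>g x\<bar> \<le> B" by (auto simp: bdd_fun_def)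
  show ?thesis
  proof (rule bounded_linear_intro[where K = B])
    fix x y :: L1 and r :: real
    obtain f where f: "integrable leb01 f" "x = mk f" by (rule L1_cases)
    obtain h where h: "integrable leb01 h" "y = mk h" by (rule L1_cases)
    show "mult_L1 g (x + y) = mult_L1 g x + mult_L1 g y"
      using f h g by (simp add: mk_add mult_L1_mk integrable_bdd_fun distrib_left)
    show "mult_L1 g (r *\<^sub>R x) = r *\<^sub>R mult_L1 g x"
      using f g by (simp add: mk_scaleR mult_L1_mk integrable_bdd_fun mult.left_commute)
    show "norm (mult_L1 g x) \<le> norm x * B"
      using norm_mult_L1_le[OF g B] by (simp add: mult.commute)
  qed
qed

lemma bounded_linear_pair_L1: "bdd_fun g \<Longrightarrow> bounded_linear (pair_L1 g)"
proof -
  assume g: "bdd_fun g"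
  then obtain B where B: "\<And>x. \<bar>g x\<bar> \<le> B" by (auto simp: bdd_fun_def)
  show ?thesis
  proof (rule bounded_linear_intro[where K = B])
    fix x y :: L1 and r :: real
    obtain f where f: "integrable leb01 f" "x = mk f" by (rule L1_cases)
    obtain h where h: "integrable leb01 h" "y = mk h" by (rule L1_cases)
    show "pair_L1 g (x + y) = pair_L1 g x + pair_L1 g y"
      using f h g integrable_bdd_fun[OF g f(1)] integrable_bdd_fun[OF g h(1)]
      by (simp add: mk_add pair_L1_mk distrib_left)
    show "pair_L1 g (r *\<^sub>R x) = r *\<^sub>R pair_L1 g x"
      using f g by (simp add: mk_scaleR pair_L1_mk mult.left_commute)
    show "norm (pair_L1 g x) \<le> norm x * B"
      using abs_pair_L1_le[OF g B] by (simp add: mult.commute)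
  qed
qed

definition proj :: "real set \<Rightarrow> L1 \<Rightarrow>\<^sub>L L1"
  where "proj A = Blinfun (mult_L1 (indicator A))"

definition pairing :: "(real \<Rightarrow> real) \<Rightarrow> L1 \<Rightarrow>\<^sub>L real"
  where "pairing g = Blinfun (pair_L1 g)"

lemma proj_mk: "A \<in> sets leb01 \<Longrightarrow> integrable leb01 f \<Longrightarrow> proj A (mk f) = mk (\<lambda>x. indicator A x * f x)"
  using bounded_linear_Blinfun_apply[OF bounded_linear_mult_L1[OF bdd_fun_indicator]]
  by (simp add: proj_def mult_L1_mk bdd_fun_indicator)

lemma pairing_mk: "bdd_fun g \<Longrightarrow> integrable leb01 f \<Longrightarrow> pairing g (mk f) = (LINT x|leb01. g x * f x)"
  using bounded_linear_Blinfun_apply[OF bounded_linear_pair_L1] by (simp add: pairing_def pair_L1_mk)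

lemma norm_pairing_le:
  assumes "bdd_fun g" "\<And>x. \<bar>g x\<bar> \<le> B"
  shows "norm (pairing g) \<le> B"
proof (rule norm_blinfun_bound)
  show "0 \<le> B" using assms(2)[of 0] by linarith
  show "norm (pairing g x) \<le> B * norm x" for x
    using abs_pair_L1_le[OF assms] bounded_linear_Blinfun_apply[OF bounded_linear_pair_L1[OF assms(1)]]
    by (simp add: pairing_def)
qed

lemma integrable_indicator_mult:
  fixes f :: "real \<Rightarrow> real"
  shows "A \<in> sets leb01 \<Longrightarrow> integrable leb01 f \<Longrightarrow> integrable leb01 (\<lambda>x. indicator A x * f x)"
  by (rule integrable_bdd_fun[OF bdd_fun_indicator])

lemma proj_proj: "A \<in> sets leb01 \<Longrightarrow> B \<in> sets leb01 \<Longrightarrow> proj A (proj B x) = proj (A \<inter> B) x"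
  by (rule L1_cases[of x]) (simp add: proj_mk integrable_indicator_mult sets.Int indicator_inter_arith mult.assoc)

lemma proj_Un:
  assumes "A \<in> sets leb01" "B \<in> sets leb01" "A \<inter> B = {}"
  shows "proj (A \<union> B) x = proj A x + proj B x" "norm (proj A x) + norm (proj B x) = norm (proj (A \<union> B) x)"
proof -
  obtain f where f: "integrable leb01 f" "x = mk f" by (rule L1_cases)
  have ind: "indicator (A \<union> B) t = indicator A t + (indicator B t :: real)" for t
    using assms(3) by (auto simp: indicator_def)
  note i = integrable_indicator_mult[OF assms(1) f(1)] integrable_indicator_mult[OF assms(2) f(1)]
    integrable_indicator_mult[OF sets.Un[OF assms(1,2)] f(1)]
  show "proj (A \<union> B) x = proj A x + proj B x"
    using assms i by (simp add: f proj_mk mk_add sets.Un ind distrib_right)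
  have "(LINT t|leb01. \<bar>indicator A t * f t\<bar>) + (LINT t|leb01. \<bar>indicator B t * f t\<bar>)
      = (LINT t|leb01. \<bar>indicator A t * f t\<bar> + \<bar>indicator B t * f t\<bar>)"
    using i by simp
  also have "\<dots> = (LINT t|leb01. \<bar>indicator (A \<union> B) t * f t\<bar>)"
    using assms(3) by (intro Bochner_Integration.integral_cong refl) (auto simp: indicator_def)
  finally show "norm (proj A x) + norm (proj B x) = norm (proj (A \<union> B) x)"
    using assms i by (simp add: f proj_mk norm_mk sets.Un)
qed

lemma norm_proj_le: "A \<in> sets leb01 \<Longrightarrow> norm (proj A x) \<le> norm x"
  using norm_mult_L1_le[of "indicator A" 1 x] bounded_linear_Blinfun_apply[OF bounded_linear_mult_L1[OF bdd_fun_indicator]]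
  by (simp add: proj_def bdd_fun_indicator)

lemma proj_absolutely_continuous:
  assumes "\<epsilon> > 0"
  shows "\<exists>\<eta>>0. \<forall>A\<in>sets leb01. measure leb01 A \<le> \<eta> \<longrightarrow> norm (proj A x) < \<epsilon>"
proof -
  interpret finite_measure leb01 by (rule finite_measure_leb01)
  obtain f where f: "integrable leb01 f" "x = mk f" by (rule L1_cases)
  obtain m F where F: "depends_on {..<m} F" "(LINT t|leb01. \<bar>f t - F (digits t)\<bar>) < \<epsilon> / 2"
    using digits_dense[OF f(1)] assms by (meson half_gt_zero)
  note iF = digits_integral(1)[OF F(1)]
  define R where "R = (\<Sum>D\<in>Pow {..<m}. \<bar>F D\<bar>)"
  have R: "\<bar>F D\<bar> \<le> R" for D
    using member_le_sum[of "D \<inter> {..<m}" "Pow {..<m}" "\<lambda>D. \<bar>F D\<bar>"] depends_onD[OF F(1), of D] by (simp add: R_def)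
  have R0: "R \<ge> 0" using R[of "{}"] by linarith
  show ?thesis
  proof (intro exI[of _ "\<epsilon> / (2 * (R + 1))"] conjI ballI impI)
    show "\<epsilon> / (2 * (R + 1)) > 0" using assms R0 by simp
    fix A assume A: "A \<in> sets leb01" "measure leb01 A \<le> \<epsilon> / (2 * (R + 1))"
    have iA: "integrable leb01 (\<lambda>t. R * indicator A t :: real)"
      using A(1) emeasure_finite by (intro integrable_mult_right integrable_real_indicator) (auto simp: less_top[symmetric])
    have "norm (proj A x) = (LINT t|leb01. \<bar>indicator A t * f t\<bar>)"
      using A f by (simp add: proj_mk norm_mk integrable_indicator_mult)
    also have "\<dots> \<le> (LINT t|leb01. \<bar>f t - F (digits t)\<bar> + R * indicator A t)"
    proof (rule integral_mono)
      fix t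
      show "\<bar>indicator A t * f t\<bar> \<le> \<bar>f t - F (digits t)\<bar> + R * indicator A t"
        using R[of "digits t"] by (auto simp: indicator_def)
    qed (use A f iF iA integrable_indicator_mult in auto)
    also have "\<dots> = (LINT t|leb01. \<bar>f t - F (digits t)\<bar>) + R * measure leb01 A"
      using f iF iA A(1) sets.Int_space_eq2[OF A(1)] by simp
    also have "R * measure leb01 A \<le> (R + 1) * (\<epsilon> / (2 * (R + 1)))"
      using A(2) R0 by (intro mult_mono) auto
    also have "\<dots> = \<epsilon> / 2"
    proof -
      have "q * (\<epsilon> / (2 * q)) = \<epsilon> / 2" if "q \<noteq> 0" for q :: real using that by simp
      then show ?thesis using R0 by (metis add_nonneg_eq_0_iff zero_le_one zero_neq_one)
    qed
    finally show "norm (proj A x) < \<epsilon>" using F(2) by simp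
  qed
qed

text \<open>Absolute continuity turns finite additivity into countable additivity, after which the
  Radon-Nikodym theorem applies.\<close>

lemma density_of_absolutely_continuous:
  fixes p :: "real set \<Rightarrow> real"
  assumes nonneg: "\<And>A. A \<in> sets leb01 \<Longrightarrow> 0 \<le> p A"
    and add: "\<And>A B. A \<in> sets leb01 \<Longrightarrow> B \<in> sets leb01 \<Longrightarrow> A \<inter> B = {} \<Longrightarrow> p (A \<union> B) = p A + p B"
    and ac: "\<And>\<epsilon>. \<epsilon> > 0 \<Longrightarrow> \<exists>\<eta>>0. \<forall>A\<in>sets leb01. measure leb01 A \<le> \<eta> \<longrightarrow> p A \<le> \<epsilon>"
  shows "\<exists>k. integrable leb01 k \<and> (\<forall>A\<in>sets leb01. p A = (LINT x|leb01. indicator A x * k x))"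
proof -
  interpret finite_measure leb01 by (rule finite_measure_leb01)
  have p_empty: "p {} = 0" using add[of "{}" "{}"] by simp
  define N where "N = measure_of (space leb01) (sets leb01) (\<lambda>A. ennreal (p A))"
  have sN: "sets N = sets leb01" unfolding N_def by (subst sets_measure_of[OF sets.space_closed]) (rule sets.sigma_sets_eq)
  have ca: "countably_additive (sets leb01) (\<lambda>A. ennreal (p A))"
  proof (rule sets.empty_continuous_imp_countably_additive)
    show "positive (sets leb01) (\<lambda>A. ennreal (p A))" by (simp add: positive_def p_empty)
    show "Measure_Space.additive (sets leb01) (\<lambda>A. ennreal (p A))"
      unfolding Measure_Space.additive_def using add nonneg by (auto simp: ennreal_plus)
    show "\<forall>A\<in>sets leb01. ennreal (p A) \<noteq> \<infinity>" by simp
    fix A :: "nat \<Rightarrow> real set" assume A: "range A \<subseteq> sets leb01" "decseq A" "(\<Inter>i. A i) = {}"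
    have "(\<lambda>i. measure leb01 (A i)) \<longlonglongrightarrow> measure leb01 (\<Inter>i. A i)"
      using A by (intro finite_Lim_measure_decseq)
    then have m0: "(\<lambda>i. measure leb01 (A i)) \<longlonglongrightarrow> 0" using A(3) by simp
    have "(\<lambda>i. p (A i)) \<longlonglongrightarrow> 0"
    proof (rule LIMSEQ_I)
      fix r :: real assume r: "r > 0"
      then obtain \<eta> where \<eta>: "\<eta> > 0" "\<forall>A\<in>sets leb01. measure leb01 A \<le> \<eta> \<longrightarrow> p A \<le> r / 2"
        using ac[of "r / 2"] by auto
      obtain n0 where "\<forall>n\<ge>n0. measure leb01 (A n) < \<eta>"
        using order_tendstoD(2)[OF m0 \<eta>(1)] by (auto simp: eventually_sequentially)
      then have "\<forall>n\<ge>n0. norm (p (A n) - 0) < r"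
        using \<eta>(2) A(1) nonneg r by (auto simp: less_imp_le subset_iff) (smt (verit) field_sum_of_halves rangeI)
      then show "\<exists>n0. \<forall>n\<ge>n0. norm (p (A n) - 0) < r" by blast
    qed
    then show "(\<lambda>i. ennreal (p (A i))) \<longlonglongrightarrow> 0" using tendsto_ennrealI by fastforce
  qed
  have eN: "emeasure N A = ennreal (p A)" if "A \<in> sets leb01" for A
    unfolding N_def
    by (rule emeasure_measure_of_sigma[OF sets.sigma_algebra_axioms _ ca that]) (simp add: positive_def p_empty)
  have "absolutely_continuous leb01 N"
    unfolding absolutely_continuous_def
  proof
    fix A assume A: "A \<in> null_sets leb01"
    then have A': "A \<in> sets leb01" "measure leb01 A = 0" by (auto simp: measure_def)
    have "p A \<le> 0"
    proof (rule field_le_epsilon)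
      fix e :: real assume "e > 0"
      then obtain \<eta> where "\<eta> > 0" "\<forall>A\<in>sets leb01. measure leb01 A \<le> \<eta> \<longrightarrow> p A \<le> e" using ac by blast
      then show "p A \<le> 0 + e" using A' by simp
    qed
    then show "A \<in> null_sets N" using A' eN sN by (auto simp: null_sets_def ennreal_neg)
  qed
  then obtain f where f: "f \<in> borel_measurable leb01" "density leb01 f = N"
    using Radon_Nikodym[OF _ sN] by blast
  have int_f: "(\<integral>\<^sup>+x. f x * indicator A x \<partial>leb01) = ennreal (p A)" if "A \<in> sets leb01" for A
    using emeasure_density[OF f(1) that] f(2) eN[OF that] by simp
  have "(\<integral>\<^sup>+x. f x \<partial>leb01) = (\<integral>\<^sup>+x. f x * indicator (space leb01) x \<partial>leb01)"
    by (intro nn_integral_cong) (simp add: indicator_def)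
  then have fin: "(\<integral>\<^sup>+x. f x \<partial>leb01) \<noteq> \<infinity>" using int_f[OF sets.top] by simp
  define k where "k x = enn2real (f x)" for x
  have "AE x in leb01. f x \<noteq> \<infinity>" using nn_integral_PInf_AE[OF f(1) fin] .
  then have fk: "AE x in leb01. f x = ennreal (k x)" by eventually_elim (simp add: k_def less_top)
  have km: "k \<in> borel_measurable leb01" using f(1) unfolding k_def by measurable
  have k0: "0 \<le> k x" for x by (simp add: k_def)
  have "(\<integral>\<^sup>+x. ennreal (k x) \<partial>leb01) = (\<integral>\<^sup>+x. f x \<partial>leb01)"
    by (rule nn_integral_cong_AE) (use fk in \<open>auto elim: eventually_mono\<close>)
  then have ik: "integrable leb01 k"
    using fin km k0 by (intro integrableI_nonneg) (auto simp: less_top)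
  have "p A = (LINT x|leb01. indicator A x * k x)" if A: "A \<in> sets leb01" for A
  proof -
    have "(\<integral>\<^sup>+x. ennreal (indicator A x * k x) \<partial>leb01) = (\<integral>\<^sup>+x. f x * indicator A x \<partial>leb01)"
      by (rule nn_integral_cong_AE) (use fk in eventually_elim, auto simp: indicator_def)
    then have "(\<integral>\<^sup>+x. ennreal (indicator A x * k x) \<partial>leb01) = ennreal (p A)" using int_f[OF A] by simp
    moreover have "(\<integral>\<^sup>+x. ennreal (indicator A x * k x) \<partial>leb01) = ennreal (LINT x|leb01. indicator A x * k x)"
      using k0 integrable_indicator_mult[OF A ik] by (intro nn_integral_eq_integral) (auto simp: indicator_def)
    ultimately have "ennreal (p A) = ennreal (LINT x|leb01. indicator A x * k x)" by simp
    then show ?thesis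
      using nonneg[OF A] k0 by (subst (asm) ennreal_inj) (auto intro!: Bochner_Integration.integral_nonneg simp: indicator_def)
  qed
  then show ?thesis using ik by blast
qed

lemma indicator_integrable: "A \<in> sets leb01 \<Longrightarrow> integrable leb01 (indicator A :: real \<Rightarrow> real)"
  using finite_measure.emeasure_finite[OF finite_measure_leb01]
  by (intro integrable_real_indicator) (auto simp: less_top[symmetric])

text \<open>The dual of \<open>L\<^sub>1\<close> is \<open>L\<^sub>\<infinity>\<close>. Adding a multiple of Lebesgue measure to the set function given by \<open>\<phi>\<close>
  makes it nonnegative, so that it has a density.\<close>

lemma functional_representation:
  fixes \<phi> :: "L1 \<Rightarrow>\<^sub>L real"
  shows "\<exists>g. bdd_fun g \<and> \<phi> = pairing g"
proof -
  interpret finite_measure leb01 by (rule finite_measure_leb01)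
  define B where "B = norm \<phi>"
  have B0: "B \<ge> 0" by (simp add: B_def)
  have bnd: "\<bar>\<phi> (mk (indicator A))\<bar> \<le> B * measure leb01 A" if "A \<in> sets leb01" for A
    using norm_blinfun[of \<phi> "mk (indicator A)"] that sets.Int_space_eq2[OF that]
    by (simp add: B_def norm_mk indicator_integrable)
  \<comment> \<open>the second summand makes \<open>p\<close> nonnegative\<close>
  define p where "p A = \<phi> (mk (indicator A)) + B * measure leb01 A" for A
  have "\<exists>k. integrable leb01 k \<and> (\<forall>A\<in>sets leb01. p A = (LINT x|leb01. indicator A x * k x))"
  proof (rule density_of_absolutely_continuous)
    show "0 \<le> p A" if "A \<in> sets leb01" for A using bnd[OF that] by (simp add: p_def abs_le_iff)
    show "p (A1 \<union> A2) = p A1 + p A2" if A: "A1 \<in> sets leb01" "A2 \<in> sets leb01" "A1 \<inter> A2 = {}" for A1 A2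
    proof -
      have "mk (indicator (A1 \<union> A2)) = mk (indicator A1) + mk (indicator A2)"
        using A indicator_integrable by (simp add: mk_add indicator_add)
      then show ?thesis using A by (simp add: p_def blinfun.bilinear_simps finite_measure_Union algebra_simps)
    qed
    fix \<epsilon> :: real assume \<epsilon>: "\<epsilon> > 0"
    show "\<exists>\<eta>>0. \<forall>A\<in>sets leb01. measure leb01 A \<le> \<eta> \<longrightarrow> p A \<le> \<epsilon>"
    proof (intro exI[of _ "\<epsilon> / (2 * B + 1)"] conjI ballI impI)
      show "\<epsilon> / (2 * B + 1) > 0" using \<epsilon> B0 by simp
      fix A assume A: "A \<in> sets leb01" "measure leb01 A \<le> \<epsilon> / (2 * B + 1)"
      have "p A \<le> 2 * B * measure leb01 A" using bnd[OF A(1)] by (simp add: p_def)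
      also have "\<dots> \<le> (2 * B + 1) * (\<epsilon> / (2 * B + 1))" using A(2) B0 by (intro mult_mono) auto
      finally show "p A \<le> \<epsilon>" using B0 by simp
    qed
  qed
  then obtain k where k: "integrable leb01 k" "\<And>A. A \<in> sets leb01 \<Longrightarrow> p A = (LINT x|leb01. indicator A x * k x)" by blast
  define h where "h x = k x - B" for x
  have ih: "integrable leb01 h" unfolding h_def using k(1) by simp
  have \<phi>h: "\<phi> (mk (indicator A)) = (LINT x|leb01. indicator A x * h x)" if A: "A \<in> sets leb01" for A
  proof -
    have "(LINT x|leb01. indicator A x * h x) = (LINT x|leb01. indicator A x * k x - B * indicator A x)"
      by (intro Bochner_Integration.integral_cong) (auto simp: h_def algebra_simps)
    also have "\<dots> = p A - B * measure leb01 A"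
      using k(2)[OF A] integrable_indicator_mult[OF A k(1)] indicator_integrable[OF A] sets.Int_space_eq2[OF A] by simp
    finally show ?thesis by (simp add: p_def)
  qed
  have one_side: "AE x in leb01. s * h x \<le> B" if s: "\<bar>s\<bar> = 1" for s :: real
  proof -
    define A where "A = {x \<in> space leb01. B < s * h x}"
    have A: "A \<in> sets leb01" unfolding A_def using ih by measurable
    have i: "integrable leb01 (\<lambda>x. indicator A x * (s * h x - B))"
      using ih by (intro integrable_indicator_mult A) simp
    have "(LINT x|leb01. indicator A x * (s * h x - B)) = (LINT x|leb01. s * (indicator A x * h x) - B * indicator A x)"
      by (intro Bochner_Integration.integral_cong) (auto simp: algebra_simps)
    also have "\<dots> = s * \<phi> (mk (indicator A)) - B * measure leb01 A"
      using \<phi>h[OF A] integrable_indicator_mult[OF A ih] indicator_integrable[OF A] sets.Int_space_eq2[OF A] by simp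
    also have "\<dots> \<le> 0"
    proof -
      have "s * \<phi> (mk (indicator A)) \<le> \<bar>s * \<phi> (mk (indicator A))\<bar>" by (rule abs_ge_self)
      also have "\<dots> \<le> B * measure leb01 A" using bnd[OF A] s by (simp add: abs_mult)
      finally show ?thesis by simp
    qed
    finally have "(LINT x|leb01. indicator A x * (s * h x - B)) \<le> 0" .
    moreover have nn: "0 \<le> indicator A x * (s * h x - B)" for x by (auto simp: A_def indicator_def)
    moreover have "0 \<le> (LINT x|leb01. indicator A x * (s * h x - B))" by (rule Bochner_Integration.integral_nonneg) (rule nn)
    ultimately have "(LINT x|leb01. indicator A x * (s * h x - B)) = 0" by linarith
    then have "AE x in leb01. indicator A x * (s * h x - B) = 0"
      using integral_nonneg_eq_0_iff_AE[OF i] nn by simp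
    then show ?thesis
      by (rule AE_mp) (intro AE_I2, auto simp: A_def indicator_def not_less split: if_splits)
  qed
  define g where "g x = max (- B) (min B (h x))" for x
  have g_bd: "\<bar>g x\<bar> \<le> B" for x using B0 by (auto simp: g_def)
  have gm: "g \<in> borel_measurable leb01" unfolding g_def using ih by measurable
  have bg: "bdd_fun g" using g_bd gm by (auto simp: bdd_fun_def)
  have gh: "AE x in leb01. g x = h x"
    using one_side[of 1] one_side[of "-1"] by (auto simp: g_def elim!: eventually_elim2)
  have "\<phi> (mk f) = (LINT x|leb01. g x * f x)" if "integrable leb01 f" for f
    using that
  proof (induct rule: integrable_induct)
    case (base A c)
    have "\<phi> (mk (\<lambda>x. indicator A x *\<^sub>R c)) = \<phi> (c *\<^sub>R mk (indicator A))"
      using indicator_integrable[OF base(1)] by (simp add: mk_scaleR mult.commute)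
    also have "\<dots> = c * (LINT x|leb01. indicator A x * h x)" by (simp add: blinfun.bilinear_simps \<phi>h[OF base(1)])
    also have "(LINT x|leb01. indicator A x * h x) = (LINT x|leb01. indicator A x * g x)"
      using gh base(1) gm ih by (intro integral_cong_AE) (auto elim!: eventually_mono)
    also have "c * \<dots> = (LINT x|leb01. c * (indicator A x * g x))" by simp
    finally show ?case by (simp add: ac_simps)
  next
    case (add f1 f2)
    then show ?case
      using integrable_bdd_fun[OF bg add(1)] integrable_bdd_fun[OF bg add(3)]
      by (simp add: mk_add[symmetric] blinfun.bilinear_simps distrib_left)
  next
    case (lim f s)
    have 0: "(\<lambda>i. LINT x|leb01. \<bar>s i x - f x\<bar>) \<longlonglongrightarrow> 0"
      by (rule integral_abs_diff_tendsto_0[OF lim(1,5,3,4)])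
    have nrm: "norm (mk (s i) - mk f) = (LINT x|leb01. \<bar>s i x - f x\<bar>)" for i
      using lim(1,5) by (simp add: mk_diff norm_mk)
    then have conv: "(\<lambda>i. mk (s i)) \<longlonglongrightarrow> mk f"
      using 0 by (subst LIM_zero_iff[symmetric], subst tendsto_norm_zero_iff[symmetric]) simp
    have 1: "(\<lambda>i. \<phi> (mk (s i))) \<longlonglongrightarrow> \<phi> (mk f)"
      by (rule bounded_linear.tendsto[OF blinfun.bounded_linear_right conv])
    have "(\<lambda>i. pairing g (mk (s i))) \<longlonglongrightarrow> pairing g (mk f)"
      by (rule bounded_linear.tendsto[OF blinfun.bounded_linear_right conv])
    then have "(\<lambda>i. \<phi> (mk (s i))) \<longlonglongrightarrow> (LINT x|leb01. g x * f x)"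
      using lim(1,2,5) by (simp add: pairing_mk bg)
    then show ?case using 1 LIMSEQ_unique by blast
  qed
  then have "\<phi> x = pairing g x" for x
    by (rule_tac L1_cases[of x]) (simp add: pairing_mk bg)
  then show ?thesis using bg blinfun_eqI by blast
qed

section \<open>A criterion for Tauberian operators\<close>

text \<open>The part of an element of the bidual that lives on \<open>A\<close>.\<close>

definition restr :: "real set \<Rightarrow> (L1 \<Rightarrow>\<^sub>L real) \<Rightarrow>\<^sub>L real \<Rightarrow> (L1 \<Rightarrow>\<^sub>L real) \<Rightarrow>\<^sub>L real"
  where "restr A \<xi> = banach_adjoint (banach_adjoint (proj A)) \<xi>"

lemma restr_apply: "restr A \<xi> \<phi> = \<xi> (\<phi> o\<^sub>L proj A)"
  by (simp add: restr_def banach_adjoint.rep_eq)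

lemma restr_diff: "restr A (\<xi> - \<zeta>) = restr A \<xi> - restr A \<zeta>"
  by (simp add: restr_def blinfun.bilinear_simps)

lemma restr_tendsto: "(\<xi> \<longlongrightarrow> \<zeta>) F \<Longrightarrow> ((\<lambda>i. restr A (\<xi> i)) \<longlongrightarrow> restr A \<zeta>) F"
  unfolding restr_def by (rule bounded_linear.tendsto[OF blinfun.bounded_linear_right])

lemma restr_restr:
  assumes "A \<in> sets leb01" "B \<in> sets leb01"
  shows "restr A (restr B \<xi>) = restr (A \<inter> B) \<xi>"
proof (rule blinfun_eqI)
  fix \<phi> :: "L1 \<Rightarrow>\<^sub>L real"
  have "(\<phi> o\<^sub>L proj A) o\<^sub>L proj B = \<phi> o\<^sub>L proj (A \<inter> B)"
    by (rule blinfun_eqI) (simp add: proj_proj[OF assms])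
  then show "restr A (restr B \<xi>) \<phi> = restr (A \<inter> B) \<xi> \<phi>" by (simp add: restr_apply)
qed

lemma restr_Un:
  assumes "A \<in> sets leb01" "B \<in> sets leb01" "A \<inter> B = {}"
  shows "restr (A \<union> B) \<xi> = restr A \<xi> + restr B \<xi>"
proof (rule blinfun_eqI)
  fix \<phi> :: "L1 \<Rightarrow>\<^sub>L real"
  have "\<phi> o\<^sub>L proj (A \<union> B) = (\<phi> o\<^sub>L proj A) + (\<phi> o\<^sub>L proj B)"
    by (rule blinfun_eqI) (simp add: proj_Un(1)[OF assms] blinfun.bilinear_simps)
  then show "restr (A \<union> B) \<xi> \<phi> = (restr A \<xi> + restr B \<xi>) \<phi>"
    by (simp add: restr_apply blinfun.bilinear_simps)
qed

lemma norm_restr_le: "A \<in> sets leb01 \<Longrightarrow> norm (restr A \<xi>) \<le> norm \<xi>"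
proof (rule norm_blinfun_bound)
  fix \<phi> :: "L1 \<Rightarrow>\<^sub>L real" assume A: "A \<in> sets leb01"
  have "norm (\<phi> o\<^sub>L proj A) \<le> norm \<phi>"
  proof (rule norm_blinfun_bound)
    fix x
    have "norm ((\<phi> o\<^sub>L proj A) x) \<le> norm \<phi> * norm (proj A x)" using norm_blinfun[of \<phi> "proj A x"] by simp
    also have "\<dots> \<le> norm \<phi> * norm x" by (intro mult_left_mono norm_proj_le A) simp
    finally show "norm ((\<phi> o\<^sub>L proj A) x) \<le> norm \<phi> * norm x" .
  qed simp
  then have "norm \<xi> * norm (\<phi> o\<^sub>L proj A) \<le> norm \<xi> * norm \<phi>" by (rule mult_left_mono) simp
  then show "norm (restr A \<xi> \<phi>) \<le> norm \<xi> * norm \<phi>"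
    using norm_blinfun[of \<xi> "\<phi> o\<^sub>L proj A"] unfolding restr_apply by (rule order_trans[rotated])
qed simp

text \<open>The bidual of \<open>L\<^sub>1\<close> is again an \<open>L\<^sub>1\<close>-like space: functionals of norm at most one that are supported on
  \<open>A\<close> and on \<open>B\<close> can be glued to one of norm at most one. Products with the norms replace a
  normalisation of the two functionals.\<close>

lemma norm_restr_Un:
  assumes A: "A \<in> sets leb01" "B \<in> sets leb01" "A \<inter> B = {}"
  shows "norm (restr (A \<union> B) \<xi>) = norm (restr A \<xi>) + norm (restr B \<xi>)"
proof (rule antisym)
  show "norm (restr (A \<union> B) \<xi>) \<le> norm (restr A \<xi>) + norm (restr B \<xi>)"
    unfolding restr_Un[OF A] by (rule norm_triangle_ineq)
  define M where "M = norm (restr (A \<union> B) \<xi>)"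
  have M0: "M \<ge> 0" by (simp add: M_def)
  have key: "b * restr A \<xi> \<phi> + a * restr B \<xi> \<psi> \<le> M * (a * b)"
    if ab: "norm \<phi> \<le> a" "norm \<psi> \<le> b" for a b \<phi> \<psi>
  proof -
    have ab0: "0 \<le> a" "0 \<le> b" using ab norm_ge_zero order_trans by blast+
    define \<kappa> where "\<kappa> = b *\<^sub>R (\<phi> o\<^sub>L proj A) + a *\<^sub>R (\<psi> o\<^sub>L proj B)"
    have AB: "A \<inter> (A \<union> B) = A" "B \<inter> (A \<union> B) = B" by auto
    have "\<kappa> o\<^sub>L proj (A \<union> B) = \<kappa>"
      by (rule blinfun_eqI) (simp add: \<kappa>_def blinfun.bilinear_simps proj_proj A sets.Un AB)
    then have "restr (A \<union> B) \<xi> \<kappa> = \<xi> \<kappa>" by (simp add: restr_apply)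
    also have "\<dots> = b * restr A \<xi> \<phi> + a * restr B \<xi> \<psi>"
      by (simp add: \<kappa>_def blinfun.bilinear_simps restr_apply)
    finally have "b * restr A \<xi> \<phi> + a * restr B \<xi> \<psi> \<le> M * norm \<kappa>"
      using norm_blinfun[of "restr (A \<union> B) \<xi>" \<kappa>] by (simp add: M_def abs_le_iff)
    also have "M * norm \<kappa> \<le> M * (a * b)"
    proof (rule mult_left_mono[OF _ M0], rule norm_blinfun_bound)
      fix x
      have "norm (\<kappa> x) \<le> b * norm (\<phi> (proj A x)) + a * norm (\<psi> (proj B x))"
        unfolding \<kappa>_def using ab0
        by (simp add: blinfun.bilinear_simps) (metis abs_mult abs_of_nonneg abs_triangle_ineq)
      also have "\<dots> \<le> b * (a * norm (proj A x)) + a * (b * norm (proj B x))"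
      proof (intro add_mono mult_left_mono ab0)
        show "norm (\<phi> (proj A x)) \<le> a * norm (proj A x)"
          using norm_blinfun[of \<phi> "proj A x"] mult_right_mono[OF ab(1), of "norm (proj A x)"] by simp
        show "norm (\<psi> (proj B x)) \<le> b * norm (proj B x)"
          using norm_blinfun[of \<psi> "proj B x"] mult_right_mono[OF ab(2), of "norm (proj B x)"] by simp
      qed
      also have "\<dots> = a * b * (norm (proj A x) + norm (proj B x))" by (simp add: algebra_simps)
      also have "\<dots> \<le> a * b * norm x"
        unfolding proj_Un(2)[OF A] using ab0 A by (intro mult_left_mono norm_proj_le) auto
      finally show "norm (\<kappa> x) \<le> a * b * norm x" .
    qed (use ab0 in simp)
    finally show ?thesis .
  qed
  have B_le: "norm (restr B \<xi>) \<le> M"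
  proof (rule norm_blinfun_bound[OF M0])
    fix \<psi>
    show "norm (restr B \<xi> \<psi>) \<le> M * norm \<psi>"
      using key[of 0 1 \<psi> "norm \<psi>"] key[of 0 1 "- \<psi>" "norm \<psi>"] by (simp add: blinfun.bilinear_simps abs_le_iff)
  qed
  have A_le: "restr A \<xi> \<phi> \<le> (M - norm (restr B \<xi>)) * norm \<phi>" for \<phi>
  proof -
    have le0: "restr A \<xi> \<phi> \<le> M * norm \<phi>" using key[of \<phi> "norm \<phi>" 0 1] by simp
    have "norm (norm \<phi> *\<^sub>R restr B \<xi>) \<le> M * norm \<phi> - restr A \<xi> \<phi>"
    proof (rule norm_blinfun_bound)
      fix \<psi>
      show "norm ((norm \<phi> *\<^sub>R restr B \<xi>) \<psi>) \<le> (M * norm \<phi> - restr A \<xi> \<phi>) * norm \<psi>"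
        using key[of \<phi> "norm \<phi>" \<psi> "norm \<psi>"] key[of \<phi> "norm \<phi>" "- \<psi>" "norm \<psi>"]
        by (simp add: blinfun.bilinear_simps abs_le_iff abs_mult algebra_simps)
    qed (use le0 in simp)
    then show ?thesis by (simp add: algebra_simps)
  qed
  have "norm (restr A \<xi>) \<le> M - norm (restr B \<xi>)"
  proof (rule norm_blinfun_bound)
    show "norm (restr A \<xi> \<phi>) \<le> (M - norm (restr B \<xi>)) * norm \<phi>" for \<phi>
      using A_le[of \<phi>] A_le[of "- \<phi>"] by (simp add: blinfun.bilinear_simps abs_le_iff)
  qed (use B_le in simp)
  then show "norm (restr A \<xi>) + norm (restr B \<xi>) \<le> norm (restr (A \<union> B) \<xi>)" by (simp add: M_def)
qed

lemma norm_restr_mono: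
  assumes "A \<in> sets leb01" "B \<in> sets leb01" "A \<subseteq> B"
  shows "norm (restr A \<xi>) \<le> norm (restr B \<xi>)"
  using norm_restr_Un[of A "B - A" \<xi>] assms by (simp add: sets.Diff Un_absorb1)

text \<open>The set function given by \<open>\<xi>\<close> may have both signs, but the norm of the restriction of \<open>\<xi>\<close> is
  nonnegative, additive and dominates it, so it is a difference of two set functions with densities.
  Agreement on indicator functions extends to all functionals by uniform approximation.\<close>

lemma absolutely_continuous_in_L1:
  fixes \<xi> :: "(L1 \<Rightarrow>\<^sub>L real) \<Rightarrow>\<^sub>L real"
  assumes ac: "\<And>\<epsilon>. \<epsilon> > 0 \<Longrightarrow> \<exists>\<eta>>0. \<forall>A\<in>sets leb01. measure leb01 A \<le> \<eta> \<longrightarrow> norm (restr A \<xi>) \<le> \<epsilon>"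
  shows "\<xi> \<in> range bidual_embedding"
proof -
  define \<kappa> where "\<kappa> A = pairing (indicator A)" for A
  define p where "p A = norm (restr A \<xi>)" for A
  define q where "q A = \<xi> (\<kappa> A) + p A" for A
  have \<kappa>_abs: "\<bar>\<xi> (\<kappa> A)\<bar> \<le> p A" if A: "A \<in> sets leb01" for A
  proof -
    have "\<kappa> A o\<^sub>L proj A = \<kappa> A"
    proof (rule blinfun_eqI)
      fix x
      obtain f where f: "integrable leb01 f" "x = mk f" by (rule L1_cases)
      show "(\<kappa> A o\<^sub>L proj A) x = \<kappa> A x"
        using A f by (simp add: \<kappa>_def proj_mk pairing_mk bdd_fun_indicator integrable_indicator_mult
            mult.assoc[symmetric] indicator_inter_arith[symmetric])
    qed
    then have "\<bar>\<xi> (\<kappa> A)\<bar> = \<bar>restr A \<xi> (\<kappa> A)\<bar>" by (simp add: restr_apply)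
    also have "\<dots> \<le> p A * norm (\<kappa> A)" using norm_blinfun[of "restr A \<xi>" "\<kappa> A"] by (simp add: p_def)
    also have "\<dots> \<le> p A * 1"
      unfolding \<kappa>_def by (intro mult_left_mono norm_pairing_le bdd_fun_indicator A) (auto simp: p_def indicator_def)
    finally show ?thesis by simp
  qed
  have p_add: "p (A \<union> B) = p A + p B" if "A \<in> sets leb01" "B \<in> sets leb01" "A \<inter> B = {}" for A B
    unfolding p_def by (rule norm_restr_Un[OF that])
  have \<kappa>_add: "\<kappa> (A \<union> B) = \<kappa> A + \<kappa> B" if A: "A \<in> sets leb01" "B \<in> sets leb01" "A \<inter> B = {}" for A B
  proof (rule blinfun_eqI)
    fix x
    obtain f where f: "integrable leb01 f" "x = mk f" by (rule L1_cases)
    have "(LINT t|leb01. indicator (A \<union> B) t * f t) = (LINT t|leb01. indicator A t * f t + indicator B t * f t)"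
      using A(3) by (intro Bochner_Integration.integral_cong) (auto simp: indicator_def)
    then show "\<kappa> (A \<union> B) x = (\<kappa> A + \<kappa> B) x"
      using A f by (simp add: \<kappa>_def pairing_mk bdd_fun_indicator sets.Un blinfun.bilinear_simps integrable_indicator_mult)
  qed
  have "\<exists>k. integrable leb01 k \<and> (\<forall>A\<in>sets leb01. p A = (LINT x|leb01. indicator A x * k x))"
    by (rule density_of_absolutely_continuous) (use p_add ac in \<open>auto simp: p_def\<close>)
  then obtain k where k: "integrable leb01 k" "\<And>A. A \<in> sets leb01 \<Longrightarrow> p A = (LINT x|leb01. indicator A x * k x)" by blast
  have "\<exists>k. integrable leb01 k \<and> (\<forall>A\<in>sets leb01. q A = (LINT x|leb01. indicator A x * k x))"
  proof (rule density_of_absolutely_continuous)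
    show "0 \<le> q A" if "A \<in> sets leb01" for A using \<kappa>_abs[OF that] by (simp add: q_def abs_le_iff)
    show "q (A \<union> B) = q A + q B" if "A \<in> sets leb01" "B \<in> sets leb01" "A \<inter> B = {}" for A B
      using p_add[OF that] \<kappa>_add[OF that] by (simp add: q_def blinfun.bilinear_simps)
    fix \<epsilon> :: real assume "\<epsilon> > 0"
    then obtain \<eta> where \<eta>: "\<eta> > 0" "\<forall>A\<in>sets leb01. measure leb01 A \<le> \<eta> \<longrightarrow> p A \<le> \<epsilon> / 2"
      using ac[of "\<epsilon> / 2"] by (auto simp: p_def)
    have "q A \<le> 2 * p A" if "A \<in> sets leb01" for A using \<kappa>_abs[OF that] by (simp add: q_def)
    then show "\<exists>\<eta>>0. \<forall>A\<in>sets leb01. measure leb01 A \<le> \<eta> \<longrightarrow> q A \<le> \<epsilon>"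
      using \<eta> by (intro exI[of _ \<eta>]) fastforce
  qed
  then obtain l where l: "integrable leb01 l" "\<And>A. A \<in> sets leb01 \<Longrightarrow> q A = (LINT x|leb01. indicator A x * l x)" by blast
  define f where "f x = l x - k x" for x
  have f: "integrable leb01 f" unfolding f_def using k l by simp
  have \<xi>\<kappa>: "\<xi> (\<kappa> A) = \<kappa> A (mk f)" if A: "A \<in> sets leb01" for A
  proof -
    have "\<kappa> A (mk f) = (LINT x|leb01. indicator A x * l x - indicator A x * k x)"
      using f A by (simp add: \<kappa>_def pairing_mk bdd_fun_indicator f_def algebra_simps)
    also have "\<dots> = q A - p A"
      using k l integrable_indicator_mult[OF A k(1)] integrable_indicator_mult[OF A l(1)] A by simp
    finally show ?thesis by (simp add: q_def)
  qed
  have "\<xi> \<phi> = \<phi> (mk f)" for \<phi>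
  proof -
    obtain g where g: "bdd_fun g" "\<phi> = pairing g" using functional_representation by blast
    obtain B where B: "\<And>x. \<bar>g x\<bar> \<le> B" using g(1) by (auto simp: bdd_fun_def)
    have gm: "g \<in> borel_measurable leb01" using g(1) by (simp add: bdd_fun_def)
    have "\<bar>\<xi> \<phi> - \<phi> (mk f)\<bar> \<le> \<epsilon> * (norm \<xi> + norm (mk f))" if \<epsilon>: "\<epsilon> > 0" for \<epsilon>
    proof -
      define N where "N = \<lceil>B / \<epsilon>\<rceil> + 1"
      define A where "A i = {x \<in> space leb01. \<lfloor>g x / \<epsilon>\<rfloor> = i}" for i
      have A: "A i \<in> sets leb01" for i unfolding A_def using gm by measurable
      define \<psi> where "\<psi> = (\<Sum>i\<in>{-N..N}. (of_int i * \<epsilon>) *\<^sub>R \<kappa> (A i))"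
      have \<psi>_eq: "\<xi> \<psi> = \<psi> (mk f)"
        unfolding \<psi>_def by (simp add: blinfun.bilinear_simps \<xi>\<kappa>[OF A])
      have step: "(\<Sum>i\<in>{-N..N}. of_int i * \<epsilon> * indicator (A i) x) = of_int \<lfloor>g x / \<epsilon>\<rfloor> * \<epsilon>" if x: "x \<in> space leb01" for x
      proof -
        have "g x / \<epsilon> \<le> B / \<epsilon>" "- (B / \<epsilon>) \<le> g x / \<epsilon>"
          using divide_right_mono[of "g x" B \<epsilon>] divide_right_mono[of "- B" "g x" \<epsilon>] B[of x] \<epsilon> by (simp_all add: abs_le_iff)
        then have "\<lfloor>g x / \<epsilon>\<rfloor> \<in> {-N..N}" unfolding N_def atLeastAtMost_iff by linarith
        moreover have "(\<Sum>i\<in>{-N..N}. of_int i * \<epsilon> * indicator (A i) x)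
            = (\<Sum>i\<in>{-N..N}. if i = \<lfloor>g x / \<epsilon>\<rfloor> then of_int i * \<epsilon> else 0)"
          using x by (intro sum.cong) (auto simp: A_def indicator_def)
        ultimately show ?thesis by simp
      qed
      have "norm (\<phi> - \<psi>) \<le> \<epsilon>"
      proof (rule norm_blinfun_bound)
        fix x
        obtain h where h: "integrable leb01 h" "x = mk h" by (rule L1_cases)
        have ih: "integrable leb01 (\<lambda>t. g t * h t)" by (rule integrable_bdd_fun[OF g(1) h(1)])
        have iA: "integrable leb01 (\<lambda>t. of_int i * \<epsilon> * (indicator (A i) t * h t))" for i
          using integrable_indicator_mult[OF A h(1)] by simp
        have "\<psi> x = (\<Sum>i\<in>{-N..N}. LINT t|leb01. of_int i * \<epsilon> * (indicator (A i) t * h t))"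
          using h A by (simp add: \<psi>_def \<kappa>_def blinfun.bilinear_simps pairing_mk bdd_fun_indicator)
        also have "\<dots> = (LINT t|leb01. (\<Sum>i\<in>{-N..N}. of_int i * \<epsilon> * (indicator (A i) t * h t)))"
          by (rule Bochner_Integration.integral_sum[symmetric]) (rule iA)
        also have "\<dots> = (LINT t|leb01. of_int \<lfloor>g t / \<epsilon>\<rfloor> * \<epsilon> * h t)"
          by (rule Bochner_Integration.integral_cong) (simp_all only: step[symmetric] sum_distrib_right mult.assoc)
        finally have \<psi>x: "\<psi> x = (LINT t|leb01. of_int \<lfloor>g t / \<epsilon>\<rfloor> * \<epsilon> * h t)" .
        have iS: "integrable leb01 (\<lambda>t. of_int \<lfloor>g t / \<epsilon>\<rfloor> * \<epsilon> * h t)"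
        proof (subst Bochner_Integration.integrable_cong[OF refl])
          show "of_int \<lfloor>g t / \<epsilon>\<rfloor> * \<epsilon> * h t = (\<Sum>i\<in>{-N..N}. of_int i * \<epsilon> * (indicator (A i) t * h t))"
            if "t \<in> space leb01" for t
            unfolding step[OF that, symmetric] sum_distrib_right by (simp add: mult.assoc)
        qed (rule Bochner_Integration.integrable_sum, rule iA)
        have "(\<phi> - \<psi>) x = (LINT t|leb01. g t * h t - of_int \<lfloor>g t / \<epsilon>\<rfloor> * \<epsilon> * h t)"
          using ih iS h g by (simp add: blinfun.bilinear_simps pairing_mk \<psi>x[unfolded h(2)])
        then have "norm ((\<phi> - \<psi>) x) \<le> (LINT t|leb01. \<bar>g t * h t - of_int \<lfloor>g t / \<epsilon>\<rfloor> * \<epsilon> * h t\<bar>)"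
          using integral_abs_bound by simp
        also have "\<dots> \<le> (LINT t|leb01. \<epsilon> * \<bar>h t\<bar>)"
        proof (rule integral_mono)
          fix t
          define r where "r = (of_int \<lfloor>g t / \<epsilon>\<rfloor> :: real)"
          have "r \<le> g t / \<epsilon>" "g t / \<epsilon> \<le> r + 1" unfolding r_def by linarith+
          then have "r * \<epsilon> \<le> g t" "g t \<le> (r + 1) * \<epsilon>"
            using \<epsilon> by (simp_all only: pos_le_divide_eq pos_divide_le_eq)
          then have "of_int \<lfloor>g t / \<epsilon>\<rfloor> * \<epsilon> \<le> g t" "g t \<le> of_int \<lfloor>g t / \<epsilon>\<rfloor> * \<epsilon> + \<epsilon>"
            by (simp_all add: r_def distrib_right)
          then have "\<bar>g t - of_int \<lfloor>g t / \<epsilon>\<rfloor> * \<epsilon>\<bar> \<le> \<epsilon>" by linarith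
          then have "\<bar>g t - of_int \<lfloor>g t / \<epsilon>\<rfloor> * \<epsilon>\<bar> * \<bar>h t\<bar> \<le> \<epsilon> * \<bar>h t\<bar>" by (rule mult_right_mono) simp
          then show "\<bar>g t * h t - of_int \<lfloor>g t / \<epsilon>\<rfloor> * \<epsilon> * h t\<bar> \<le> \<epsilon> * \<bar>h t\<bar>"
            by (simp add: abs_mult[symmetric] left_diff_distrib)
        qed (use ih iS h in auto)
        also have "\<dots> = \<epsilon> * norm x" using h by (simp add: norm_mk)
        finally show "norm ((\<phi> - \<psi>) x) \<le> \<epsilon> * norm x" .
      qed (use \<epsilon> in simp)
      moreover have "\<xi> \<phi> - \<phi> (mk f) = \<xi> (\<phi> - \<psi>) - (\<phi> - \<psi>) (mk f)"
        using \<psi>_eq by (simp add: blinfun.bilinear_simps)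
      moreover have "\<bar>\<xi> (\<phi> - \<psi>)\<bar> \<le> norm \<xi> * norm (\<phi> - \<psi>)" "\<bar>(\<phi> - \<psi>) (mk f)\<bar> \<le> norm (\<phi> - \<psi>) * norm (mk f)"
        using norm_blinfun[of \<xi> "\<phi> - \<psi>"] norm_blinfun[of "\<phi> - \<psi>" "mk f"] by simp_all
      ultimately have "\<bar>\<xi> \<phi> - \<phi> (mk f)\<bar> \<le> norm (\<phi> - \<psi>) * (norm \<xi> + norm (mk f))"
        by (simp add: algebra_simps)
      also have "\<dots> \<le> \<epsilon> * (norm \<xi> + norm (mk f))" using \<open>norm (\<phi> - \<psi>) \<le> \<epsilon>\<close> by (intro mult_right_mono) auto
      finally show ?thesis .
    qed
    note small = this
    have "\<bar>\<xi> \<phi> - \<phi> (mk f)\<bar> \<le> 0"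
    proof (rule field_le_epsilon)
      fix e :: real assume e: "e > 0"
      define C where "C = norm \<xi> + norm (mk f) + 1"
      have C: "C > 0" by (simp add: C_def add_nonneg_pos)
      have "\<bar>\<xi> \<phi> - \<phi> (mk f)\<bar> \<le> (e / C) * (norm \<xi> + norm (mk f))" using e C by (intro small) simp
      also have "\<dots> \<le> (e / C) * C" using e C by (intro mult_left_mono) (auto simp: C_def)
      finally show "\<bar>\<xi> \<phi> - \<phi> (mk f)\<bar> \<le> 0 + e" using C by simp
    qed
    then show ?thesis by simp
  qed
  then have "\<xi> = bidual_embedding (mk f)" by (intro blinfun_eqI) simp
  then show ?thesis by blast
qed

text \<open>A Yosida-Hewitt decomposition. The sets \<open>B n\<close> of measure tending to zero collect asymptotically as much
  of the mass of \<open>\<xi>\<close> as small sets can. The restrictions of \<open>\<xi>\<close> to \<open>B n\<close> converge to some \<open>\<nu>\<close>, and \<open>\<xi> - \<nu>\<close>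
  is absolutely continuous, hence given by a function. Thus the second adjoint of \<open>T\<close> takes \<open>\<nu>\<close>, which
  lives on every \<open>B n\<close>, to some vector \<open>y'\<close> of the target. Now \<open>T\<close> is an isomorphism on functions supported
  in \<open>B n\<close>. By the Hahn-Banach theorem \<open>y'\<close> is the image of a function supported in \<open>B n\<close> for each large
  \<open>n\<close>; all these functions coincide, so they are zero. By the same theorem every functional agrees on such
  functions with one of the form \<open>\<psi> o\<^sub>L T\<close>, where \<open>\<nu>\<close> vanishes.\<close>

lemma tauberian_criterion:
  fixes T :: "L1 \<Rightarrow>\<^sub>L 'b::banach"
  assumes c: "c > 0" and \<delta>: "\<delta> > 0"
    and lower: "\<And>A x. A \<in> sets leb01 \<Longrightarrow> measure leb01 A \<le> \<delta> \<Longrightarrow> c * norm (proj A x) \<le> norm (T (proj A x))"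
  shows "tauberian T"
  unfolding tauberian_iff
proof (intro allI impI)
  interpret finite_measure leb01 by (rule finite_measure_leb01)
  fix \<xi> :: "(L1 \<Rightarrow>\<^sub>L real) \<Rightarrow>\<^sub>L real"
  assume "banach_adjoint (banach_adjoint T) \<xi> \<in> range bidual_embedding"
  then obtain y where y: "banach_adjoint (banach_adjoint T) \<xi> = bidual_embedding y" by blast
  define p where "p A = norm (restr A \<xi>)" for A
  define C where "C k = {A \<in> sets leb01. measure leb01 A \<le> (1/2) ^ k}" for k :: nat
  \<comment> \<open>the largest mass of \<open>\<xi>\<close> on sets of measure at most \<open>(1/2) ^ k\<close>\<close>
  define s where "s k = Sup (p ` C k)" for k
  have p0: "0 \<le> p A" for A by (simp add: p_def)
  have p_le: "p A \<le> norm \<xi>" if "A \<in> sets leb01" for A unfolding p_def by (rule norm_restr_le[OF that])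
  have bdd: "bdd_above (p ` C k)" for k by (rule bdd_aboveI[of _ "norm \<xi>"]) (auto simp: C_def p_le)
  have C_ne: "{} \<in> C k" for k by (simp add: C_def)
  have s_upper: "p A \<le> s k" if "A \<in> C k" for A k unfolding s_def by (rule cSup_upper[OF imageI[OF that] bdd])
  have s0: "0 \<le> s k" for k using s_upper[OF C_ne] p0 order_trans by blast
  have C_mono: "C (Suc k) \<subseteq> C k" for k
  proof -
    have "(1/2::real) ^ Suc k \<le> (1/2) ^ k" by simp
    then show ?thesis unfolding C_def by (auto simp del: power_Suc intro: order_trans)
  qed
  have "decseq s"
  proof (rule decseq_SucI)
    have "p ` C (Suc k) \<noteq> {}" for k using C_ne by blast
    then show "s (Suc k) \<le> s k" for k
      unfolding s_def by (intro cSup_subset_mono bdd image_mono C_mono)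
  qed
  then obtain s' where s_lim: "s \<longlonglongrightarrow> s'" using s0 decseq_convergent by blast
  have "\<exists>A. A \<in> C k \<and> s k - (1/2) ^ k < p A" for k
  proof -
    have "s k - (1/2) ^ k < Sup (p ` C k)" by (simp add: s_def)
    then obtain v where "v \<in> p ` C k" "s k - (1/2) ^ k < v" using C_ne by (metis less_cSupE empty_iff imageI)
    then show ?thesis by blast
  qed
  then obtain A where A: "\<And>k. A k \<in> C k" "\<And>k. s k - (1/2) ^ k < p (A k)" by metis
  have A_meas: "A k \<in> sets leb01" for k using A(1) by (simp add: C_def)
  define B where "B n = (\<Union>i. A (n + i))" for n
  have B: "B n \<in> sets leb01" for n unfolding B_def using A_meas by blast
  have B_anti: "B m \<subseteq> B n" if "n \<le> m" for n m
  proof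
    fix x assume "x \<in> B m"
    then obtain i where "x \<in> A (m + i)" by (auto simp: B_def)
    then have "x \<in> A (n + (m - n + i))" using that by simp
    then show "x \<in> B n" unfolding B_def by blast
  qed
  have mB: "measure leb01 (B n) \<le> 2 * (1/2) ^ n" for n
  proof -
    have sm: "(\<lambda>i. (1/2::real) ^ (n + i)) sums (2 * (1/2) ^ n)"
      using sums_mult[OF geometric_sums[of "1/2::real"], of "(1/2) ^ n"] by (simp add: power_add mult.commute)
    have le: "measure leb01 (A (n + i)) \<le> (1/2) ^ (n + i)" for i using A(1)[of "n + i"] by (simp add: C_def)
    have sA: "summable (\<lambda>i. measure leb01 (A (n + i)))"
      by (rule summable_comparison_test'[OF sums_summable[OF sm]]) (use le in simp)
    have "measure leb01 (B n) \<le> (\<Sum>i. measure leb01 (A (n + i)))"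
      unfolding B_def using A_meas by (intro finite_measure_subadditive_countably sA) auto
    also have "\<dots> \<le> (\<Sum>i. (1/2) ^ (n + i))" by (rule suminf_le[OF le sA sums_summable[OF sm]])
    also have "\<dots> = 2 * (1/2) ^ n" using sums_unique[OF sm] by simp
    finally show ?thesis .
  qed
  have B_in_C: "B (Suc n) \<in> C n" for n using mB[of "Suc n"] B by (simp add: C_def)
  have mB_lim: "(\<lambda>n. measure leb01 (B n)) \<longlonglongrightarrow> 0"
  proof (rule tendsto_sandwich[of "\<lambda>_. 0"])
    show "(\<lambda>n. 2 * (1/2::real) ^ n) \<longlonglongrightarrow> 0" using LIMSEQ_power_zero[of "1/2::real"] tendsto_mult_right_zero by fastforce
  qed (use mB in auto)
  have pB_lim: "(\<lambda>n. p (B n)) \<longlonglongrightarrow> s'"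
  proof (rule LIMSEQ_imp_Suc, rule tendsto_sandwich)
    show "\<forall>\<^sub>F n in sequentially. s (Suc n) - (1/2) ^ Suc n \<le> p (B (Suc n))"
    proof (intro always_eventually allI)
      fix n
      have "A (Suc n) \<subseteq> B (Suc n)" unfolding B_def by (metis UNIV_I UN_upper add_0_right)
      then have "p (A (Suc n)) \<le> p (B (Suc n))" unfolding p_def by (intro norm_restr_mono A_meas B)
      then show "s (Suc n) - (1/2) ^ Suc n \<le> p (B (Suc n))" using A(2)[of "Suc n"] by linarith
    qed
    show "\<forall>\<^sub>F n in sequentially. p (B (Suc n)) \<le> s n" using s_upper[OF B_in_C] by simp
    have "(\<lambda>n. s (Suc n) - (1/2) ^ Suc n) \<longlonglongrightarrow> s' - 0"
      by (intro tendsto_diff LIMSEQ_Suc[OF s_lim] LIMSEQ_Suc[OF LIMSEQ_power_zero]) simp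
    then show "(\<lambda>n. s (Suc n) - (1/2) ^ Suc n) \<longlonglongrightarrow> s'" by simp
  qed (rule s_lim)
  define \<nu>s where "\<nu>s n = restr (B n) \<xi>" for n
  have \<nu>s_diff: "norm (\<nu>s n - \<nu>s m) = p (B n) - p (B m)" if nm: "n \<le> m" for n m
  proof -
    have un: "B m \<union> (B n - B m) = B n" using B_anti[OF nm] by blast
    have disj: "B m \<inter> (B n - B m) = {}" by blast
    have d: "B n - B m \<in> sets leb01" using B by blast
    show ?thesis
      using restr_Un[OF B d disj, of \<xi>, unfolded un] norm_restr_Un[OF B d disj, of \<xi>, unfolded un]
      by (simp add: p_def \<nu>s_def)
  qed
  have "Cauchy \<nu>s"
  proof (rule metric_CauchyI)
    fix e :: real assume e: "e > 0"
    obtain N where N: "\<And>m n. m \<ge> N \<Longrightarrow> n \<ge> N \<Longrightarrow> dist (p (B m)) (p (B n)) < e"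
      using metric_CauchyD[OF LIMSEQ_imp_Cauchy[OF pB_lim] e] by blast
    have "dist (\<nu>s m) (\<nu>s n) < e" if "m \<ge> N" "n \<ge> N" for m n
    proof (cases "m \<le> n")
      case True
      then show ?thesis using N[OF that] \<nu>s_diff[OF True] by (simp add: dist_norm)
    next
      case False
      then have "n \<le> m" by simp
      then show ?thesis using N[OF that(2,1)] \<nu>s_diff[of n m] by (simp add: dist_norm norm_minus_commute)
    qed
    then show "\<exists>N. \<forall>m\<ge>N. \<forall>n\<ge>N. dist (\<nu>s m) (\<nu>s n) < e" by blast
  qed
  then obtain \<nu> where \<nu>: "\<nu>s \<longlonglongrightarrow> \<nu>" using Cauchy_convergent convergent_def by blast
  have "\<xi> - \<nu> \<in> range bidual_embedding"
  proof (rule absolutely_continuous_in_L1)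
    fix \<epsilon> :: real assume \<epsilon>: "\<epsilon> > 0"
    have 1: "(\<lambda>n. s n - p (B (Suc (Suc n)))) \<longlonglongrightarrow> s' - s'"
      by (intro tendsto_diff s_lim LIMSEQ_Suc[OF LIMSEQ_Suc[OF pB_lim]])
    have 2: "(\<lambda>n. norm (\<nu>s (Suc (Suc n)) - \<nu>)) \<longlonglongrightarrow> 0"
      using LIMSEQ_Suc[OF LIMSEQ_Suc[OF \<nu>]] by (simp add: tendsto_norm_zero LIM_zero)
    have "\<forall>\<^sub>F n in sequentially. s n - p (B (Suc (Suc n))) < \<epsilon> / 2 \<and> norm (\<nu>s (Suc (Suc n)) - \<nu>) < \<epsilon> / 2"
      using 1 2 \<epsilon> by (intro eventually_conj order_tendstoD(2)) auto
    from eventually_happens'[OF sequentially_bot this] obtain n where n: "s n - p (B (Suc (Suc n))) < \<epsilon> / 2" "norm (\<nu>s (Suc (Suc n)) - \<nu>) < \<epsilon> / 2"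
      by blast
    define D where "D = B (Suc (Suc n))"
    have D: "D \<in> sets leb01" using B by (simp add: D_def)
    show "\<exists>\<eta>>0. \<forall>A\<in>sets leb01. measure leb01 A \<le> \<eta> \<longrightarrow> norm (restr A (\<xi> - \<nu>)) \<le> \<epsilon>"
    proof (intro exI[of _ "(1/2) ^ Suc n"] conjI ballI impI)
      fix E assume E: "E \<in> sets leb01" "measure leb01 E \<le> (1/2) ^ Suc n"
      have "measure leb01 (E \<union> D) \<le> measure leb01 E + measure leb01 D" using E D by (intro measure_Un_le) auto
      also have "\<dots> \<le> (1/2) ^ n" using E(2) mB[of "Suc (Suc n)"] by (simp add: D_def)
      finally have ED: "E \<union> D \<in> C n" using E D by (simp add: C_def)
      have "D \<union> (E - D) = E \<union> D" by blast
      then have pED: "p (E - D) = p (E \<union> D) - p D"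
        using norm_restr_Un[of D "E - D" \<xi>] E D by (simp add: p_def sets.Diff)
      have "(E - D) \<union> (E \<inter> D) = E" "(E - D) \<inter> (E \<inter> D) = {}" by blast+
      then have "restr E \<xi> = restr (E - D) \<xi> + restr (E \<inter> D) \<xi>"
        using restr_Un[of "E - D" "E \<inter> D" \<xi>] E D by (simp add: sets.Diff sets.Int)
      then have "restr E (\<xi> - \<nu>) = restr (E - D) \<xi> + restr E (\<nu>s (Suc (Suc n)) - \<nu>)"
        using restr_restr[OF E(1) D, of \<xi>] by (simp add: restr_diff \<nu>s_def D_def)
      then have "norm (restr E (\<xi> - \<nu>)) \<le> p (E - D) + norm (restr E (\<nu>s (Suc (Suc n)) - \<nu>))"
        unfolding p_def by (simp only: norm_triangle_ineq)
      also have "\<dots> \<le> (s n - p D) + norm (\<nu>s (Suc (Suc n)) - \<nu>)"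
        unfolding pED using s_upper[OF ED] norm_restr_le[OF E(1)] by (intro add_mono diff_right_mono) auto
      also have "\<dots> \<le> \<epsilon>" using n by (simp add: D_def)
      finally show "norm (restr E (\<xi> - \<nu>)) \<le> \<epsilon>" .
    qed simp
  qed
  then obtain z where z: "\<xi> - \<nu> = bidual_embedding z" by blast
  have T_emb: "banach_adjoint (banach_adjoint T) (bidual_embedding x) = bidual_embedding (T x)" for x
    by (rule blinfun_eqI) simp
  define y' where "y' = y - T z"
  have \<nu>_eq: "\<nu> = \<xi> - bidual_embedding z" using z by (simp add: algebra_simps)
  have T\<nu>: "\<nu> (\<psi> o\<^sub>L T) = \<psi> y'" for \<psi>
  proof -
    have "banach_adjoint (banach_adjoint T) \<nu> = bidual_embedding y'"
      by (simp add: \<nu>_eq blinfun.bilinear_simps y T_emb y'_def bidual_embedding_diff)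
    then have "banach_adjoint (banach_adjoint T) \<nu> \<psi> = \<psi> y'" by simp
    then show ?thesis by (simp add: banach_adjoint.rep_eq)
  qed
  have \<nu>B: "restr (B n) \<nu> = \<nu>" for n
  proof (rule LIMSEQ_unique)
    show "(\<lambda>m. restr (B n) (\<nu>s m)) \<longlonglongrightarrow> restr (B n) \<nu>" by (rule restr_tendsto[OF \<nu>])
    have "\<forall>\<^sub>F m in sequentially. \<nu>s m = restr (B n) (\<nu>s m)"
      using eventually_ge_at_top[of n]
    proof eventually_elim
      case (elim m)
      then have "B n \<inter> B m = B m" using B_anti by blast
      then show ?case by (simp add: \<nu>s_def restr_restr B)
    qed
    then show "(\<lambda>m. restr (B n) (\<nu>s m)) \<longlonglongrightarrow> \<nu>" by (rule Lim_transform_eventually[OF \<nu>])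
  qed
  have \<nu>_B: "\<nu> (\<phi> o\<^sub>L proj (B n)) = \<nu> \<phi>" for \<phi> n
    using \<nu>B[of n] restr_apply[of "B n" \<nu> \<phi>] by simp
  obtain n0 where "\<forall>n\<ge>n0. measure leb01 (B n) < \<delta>"
    using order_tendstoD(2)[OF mB_lim \<delta>] unfolding eventually_sequentially by blast
  then have n0: "measure leb01 (B n) \<le> \<delta>" if "n \<ge> n0" for n using that by (simp add: less_imp_le)
  define R where "R n = range (\<lambda>x. T (proj (B n) x))" for n
  have PP: "proj (B n) (proj (B n) x) = proj (B n) x" for n x by (simp add: proj_proj B)
  have low: "c * norm (proj (B n) x) \<le> norm (T (proj (B n) x))" if "n \<ge> n0" for n x
    by (rule lower[OF B n0[OF that]])
  have sub_R: "subspace (R n)" for n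
  proof -
    have "linear (\<lambda>x. T (proj (B n) x))"
      by (intro bounded_linear.linear bounded_linear_compose[OF blinfun.bounded_linear_right blinfun.bounded_linear_right])
    then show ?thesis unfolding R_def by (rule linear_subspace_image[OF _ subspace_UNIV])
  qed
  have closed_R: "closed (R n)" if n: "n \<ge> n0" for n
    unfolding closed_sequential_limits
  proof (intro allI impI, elim conjE)
    fix v l assume v: "\<forall>i. v i \<in> R n" "v \<longlonglongrightarrow> l"
    then obtain x where x: "\<And>i. v i = T (proj (B n) (x i))" unfolding R_def image_iff by metis
    define w where "w i = proj (B n) (x i)" for i
    have "Cauchy w"
    proof (rule metric_CauchyI)
      fix e :: real assume e: "e > 0"
      obtain N where N: "\<And>i j. i \<ge> N \<Longrightarrow> j \<ge> N \<Longrightarrow> dist (v i) (v j) < c * e"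
        using metric_CauchyD[OF LIMSEQ_imp_Cauchy[OF v(2)], of "c * e"] c e by auto
      have "dist (w i) (w j) < e" if "i \<ge> N" "j \<ge> N" for i j
      proof -
        have "c * norm (w i - w j) \<le> norm (v i - v j)"
          using low[OF n, of "x i - x j"] by (simp add: blinfun.bilinear_simps w_def x)
        then have "c * dist (w i) (w j) < c * e" using N[OF that] by (simp add: dist_norm)
        then show ?thesis using c by simp
      qed
      then show "\<exists>N. \<forall>i\<ge>N. \<forall>j\<ge>N. dist (w i) (w j) < e" by blast
    qed
    then obtain u where u: "w \<longlonglongrightarrow> u" using Cauchy_convergent convergent_def by blast
    have "(\<lambda>i. T (proj (B n) (w i))) \<longlonglongrightarrow> T (proj (B n) u)"
      by (intro bounded_linear.tendsto[OF blinfun.bounded_linear_right] u)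
    then have "v \<longlonglongrightarrow> T (proj (B n) u)" by (simp add: w_def PP x[symmetric])
    then have "l = T (proj (B n) u)" using v(2) LIMSEQ_unique by blast
    then show "l \<in> R n" by (simp add: R_def)
  qed
  have y'R: "y' \<in> R n" if n: "n \<ge> n0" for n
  proof (rule ccontr)
    assume "y' \<notin> R n"
    then obtain \<psi> :: "'b \<Rightarrow>\<^sub>L real" where \<psi>: "\<forall>x\<in>R n. blinfun_apply \<psi> x = 0" "\<psi> y' = 1"
      using separate_point_from_closed_subspace[OF sub_R closed_R[OF n]] by blast
    have "(\<psi> o\<^sub>L T) o\<^sub>L proj (B n) = 0" by (rule blinfun_eqI) (use \<psi>(1) in \<open>simp add: R_def\<close>)
    then have "\<nu> (\<psi> o\<^sub>L T) = 0" using \<nu>_B[of "\<psi> o\<^sub>L T" n] by simp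
    then show False using T\<nu>[of \<psi>] \<psi>(2) by simp
  qed
  have y'0: "y' = 0"
  proof -
    obtain x where x: "y' = T (proj (B n0) x)" using y'R[of n0] by (auto simp: R_def)
    define w where "w = proj (B n0) x"
    have wB: "proj (B n) w = w" if n: "n \<ge> n0" for n
    proof -
      obtain x' where x': "y' = T (proj (B n) x')" using y'R[OF n] by (auto simp: R_def)
      have "B n0 \<inter> B n = B n" using B_anti[OF n] by blast
      then have "proj (B n0) (x - proj (B n) x') = w - proj (B n) x'"
        by (simp add: blinfun.bilinear_simps proj_proj B w_def)
      then have "c * norm (w - proj (B n) x') \<le> norm (T (w - proj (B n) x'))"
        using low[of n0 "x - proj (B n) x'"] by simp
      also have "T (w - proj (B n) x') = 0" using x x' by (simp add: blinfun.bilinear_simps w_def)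
      finally have "w = proj (B n) x'" using c by (simp add: mult_le_0_iff)
      then show ?thesis by (simp add: PP)
    qed
    have "norm w \<le> 0"
    proof (rule field_le_epsilon)
      fix e :: real assume "e > 0"
      then obtain \<eta> where \<eta>: "\<eta> > 0" "\<forall>A\<in>sets leb01. measure leb01 A \<le> \<eta> \<longrightarrow> norm (proj A w) < e"
        using proj_absolutely_continuous by blast
      have "\<forall>\<^sub>F n in sequentially. measure leb01 (B n) < \<eta> \<and> n \<ge> n0"
        by (intro eventually_conj order_tendstoD(2)[OF mB_lim \<eta>(1)] eventually_ge_at_top)
      from eventually_happens'[OF sequentially_bot this] obtain n where "measure leb01 (B n) < \<eta>" "n \<ge> n0" by blast
      then show "norm w \<le> 0 + e" using \<eta>(2) wB[of n] B[of n] by (metis add_0 less_imp_le)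
    qed
    then show ?thesis using x by (simp add: w_def blinfun.bilinear_simps)
  qed
  have "\<nu> \<phi> = 0" for \<phi>
  proof -
    define P where "P = blinfun_apply (proj (B n0))"
    have P_bl: "P (u + v) = P u + P v" "P (r *\<^sub>R u) = r *\<^sub>R P u" for u v r by (simp_all add: P_def blinfun.bilinear_simps)
    define g where "g v = \<phi> (P (SOME x. v = T (P x)))" for v
    have inj: "P x = P x'" if "T (P x) = T (P x')" for x x'
    proof -
      have "c * norm (P (x - x')) \<le> norm (T (P (x - x')))" unfolding P_def by (rule low) simp
      also have "\<dots> = 0" using that by (simp add: P_def blinfun.bilinear_simps)
      finally have "P (x - x') = 0" using c by (simp add: mult_le_0_iff)
      then show ?thesis by (simp add: P_def blinfun.bilinear_simps)
    qed
    have g: "g (T (P x)) = \<phi> (P x)" for x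
    proof -
      have "T (P x) = T (P (SOME x'. T (P x) = T (P x')))" by (rule someI) (rule refl)
      then show ?thesis unfolding g_def using inj by metis
    qed
    have RP: "R n0 = range (\<lambda>x. T (P x))" by (simp add: R_def P_def)
    have "\<exists>\<psi> :: 'b \<Rightarrow>\<^sub>L real. \<forall>x\<in>R n0. \<psi> x = g x"
    proof (rule hahn_banach_extension[where B = "norm \<phi> / c", OF sub_R])
      show "0 \<le> norm \<phi> / c" using c by simp
      fix u v assume "u \<in> R n0" "v \<in> R n0"
      then obtain x x' where "u = T (P x)" "v = T (P x')" by (auto simp: RP)
      then show "g (u + v) = g u + g v" using g[of "x + x'"] g[of x] g[of x'] by (simp add: P_bl blinfun.bilinear_simps)
    next
      fix r v assume "v \<in> R n0"
      then obtain x where "v = T (P x)" by (auto simp: RP)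
      then show "g (r *\<^sub>R v) = r * g v" using g[of "r *\<^sub>R x"] g[of x] by (simp add: P_bl blinfun.bilinear_simps)
    next
      fix v assume "v \<in> R n0"
      then obtain x where v: "v = T (P x)" by (auto simp: RP)
      have "\<bar>g v\<bar> \<le> norm \<phi> * norm (P x)" using norm_blinfun[of \<phi> "P x"] by (simp add: v g)
      also have "\<dots> \<le> norm \<phi> * (norm v / c)"
        using low[of n0 x] c by (intro mult_left_mono) (auto simp: v P_def field_simps)
      finally show "\<bar>g v\<bar> \<le> norm \<phi> / c * norm v" by simp
    qed
    then obtain \<psi> :: "'b \<Rightarrow>\<^sub>L real" where \<psi>: "\<And>x. x \<in> R n0 \<Longrightarrow> \<psi> x = g x" by blast
    have "(\<psi> o\<^sub>L T) o\<^sub>L proj (B n0) = \<phi> o\<^sub>L proj (B n0)"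
    proof (rule blinfun_eqI)
      fix x
      have "\<psi> (T (P x)) = \<phi> (P x)" using \<psi>[of "T (P x)"] g by (simp add: RP)
      then show "((\<psi> o\<^sub>L T) o\<^sub>L proj (B n0)) x = (\<phi> o\<^sub>L proj (B n0)) x" by (simp add: P_def)
    qed
    then have "\<nu> \<phi> = \<nu> (\<psi> o\<^sub>L T)" using \<nu>_B[of \<phi> n0] \<nu>_B[of "\<psi> o\<^sub>L T" n0] by simp
    also have "\<dots> = 0" by (simp add: T\<nu> y'0 blinfun.bilinear_simps)
    finally show ?thesis .
  qed
  then have "\<nu> = 0" by (intro blinfun_eqI) simp
  then show "\<xi> \<in> range bidual_embedding" using z by auto
qed

section \<open>Functions of finitely many digits\<close>

definition cylinder :: "(nat set \<Rightarrow> real) \<Rightarrow> bool"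
  where "cylinder F \<longleftrightarrow> (\<exists>K. finite K \<and> depends_on K F)"

text \<open>The set of the digits equal to one is the sample point.\<close>

definition mean :: "(nat set \<Rightarrow> real) \<Rightarrow> real"
  where "mean F = (LINT x|leb01. F (digits x))"

definition L1_of :: "(nat set \<Rightarrow> real) \<Rightarrow> L1"
  where "L1_of F = mk (\<lambda>x. F (digits x))"

lemma cylinderE:
  assumes "cylinder F"
  obtains m where "depends_on {..<m} F"
proof -
  obtain K where K: "finite K" "depends_on K F" using assms by (auto simp: cylinder_def)
  obtain m where "K \<subseteq> {..<m}" using K(1) finite_nat_iff_bounded by blast
  then show thesis using depends_on_mono[OF K(2)] that by blast
qed

lemma cylinderI: "finite K \<Longrightarrow> depends_on K F \<Longrightarrow> cylinder F"
  by (auto simp: cylinder_def)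

lemma mean_avg: "finite K \<Longrightarrow> depends_on K F \<Longrightarrow> mean F = avg K F"
proof -
  assume K: "finite K" "depends_on K F"
  obtain m where m: "K \<subseteq> {..<m}" using K(1) finite_nat_iff_bounded by blast
  then show ?thesis
    using digits_integral(2)[OF depends_on_mono[OF K(2) m]] avg_superset[OF K(2) m] by (simp add: mean_def)
qed

lemma cylinder_integrable: "cylinder F \<Longrightarrow> integrable leb01 (\<lambda>x. F (digits x))"
  using cylinderE digits_integral(1) by metis

lemma cylinder_comp: "cylinder F \<Longrightarrow> cylinder (\<lambda>D. h (F D))"
  unfolding cylinder_def using depends_on_comp by blast

lemma cylinder_comp2:
  assumes "cylinder F" "cylinder G"
  shows "cylinder (\<lambda>D. h (F D) (G D))"
proof -
  obtain K L where "finite K" "depends_on K F" "finite L" "depends_on L G" using assms by (auto simp: cylinder_def)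
  then have "finite (K \<union> L)" "depends_on (K \<union> L) F" "depends_on (K \<union> L) G"
    by (auto intro: depends_on_mono)
  then have "depends_on (K \<union> L) (\<lambda>D. h (F D) (G D))" unfolding depends_on_def by metis
  then show ?thesis using \<open>finite (K \<union> L)\<close> by (auto simp: cylinder_def)
qed

lemma cylinder_const: "cylinder (\<lambda>_. c)"
  by (auto simp: cylinder_def depends_on_def)

lemma cylinder_sum: "(\<And>i. i \<in> I \<Longrightarrow> cylinder (F i)) \<Longrightarrow> cylinder (\<lambda>D. \<Sum>i\<in>I. F i D)"
proof (induction I rule: infinite_finite_induct)
  case (insert i I)
  then show ?case using cylinder_comp2[of "F i" "\<lambda>D. \<Sum>i\<in>I. F i D" "(+)"] by simp
qed (auto simp: cylinder_const)

lemma cylinder_vimage: "cylinder F \<Longrightarrow> cylinder (\<lambda>D. F (\<theta> -` D))"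
  unfolding cylinder_def using depends_on_vimage by blast

lemma cylinder_bounded: "cylinder F \<Longrightarrow> \<exists>R. \<forall>D. \<bar>F D\<bar> \<le> R"
proof -
  assume "cylinder F"
  then obtain K where K: "finite K" "depends_on K F" by (auto simp: cylinder_def)
  have "\<bar>F D\<bar> \<le> (\<Sum>D\<in>Pow K. \<bar>F D\<bar>)" for D
    using member_le_sum[of "D \<inter> K" "Pow K" "\<lambda>D. \<bar>F D\<bar>"] K depends_onD[OF K(2), of D] by simp
  then show ?thesis by blast
qed

lemma cylinder_bdd_fun: "cylinder F \<Longrightarrow> bdd_fun (\<lambda>x. F (digits x))"
  unfolding bdd_fun_def using cylinder_bounded cylinder_integrable by blast

lemma mean_add: "cylinder F \<Longrightarrow> cylinder G \<Longrightarrow> mean (\<lambda>D. F D + G D) = mean F + mean G"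
  unfolding mean_def using cylinder_integrable by simp

lemma mean_mult: "mean (\<lambda>D. c * F D) = c * mean F"
  unfolding mean_def by simp

lemma mean_sum: "(\<And>i. i \<in> I \<Longrightarrow> cylinder (F i)) \<Longrightarrow> mean (\<lambda>D. \<Sum>i\<in>I. F i D) = (\<Sum>i\<in>I. mean (F i))"
  unfolding mean_def using cylinder_integrable by (intro Bochner_Integration.integral_sum) auto

lemma mean_mono: "cylinder F \<Longrightarrow> cylinder G \<Longrightarrow> (\<And>D. F D \<le> G D) \<Longrightarrow> mean F \<le> mean G"
  unfolding mean_def using cylinder_integrable by (intro integral_mono) auto

lemma mean_const: "mean (\<lambda>_. c) = c"
  using mean_avg[of "{}" "\<lambda>_. c"] by (simp add: depends_on_def)

lemma mean_vimage:
  assumes F: "cylinder F" and \<theta>: "inj \<theta>"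
  shows "mean (\<lambda>D. F (\<theta> -` D)) = mean F"
proof -
  obtain K where K: "finite K" "depends_on K F" using F by (auto simp: cylinder_def)
  have "mean (\<lambda>D. F (\<theta> -` D)) = avg (\<theta> ` K) (\<lambda>D. F (\<theta> -` D))"
    using K by (intro mean_avg depends_on_vimage) auto
  also have "\<dots> = mean F" using avg_image[OF K(2) inj_on_subset[OF \<theta> subset_UNIV]] mean_avg[OF K] by simp
  finally show ?thesis .
qed

lemma mean_independent:
  assumes F: "finite K" "depends_on K F" and G: "finite L" "depends_on L G" and "K \<inter> L = {}"
  shows "mean (\<lambda>D. F D * G D) = mean F * mean G"
proof -
  have "depends_on (K \<union> L) F" "depends_on (K \<union> L) G"
    using F G by (auto intro: depends_on_mono)
  then have "depends_on (K \<union> L) (\<lambda>D. F D * G D)" unfolding depends_on_def by metis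
  then have "mean (\<lambda>D. F D * G D) = avg (K \<union> L) (\<lambda>D. F D * G D)" using F G by (intro mean_avg) auto
  also have "\<dots> = avg K F * avg L G"
    using avg_disjoint[OF F(1) G(1) assms(5), of F G] depends_onD[OF F(2)] depends_onD[OF G(2)] by simp
  finally show ?thesis using mean_avg F G by simp
qed

lemma norm_L1_of: "cylinder F \<Longrightarrow> norm (L1_of F) = mean (\<lambda>D. \<bar>F D\<bar>)"
  by (simp add: L1_of_def norm_mk cylinder_integrable mean_def)

lemma L1_of_add: "cylinder F \<Longrightarrow> cylinder G \<Longrightarrow> L1_of F + L1_of G = L1_of (\<lambda>D. F D + G D)"
  by (simp add: L1_of_def mk_add cylinder_integrable)

lemma L1_of_diff: "cylinder F \<Longrightarrow> cylinder G \<Longrightarrow> L1_of F - L1_of G = L1_of (\<lambda>D. F D - G D)"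
  by (simp add: L1_of_def mk_diff cylinder_integrable)

lemma L1_of_scaleR: "cylinder F \<Longrightarrow> c *\<^sub>R L1_of F = L1_of (\<lambda>D. c * F D)"
  by (simp add: L1_of_def mk_scaleR cylinder_integrable)

lemma L1_of_sum: "(\<And>i. i \<in> I \<Longrightarrow> cylinder (F i)) \<Longrightarrow> L1_of (\<lambda>D. \<Sum>i\<in>I. F i D) = (\<Sum>i\<in>I. L1_of (F i))"
proof (induction I rule: infinite_finite_induct)
  case (insert i I)
  then show ?case using L1_of_add[of "F i" "\<lambda>D. \<Sum>i\<in>I. F i D"] cylinder_sum[of I F] by simp
qed (auto simp: L1_of_def mk_zero)

lemma pairing_L1_of: "cylinder F \<Longrightarrow> cylinder G \<Longrightarrow> pairing (\<lambda>x. F (digits x)) (L1_of G) = mean (\<lambda>D. F D * G D)"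
  by (simp add: L1_of_def pairing_mk cylinder_bdd_fun cylinder_integrable mean_def)

lemma L1_of_dense_norm:
  assumes "e > 0"
  obtains F where "cylinder F" "norm (x - L1_of F) < e"
proof -
  obtain f where f: "integrable leb01 f" "x = mk f" by (rule L1_cases)
  obtain m F where F: "depends_on {..<m} F" "(LINT x|leb01. \<bar>f x - F (digits x)\<bar>) < e"
    using digits_dense[OF f(1)] assms by blast
  have "cylinder F" using F(1) by (intro cylinderI[of "{..<m}"]) auto
  then show thesis
    using that F(2) f by (simp add: L1_of_def mk_diff norm_mk cylinder_integrable)
qed

lemma L1_of_dense: "closure (L1_of ` Collect cylinder) = UNIV"
proof -
  have "x \<in> closure (L1_of ` Collect cylinder)" for x
    unfolding closure_approachable
  proof (intro allI impI)
    fix e :: real assume "e > 0"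
    then obtain F where "cylinder F" "norm (x - L1_of F) < e" using L1_of_dense_norm by blast
    then show "\<exists>y\<in>L1_of ` Collect cylinder. dist y x < e" by (auto simp: dist_norm norm_minus_commute)
  qed
  then show ?thesis by blast
qed

lemma subspace_L1_of: "subspace (L1_of ` Collect cylinder)"
  unfolding subspace_def
proof (intro conjI ballI allI)
  show "0 \<in> L1_of ` Collect cylinder"
    using cylinder_const[of 0] mk_zero by (auto simp: L1_of_def image_iff intro!: exI[of _ "\<lambda>_. 0"])
next
  fix x y assume "x \<in> L1_of ` Collect cylinder" "y \<in> L1_of ` Collect cylinder"
  then obtain F G where FG: "cylinder F" "cylinder G" "x = L1_of F" "y = L1_of G" by auto
  then have "x + y = L1_of (\<lambda>D. F D + G D)" by (simp add: L1_of_add)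
  moreover have "cylinder (\<lambda>D. F D + G D)" by (rule cylinder_comp2[OF FG(1,2)])
  ultimately show "x + y \<in> L1_of ` Collect cylinder" by blast
next
  fix c x assume "x \<in> L1_of ` Collect cylinder"
  then obtain F where F: "cylinder F" "x = L1_of F" by auto
  then have "c *\<^sub>R x = L1_of (\<lambda>D. c * F D)" by (simp add: L1_of_scaleR)
  moreover have "cylinder (\<lambda>D. c * F D)" by (rule cylinder_comp[OF F(1)])
  ultimately show "c *\<^sub>R x \<in> L1_of ` Collect cylinder" by blast
qed

definition rademacher :: "nat \<Rightarrow> nat set \<Rightarrow> real"
  where "rademacher k D = (if k \<in> D then 1 else -1)"

lemma rademacher_depends: "depends_on {k} (rademacher k)"
  by (auto simp: depends_on_def rademacher_def)

lemma cylinder_rademacher: "cylinder (rademacher k)"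
  using rademacher_depends by (intro cylinderI[of "{k}"]) auto

lemma mean_rademacher: "mean (rademacher k) = 0"
  using mean_avg[OF _ rademacher_depends] by (simp add: avg_def rademacher_def Pow_insert)

lemma mean_rademacher_independent:
  assumes "finite K" "depends_on K F" "k \<notin> K"
  shows "mean (\<lambda>D. rademacher k D * F D) = 0"
  using mean_independent[of "{k}" "rademacher k" K F] assms rademacher_depends by (simp add: mean_rademacher)

lemma mean_rademacher_orthonormal: "mean (\<lambda>D. rademacher k D * rademacher l D) = (if k = l then 1 else 0)"
proof (cases "k = l")
  case True
  have "(\<lambda>D. rademacher l D * rademacher l D) = (\<lambda>_. 1)" by (auto simp: rademacher_def)
  then show ?thesis using True by (simp add: mean_const)
next
  case False
  then show ?thesis using mean_rademacher_independent[OF _ rademacher_depends, of l k] by simp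
qed

text \<open>The \<open>L\<^sub>1\<close>-norm is at most the \<open>L\<^sub>2\<close>-norm, and Rademacher functions are orthonormal.\<close>

lemma norm_L1_of_rademacher_sum_le:
  assumes S: "finite S" and inj: "inj_on e S"
  shows "norm (L1_of (\<lambda>D. \<Sum>w\<in>S. a w * rademacher (e w) D)) \<le> sqrt (\<Sum>w\<in>S. (a w)\<^sup>2)"
proof -
  define F where "F D = (\<Sum>w\<in>S. a w * rademacher (e w) D)" for D
  have cF: "cylinder F" unfolding F_def by (intro cylinder_sum cylinder_comp[OF cylinder_rademacher])
  define t where "t = mean (\<lambda>D. \<bar>F D\<bar>)"
  have "0 \<le> mean (\<lambda>D. (\<bar>F D\<bar> - t)\<^sup>2)"
    using mean_mono[OF cylinder_const[of 0] cylinder_comp[OF cF, of "\<lambda>x. (\<bar>x\<bar> - t)\<^sup>2"]] by (simp add: mean_const)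
  also have "\<dots> = mean (\<lambda>D. F D * F D + ((- 2 * t) * \<bar>F D\<bar> + t\<^sup>2))"
    by (rule arg_cong[of _ _ mean]) (auto simp: power2_eq_square algebra_simps)
  also have "\<dots> = mean (\<lambda>D. F D * F D) + ((- 2 * t) * t + t\<^sup>2)"
  proof -
    have c1: "cylinder (\<lambda>D. (- 2 * t) * \<bar>F D\<bar>)" using cF by (rule cylinder_comp)
    have c2: "cylinder (\<lambda>D. (- 2 * t) * \<bar>F D\<bar> + t\<^sup>2)" using cF by (rule cylinder_comp)
    have c3: "cylinder (\<lambda>D. F D * F D)" using cF by (rule cylinder_comp)
    show ?thesis
      using mean_add[OF c3 c2] mean_add[OF c1 cylinder_const[of "t\<^sup>2"]] mean_mult[of "- 2 * t" "\<lambda>D. \<bar>F D\<bar>"]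
      by (simp add: mean_const t_def)
  qed
  finally have "t\<^sup>2 \<le> mean (\<lambda>D. F D * F D)" by (simp add: power2_eq_square)
  also have "mean (\<lambda>D. F D * F D) = mean (\<lambda>D. \<Sum>v\<in>S. \<Sum>w\<in>S. (a v * a w) * (rademacher (e v) D * rademacher (e w) D))"
    by (rule arg_cong[of _ _ mean]) (auto simp: F_def sum_product ac_simps intro!: sum.cong)
  also have "\<dots> = (\<Sum>v\<in>S. \<Sum>w\<in>S. (a v * a w) * mean (\<lambda>D. rademacher (e v) D * rademacher (e w) D))"
  proof -
    have c: "cylinder (\<lambda>D. (a v * a w) * (rademacher (e v) D * rademacher (e w) D))" for v w
      by (rule cylinder_comp2[OF cylinder_rademacher cylinder_rademacher])
    show ?thesis by (subst mean_sum, intro cylinder_sum c, rule sum.cong[OF refl], subst mean_sum, rule c, simp add: mean_mult)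
  qed
  also have "\<dots> = (\<Sum>v\<in>S. \<Sum>w\<in>S. if v = w then (a v)\<^sup>2 else 0)"
    using inj by (intro sum.cong refl) (auto simp: mean_rademacher_orthonormal power2_eq_square dest: inj_onD)
  also have "\<dots> = (\<Sum>w\<in>S. (a w)\<^sup>2)" using S by simp
  finally have "t\<^sup>2 \<le> (\<Sum>w\<in>S. (a w)\<^sup>2)" .
  then have "t \<le> sqrt (\<Sum>w\<in>S. (a w)\<^sup>2)" by (rule real_le_rsqrt)
  then show ?thesis using norm_L1_of[OF cF] by (simp add: t_def F_def[abs_def])
qed

section \<open>The neighbour sum operator\<close>

definition labels :: "(nat list \<times> nat) set"
  where "labels = {k. reduced (fst k)}"

definition label_to_nat :: "nat list \<times> nat \<Rightarrow> nat"
  where "label_to_nat = to_nat_on labels"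

definition nat_to_label :: "nat \<Rightarrow> nat list \<times> nat"
  where "nat_to_label = from_nat_into labels"

lemma infinite_labels: "infinite labels"
proof
  assume "finite labels"
  moreover have "range (\<lambda>n. ([], n)) \<subseteq> labels" by (auto simp: labels_def reduced_def)
  ultimately have "finite (range (\<lambda>n::nat. ([] :: nat list, n)))" using finite_subset by blast
  then have "finite (UNIV :: nat set)" by (rule finite_imageD) (simp add: inj_on_def)
  then show False by simp
qed

lemma nat_to_label_in_labels: "nat_to_label k \<in> labels"
proof -
  have "labels \<noteq> {}" using infinite_labels by auto
  then show ?thesis unfolding nat_to_label_def by (rule from_nat_into)
qed

lemma label_to_nat_nat_to_label: "label_to_nat (nat_to_label k) = k"
  unfolding label_to_nat_def nat_to_label_def by (rule to_nat_on_from_nat_into_infinite[OF countableI_type infinite_labels])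

lemma nat_to_label_label_to_nat: "q \<in> labels \<Longrightarrow> nat_to_label (label_to_nat q) = q"
  unfolding label_to_nat_def nat_to_label_def by (rule from_nat_into_to_nat_on[OF countableI_type])

lemma inj_nat_to_label: "inj nat_to_label"
  by (rule inj_on_inverseI[of _ label_to_nat]) (simp add: label_to_nat_nat_to_label)

lemma inj_on_label_to_nat: "inj_on label_to_nat labels"
  by (rule inj_on_inverseI[of _ nat_to_label]) (simp add: nat_to_label_label_to_nat)

lemma label_nbr_labels: "c < 5 \<Longrightarrow> q \<in> labels \<Longrightarrow> label_nbr c q \<in> labels"
  by (simp add: labels_def label_nbr_def reduced_word_nbr)

lemma label_nbr_label_nbr: "q \<in> labels \<Longrightarrow> label_nbr c (label_nbr c q) = q"
  by (simp add: labels_def label_nbr_def word_nbr_word_nbr)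

text \<open>The factor \<open>2\<close> leaves the odd digits of the target untouched by the operator.\<close>

definition digit_map :: "nat \<Rightarrow> nat \<Rightarrow> nat"
  where "digit_map c k = 2 * label_to_nat (label_nbr c (nat_to_label k))"

lemma inj_digit_map: "c < 5 \<Longrightarrow> inj (digit_map c)"
proof (rule injI)
  fix k l assume c: "c < 5" and "digit_map c k = digit_map c l"
  then have "label_nbr c (nat_to_label k) = label_nbr c (nat_to_label l)"
    using inj_onD[OF inj_on_label_to_nat] label_nbr_labels[OF c] nat_to_label_in_labels by (simp add: digit_map_def)
  then have "nat_to_label k = nat_to_label l" using label_nbr_label_nbr[OF nat_to_label_in_labels] by metis
  then show "k = l" using inj_nat_to_label by (auto dest: injD)
qed

definition graph_sum :: "(nat set \<Rightarrow> real) \<Rightarrow> nat set \<Rightarrow> real"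
  where "graph_sum F D = (\<Sum>c<5. F (digit_map c -` D))"

lemma cylinder_graph_sum: "cylinder F \<Longrightarrow> cylinder (graph_sum F)"
  unfolding graph_sum_def[abs_def] by (intro cylinder_sum cylinder_vimage)

lemma norm_graph_sum_le: "cylinder F \<Longrightarrow> norm (L1_of (graph_sum F)) \<le> 5 * norm (L1_of F)"
proof -
  assume F: "cylinder F"
  have c: "cylinder (\<lambda>D. \<bar>F (digit_map c -` D)\<bar>)" for c by (rule cylinder_comp[OF cylinder_vimage[OF F]])
  have "mean (\<lambda>D. \<bar>graph_sum F D\<bar>) \<le> mean (\<lambda>D. \<Sum>c<5. \<bar>F (digit_map c -` D)\<bar>)"
    by (intro mean_mono cylinder_comp[OF cylinder_graph_sum[OF F]] cylinder_sum c) (simp add: graph_sum_def)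
  also have "\<dots> = (\<Sum>c<5. mean (\<lambda>D. \<bar>F (digit_map c -` D)\<bar>))" by (rule mean_sum) (rule c)
  also have "\<dots> = (\<Sum>c<5::nat. mean (\<lambda>D. \<bar>F D\<bar>))"
    using mean_vimage[OF cylinder_comp[OF F, of abs] inj_digit_map] by (intro sum.cong) auto
  finally show ?thesis by (simp add: norm_L1_of F cylinder_graph_sum)
qed

lemma small_support_bound_L1_of:
  assumes F: "cylinder F" and small: "mean (\<lambda>D. if F D \<noteq> 0 then 1 else 0) \<le> 1 / 23328"
  shows "norm (L1_of F) \<le> 2 * norm (L1_of (graph_sum F))"
proof -
  obtain L where L: "finite L" "depends_on L F" using F by (auto simp: cylinder_def)
  define K where "K = nat_to_label ` L"
  define H where "H E = F (nat_to_label -` E)" for E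
  define K' where "K' = (\<Union>c<5. label_nbr c ` K)"
  define G where "G E = (\<Sum>c<5. H (label_nbr c -` E))" for E
  define \<theta> where "\<theta> q = 2 * label_to_nat q" for q
  have K: "finite K" "\<And>k. k \<in> K \<Longrightarrow> reduced (fst k)"
    using L(1) nat_to_label_in_labels by (auto simp: K_def labels_def)
  have H: "depends_on K H" unfolding H_def K_def by (rule depends_on_vimage[OF L(2)])
  have avg_H: "avg K (\<lambda>E. h (H E)) = mean (\<lambda>D. h (F D))" for h :: "real \<Rightarrow> real"
    unfolding H_def K_def
    using avg_image[OF depends_on_comp[OF L(2), of h] inj_on_subset[OF inj_nat_to_label subset_UNIV]] mean_avg[OF L(1) depends_on_comp[OF L(2)]] by simp
  have "avg K (\<lambda>E. \<bar>H E\<bar>) \<le> avg K' (\<lambda>E. \<bar>G E\<bar>) + 11664 * avg K (\<lambda>E. if H E \<noteq> 0 then 1 else 0) * avg K (\<lambda>E. \<bar>H E\<bar>)"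
    unfolding K'_def G_def by (rule small_support_bound_cylinder[OF K H])
  then have 1: "mean (\<lambda>D. \<bar>F D\<bar>) \<le> avg K' (\<lambda>E. \<bar>G E\<bar>) + 11664 * mean (\<lambda>D. if F D \<noteq> 0 then 1 else 0) * mean (\<lambda>D. \<bar>F D\<bar>)"
    using avg_H[of abs] avg_H[of "\<lambda>x. if x \<noteq> 0 then 1 else 0"] by simp
  have K'I: "K' \<subseteq> labels" unfolding K'_def K_def using label_nbr_labels nat_to_label_in_labels by blast
  have finK': "finite K'" using K(1) by (simp add: K'_def)
  have depG: "depends_on K' G"
  proof -
    have "depends_on K' (\<lambda>E. H (label_nbr c -` E))" if "c < 5" for c
      by (rule depends_on_mono[OF depends_on_vimage[OF H]]) (use that in \<open>auto simp: K'_def\<close>)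
    then show ?thesis unfolding G_def depends_on_def by (intro allI sum.cong refl) (metis lessThan_iff)
  qed
  have inj\<theta>: "inj_on \<theta> K'" using inj_on_subset[OF inj_on_label_to_nat K'I] by (auto simp: inj_on_def \<theta>_def)
  have gs: "graph_sum F D = G (\<theta> -` D)" for D
  proof -
    have "digit_map c -` D = nat_to_label -` (label_nbr c -` (\<theta> -` D))" for c by (auto simp: digit_map_def \<theta>_def)
    then show ?thesis by (simp add: graph_sum_def G_def H_def)
  qed
  have "mean (\<lambda>D. \<bar>graph_sum F D\<bar>) = avg K' (\<lambda>E. \<bar>G E\<bar>)"
    unfolding gs
    using mean_avg[OF finite_imageI[OF finK'] depends_on_vimage[OF depends_on_comp[OF depG, of abs]], of \<theta>]
      avg_image[OF depends_on_comp[OF depG, of abs] inj\<theta>] by simp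
  moreover have "11664 * mean (\<lambda>D. if F D \<noteq> 0 then 1 else 0) * mean (\<lambda>D. \<bar>F D\<bar>) \<le> 1 / 2 * mean (\<lambda>D. \<bar>F D\<bar>)"
    using small norm_ge_zero[of "L1_of F"] norm_L1_of[OF F] by (intro mult_right_mono) auto
  ultimately show ?thesis using 1 norm_L1_of[OF F] norm_L1_of[OF cylinder_graph_sum[OF F]] by simp
qed

text \<open>The formula is given on a dense subspace only. There it respects equality almost everywhere, because
  it is linear and bounded.\<close>

lemma graph_operator_exists:
  "\<exists>T :: L1 \<Rightarrow>\<^sub>L L1. \<forall>F. cylinder F \<longrightarrow> T (L1_of F) = L1_of (graph_sum F)"
proof -
  define t where "t x = L1_of (graph_sum (SOME F. cylinder F \<and> x = L1_of F))" for x
  have gs_lin: "graph_sum (\<lambda>D. F D - G D) = (\<lambda>D. graph_sum F D - graph_sum G D)"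
    "graph_sum (\<lambda>D. F D + G D) = (\<lambda>D. graph_sum F D + graph_sum G D)"
    "graph_sum (\<lambda>D. c * F D) = (\<lambda>D. c * graph_sum F D)" for F G c
    by (auto simp: graph_sum_def fun_eq_iff sum_subtractf sum.distrib sum_distrib_left)
  have t: "t (L1_of F) = L1_of (graph_sum F)" if F: "cylinder F" for F
  proof -
    define G where "G = (SOME G. cylinder G \<and> L1_of F = L1_of G)"
    have G: "cylinder G \<and> L1_of F = L1_of G" unfolding G_def by (rule someI[of _ F]) (use F in simp)
    have c: "cylinder (\<lambda>D. G D - F D)" by (rule cylinder_comp2[OF conjunct1[OF G] F])
    have "norm (L1_of (graph_sum G) - L1_of (graph_sum F)) = norm (L1_of (graph_sum (\<lambda>D. G D - F D)))"
      using F G by (simp add: L1_of_diff cylinder_graph_sum gs_lin)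
    also have "\<dots> \<le> 5 * norm (L1_of (\<lambda>D. G D - F D))" by (rule norm_graph_sum_le[OF c])
    also have "L1_of (\<lambda>D. G D - F D) = 0" using F G L1_of_diff[of G F] by simp
    finally show ?thesis by (simp add: t_def G_def[symmetric])
  qed
  have "\<exists>T :: L1 \<Rightarrow>\<^sub>L L1. \<forall>x\<in>L1_of ` Collect cylinder. T x = t x"
  proof (rule dense_extension[OF subspace_L1_of L1_of_dense, where C = 5])
    fix x y assume "x \<in> L1_of ` Collect cylinder" "y \<in> L1_of ` Collect cylinder"
    then obtain F G where FG: "cylinder F" "cylinder G" "x = L1_of F" "y = L1_of G" by auto
    have c: "cylinder (\<lambda>D. F D + G D)" by (rule cylinder_comp2[OF FG(1,2)])
    show "t (x + y) = t x + t y"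
      using FG c by (simp add: L1_of_add t gs_lin cylinder_graph_sum)
  next
    fix c x assume "x \<in> L1_of ` Collect cylinder"
    then obtain F where F: "cylinder F" "x = L1_of F" by auto
    have "cylinder (\<lambda>D. c * F D)" by (rule cylinder_comp[OF F(1)])
    then show "t (c *\<^sub>R x) = c *\<^sub>R t x" using F by (simp add: L1_of_scaleR t gs_lin cylinder_graph_sum)
  next
    fix x assume "x \<in> L1_of ` Collect cylinder"
    then show "norm (t x) \<le> 5 * norm x" using t norm_graph_sum_le by auto
  qed
  then show ?thesis using t by auto
qed

text \<open>Cylinder functions with small support approximate a function supported in \<open>A\<close>: multiply any good
  approximation by the indicator of a cylinder set close to \<open>A\<close>. The constant is half the one of
  \<open>small_support_bound_L1_of\<close> so that this cylinder set is still small enough.\<close>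

lemma graph_operator_lower_bound:
  fixes T :: "L1 \<Rightarrow>\<^sub>L L1"
  assumes T: "\<And>F. cylinder F \<Longrightarrow> T (L1_of F) = L1_of (graph_sum F)"
    and A: "A \<in> sets leb01" "measure leb01 A \<le> 1 / 46656"
  shows "(1 / 2) * norm (proj A x) \<le> norm (T (proj A x))"
proof -
  interpret finite_measure leb01 by (rule finite_measure_leb01)
  obtain f where f: "integrable leb01 f" "x = mk f" by (rule L1_cases)
  have approx: "norm (proj A x) \<le> 2 * norm (T (proj A x)) + \<epsilon> * (4 * norm T + 2)" if \<epsilon>: "\<epsilon> > 0" for \<epsilon>
  proof -
    obtain \<eta> where \<eta>: "\<eta> > 0" "\<forall>E\<in>sets leb01. measure leb01 E \<le> \<eta> \<longrightarrow> norm (proj E x) < \<epsilon>"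
      using proj_absolutely_continuous[OF \<epsilon>] by blast
    have "min \<eta> (1 / 46656) > 0" using \<eta>(1) by simp
    from digits_dense_indicator[OF A(1) this] obtain m G where G: "depends_on {..<m} G" "\<And>D. G D \<in> {0, 1}"
      "(LINT t|leb01. \<bar>indicator A t - G (digits t)\<bar>) < min \<eta> (1 / 46656)" by blast
    have cG: "cylinder G" using G(1) by (intro cylinderI[of "{..<m}"]) auto
    obtain F where F: "cylinder F" "norm (x - L1_of F) < \<epsilon>" using L1_of_dense_norm[OF \<epsilon>] by blast
    define H where "H D = G D * F D" for D
    have cH: "cylinder H" unfolding H_def by (rule cylinder_comp2[OF cG F(1)])
    note iA = indicator_integrable[OF A(1)] and iG = cylinder_integrable[OF cG]
      and iF = cylinder_integrable[OF F(1)] and iH = cylinder_integrable[OF cH]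
    define E where "E = {t \<in> space leb01. indicator A t \<noteq> G (digits t)}"
    have mG: "(\<lambda>t. G (digits t)) \<in> borel_measurable leb01" using iG by simp
    have mA: "(indicator A :: real \<Rightarrow> real) \<in> borel_measurable leb01" using iA by simp
    have E: "E \<in> sets leb01" unfolding E_def using mG mA by measurable
    have G01: "G D = 0 \<or> G D = 1" for D using G(2) by auto
    have E_ind: "\<bar>indicator A t - G (digits t)\<bar> = indicator E t" if "t \<in> space leb01" for t
      using that G01[of "digits t"] by (auto simp: E_def indicator_def)
    have "measure leb01 E = (LINT t|leb01. indicator E t)"
      using sets.Int_space_eq2[OF E] by simp
    also have "\<dots> = (LINT t|leb01. \<bar>indicator A t - G (digits t)\<bar>)"
      by (rule Bochner_Integration.integral_cong) (auto simp: E_ind)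
    finally have mE: "measure leb01 E < min \<eta> (1 / 46656)" using G(3) by simp
    have "norm (proj A x - L1_of H) = (LINT t|leb01. \<bar>indicator A t * f t - H (digits t)\<bar>)"
      using f A iH integrable_indicator_mult[OF A(1) f(1)] by (simp add: proj_mk L1_of_def mk_diff norm_mk)
    also have "\<dots> \<le> (LINT t|leb01. \<bar>indicator E t * f t\<bar> + \<bar>f t - F (digits t)\<bar>)"
    proof (rule integral_mono)
      fix t assume t: "t \<in> space leb01"
      show "\<bar>indicator A t * f t - H (digits t)\<bar> \<le> \<bar>indicator E t * f t\<bar> + \<bar>f t - F (digits t)\<bar>"
        using G01[of "digits t"] t by (auto simp: H_def E_def indicator_def)
    qed (use f A E iH iF integrable_indicator_mult in auto)
    also have "\<dots> = norm (proj E x) + norm (x - L1_of F)"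
      using f E iF integrable_indicator_mult[OF E f(1)] by (simp add: proj_mk L1_of_def mk_diff norm_mk)
    also have "\<dots> \<le> 2 * \<epsilon>" using \<eta>(2) E mE F(2) by (auto simp: less_imp_le)
    finally have close: "norm (proj A x - L1_of H) \<le> 2 * \<epsilon>" .
    have "mean (\<lambda>D. if H D \<noteq> 0 then 1 else 0) \<le> mean G"
    proof (intro mean_mono cylinder_comp[OF cH] cG)
      show "(if H D \<noteq> 0 then 1 else 0) \<le> G D" for D using G01[of D] by (auto simp: H_def)
    qed
    also have "mean G \<le> (LINT t|leb01. indicator A t + \<bar>indicator A t - G (digits t)\<bar>)"
      unfolding mean_def using iA iG by (intro integral_mono) auto
    also have "\<dots> = measure leb01 A + (LINT t|leb01. \<bar>indicator A t - G (digits t)\<bar>)"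
      using iA iG sets.Int_space_eq2[OF A(1)] by simp
    also have "\<dots> \<le> 1 / 23328" using A(2) G(3) by simp
    finally have "norm (L1_of H) \<le> 2 * norm (T (L1_of H))"
      using small_support_bound_L1_of[OF cH] T[OF cH] by simp
    also have "norm (T (L1_of H)) \<le> norm (T (proj A x)) + norm T * (2 * \<epsilon>)"
    proof -
      have "T (L1_of H) = T (proj A x) - T (proj A x - L1_of H)" by (simp add: blinfun.bilinear_simps)
      then have "norm (T (L1_of H)) \<le> norm (T (proj A x)) + norm (T (proj A x - L1_of H))"
        by (metis norm_triangle_ineq4)
      also have "norm (T (proj A x - L1_of H)) \<le> norm T * (2 * \<epsilon>)"
        using norm_blinfun[of T "proj A x - L1_of H"] mult_left_mono[OF close, of "norm T"] by simp
      finally show ?thesis by simp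
    qed
    finally have "norm (L1_of H) \<le> 2 * norm (T (proj A x)) + 4 * norm T * \<epsilon>" by simp
    moreover have "norm (proj A x) \<le> norm (proj A x - L1_of H) + norm (L1_of H)"
      using norm_triangle_ineq[of "proj A x - L1_of H" "L1_of H"] by simp
    ultimately show ?thesis using close by (simp add: algebra_simps)
  qed
  have "norm (proj A x) \<le> 2 * norm (T (proj A x))"
  proof (rule field_le_epsilon)
    fix e :: real assume e: "e > 0"
    define C where "C = 4 * norm T + 2"
    have C: "C > 0" by (simp add: C_def add_nonneg_pos)
    show "norm (proj A x) \<le> 2 * norm (T (proj A x)) + e"
      using approx[of "e / C"] e C by (simp add: C_def[symmetric])
  qed
  then show ?thesis by simp
qed

section \<open>Approximate kernel\<close>

definition words :: "nat \<Rightarrow> nat list set"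
  where "words l = {w. reduced w \<and> length w = l}"

definition words_upto :: "nat \<Rightarrow> nat list set"
  where "words_upto l = {w. reduced w \<and> length w \<le> l}"

lemma finite_words_upto: "finite (words_upto l)"
  by (rule finite_subset[OF _ finite_lists_length_le[of "{..<5}" l]]) (auto simp: words_upto_def reduced_def)

lemma finite_words: "finite (words l)"
  by (rule finite_subset[OF _ finite_words_upto[of l]]) (auto simp: words_def words_upto_def)

lemma card_words: "card (words (Suc l)) \<le> 5 * 4 ^ l"
proof (induction l)
  case 0
  have "words (Suc 0) \<subseteq> (\<lambda>c. [c]) ` {..<5}"
    by (auto simp: words_def reduced_def length_Suc_conv)
  then have "card (words (Suc 0)) \<le> card ((\<lambda>c. [c :: nat]) ` {..<5})" by (intro card_mono) auto
  also have "\<dots> \<le> 5" using card_image_le[of "{..<5::nat}" "\<lambda>c. [c]"] by simp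
  finally show ?case by simp
next
  case (Suc l)
  define N where "N w = {..<5} - {hd w}" for w :: "nat list"
  have "words (Suc (Suc l)) \<subseteq> (\<lambda>(w, c). c # w) ` (SIGMA w:words (Suc l). N w)"
  proof
    fix v assume "v \<in> words (Suc (Suc l))"
    then obtain c w where v: "v = c # w" "length w = Suc l" "reduced (c # w)"
      by (auto simp: words_def length_Suc_conv)
    then have "w \<in> words (Suc l)" "c \<in> N w"
      by (auto simp: words_def N_def reduced_def distinct_adj_Cons)
    then show "v \<in> (\<lambda>(w, c). c # w) ` (SIGMA w:words (Suc l). N w)" unfolding v by force
  qed
  then have "card (words (Suc (Suc l))) \<le> card (SIGMA w:words (Suc l). N w)"
    by (rule surj_card_le[rotated]) (auto simp: finite_words N_def)
  also have "\<dots> = (\<Sum>w\<in>words (Suc l). card (N w))"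
    by (rule card_SigmaI) (auto simp: finite_words N_def)
  also have "\<dots> = (\<Sum>w\<in>words (Suc l). 4)"
  proof (rule sum.cong[OF refl])
    fix w assume w: "w \<in> words (Suc l)"
    then have "w \<noteq> []" by (auto simp: words_def)
    then have "hd w \<in> set w" by simp
    moreover have "set w \<subseteq> {..<5}" using w by (simp add: words_def reduced_def)
    ultimately have "hd w \<in> {..<5}" by blast
    then show "card (N w) = 4" by (simp add: N_def)
  qed
  also have "\<dots> \<le> 5 * 4 ^ Suc l" using Suc by simp
  finally show ?case .
qed

text \<open>Without the linear cut-off this is the radial function on the even part of the tree whose sum over the
  neighbours of any vertex is zero. Its values are such that all spheres have comparable \<open>\<ell>\<^sub>2\<close>-norm, so a
  sharp truncation would leave an error of the same size as the value at the root.\<close>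

definition radial :: "nat \<Rightarrow> nat list \<Rightarrow> real"
  where "radial L w = (if even (length w) \<and> length w < 2 * L
    then (-1/4) ^ (length w div 2) * (1 - real (length w div 2) / real L) else 0)"

text \<open>A word of odd length \<open>2 * k + 1\<close> has one neighbour of length \<open>2 * k\<close> and four of length \<open>2 * k + 2\<close>. The
  exact cancellation is disturbed only by the slope \<open>1 / L\<close> of the cut-off.\<close>

lemma radial_nbr_sum:
  assumes L: "L > 0" and w: "reduced w"
  shows "((\<Sum>c<5. radial L (word_nbr c w)))\<^sup>2
    = (if odd (length w) \<and> length w < 2 * L then (1/16) ^ (length w div 2) / (real L)\<^sup>2 else 0)"
proof (cases "even (length w)")
  case True
  have "radial L (word_nbr c w) = 0" for c
    using True by (cases w) (auto simp: radial_def word_nbr_def)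
  then show ?thesis using True by simp
next
  case False
  then obtain a u where wu: "w = a # u" by (cases w) auto
  define k where "k = length u div 2"
  have lu: "length u = 2 * k" using False wu by (simp add: k_def)
  have a: "a < 5" using w wu by (simp add: reduced_def)
  have up: "radial L (word_nbr c w) = (if k + 1 < L then (-1/4) ^ (k + 1) * (1 - real (k + 1) / real L) else 0)" if "c \<noteq> a" for c
    using that lu by (simp add: word_nbr_def wu radial_def)
  have "(\<Sum>c<5. radial L (word_nbr c w)) = radial L (word_nbr a w) + (\<Sum>c\<in>{..<5} - {a}. radial L (word_nbr c w))"
    using a by (intro sum.remove) auto
  also have "(\<Sum>c\<in>{..<5} - {a}. radial L (word_nbr c w))
      = (\<Sum>c\<in>{..<5} - {a}. if k + 1 < L then (-1/4) ^ (k + 1) * (1 - real (k + 1) / real L) else 0)"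
    by (intro sum.cong refl up) auto
  also have "\<dots> = 4 * (if k + 1 < L then (-1/4) ^ (k + 1) * (1 - real (k + 1) / real L) else 0)"
    using a by simp
  also have "radial L (word_nbr a w) = (if k < L then (-1/4) ^ k * (1 - real k / real L) else 0)"
    using lu by (simp add: word_nbr_def wu radial_def)
  finally have "(\<Sum>c<5. radial L (word_nbr c w)) = (if k < L then (-1/4) ^ k / real L else 0)"
  proof -
    assume eq: "(\<Sum>c<5. radial L (word_nbr c w)) = (if k < L then (-1/4) ^ k * (1 - real k / real L) else 0)
      + 4 * (if k + 1 < L then (-1/4) ^ (k + 1) * (1 - real (k + 1) / real L) else 0)"
    consider "k + 1 < L" | "k + 1 = L" | "L \<le> k" by linarith
    then show ?thesis
    proof cases
      case 1
      have "b * p + 4 * ((-1/4) * b * q) = b * (p - q)" for b p q :: real by (simp add: algebra_simps)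
      then have "(-1/4) ^ k * (1 - real k / real L) + 4 * ((-1/4) * (-1/4) ^ k * (1 - (real k + 1) / real L))
          = (-1/4 :: real) ^ k * ((1 - real k / real L) - (1 - (real k + 1) / real L))" .
      then have "(\<Sum>c<5. radial L (word_nbr c w)) = (-1/4) ^ k * ((1 - real k / real L) - (1 - (real k + 1) / real L))"
        unfolding eq using 1 by (simp add: add.commute[of 1])
      also have "(1 - real k / real L) - (1 - (real k + 1) / real L) = 1 / real L"
        by (simp add: add_divide_distrib)
      finally show ?thesis using 1 by simp
    next
      case 2
      then have "1 - real k / real L = 1 / real L" by (simp add: field_simps)
      then show ?thesis unfolding eq using 2 by simp
    next
      case 3
      then show ?thesis unfolding eq by simp
    qed
  qed
  moreover have "length w div 2 = k" "length w < 2 * L \<longleftrightarrow> k < L" using lu wu by auto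
  moreover have "((-1/4 :: real) ^ k)\<^sup>2 = (1/16) ^ k"
    by (simp add: power2_eq_square flip: power_mult_distrib)
  ultimately show ?thesis using False by (simp add: power_divide)
qed

text \<open>The sphere of radius \<open>2 * k + 1\<close> has at most \<open>5 * 16 ^ k\<close> elements, each contributing
  \<open>(1/16) ^ k / L\<^sup>2\<close>, so every sphere contributes at most \<open>5 / L\<^sup>2\<close>.\<close>

lemma radial_nbr_sum_squares:
  assumes L: "L > 0"
  shows "(\<Sum>w\<in>words_upto (2 * L). ((\<Sum>c<5. radial L (word_nbr c w)))\<^sup>2) \<le> 5 / real L"
proof -
  define X where "X = {w \<in> words_upto (2 * L). odd (length w) \<and> length w < 2 * L}"
  have "(\<Sum>w\<in>words_upto (2 * L). ((\<Sum>c<5. radial L (word_nbr c w)))\<^sup>2)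
      = (\<Sum>w\<in>words_upto (2 * L). if odd (length w) \<and> length w < 2 * L then (1/16) ^ (length w div 2) / (real L)\<^sup>2 else 0)"
    by (intro sum.cong refl radial_nbr_sum[OF L]) (auto simp: words_upto_def)
  also have "\<dots> = (\<Sum>w\<in>X. (1/16) ^ (length w div 2) / (real L)\<^sup>2)"
    unfolding X_def by (rule sum.inter_filter[symmetric]) (rule finite_words_upto)
  also have "X = (\<Union>k<L. words (Suc (2 * k)))"
  proof -
    have "w \<in> X \<longleftrightarrow> w \<in> (\<Union>k<L. words (Suc (2 * k)))" for w
    proof
      assume "w \<in> X"
      then obtain k where k: "length w = 2 * k + 1" "reduced w" "2 * k + 1 < 2 * L"
        by (auto simp: X_def words_upto_def elim!: oddE)
      then have "k < L" by simp
      then show "w \<in> (\<Union>k<L. words (Suc (2 * k)))" using k by (auto simp: words_def)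
    qed (auto simp: X_def words_def words_upto_def)
    then show ?thesis by blast
  qed
  also have "(\<Sum>w\<in>(\<Union>k<L. words (Suc (2 * k))). (1/16) ^ (length w div 2) / (real L)\<^sup>2)
      = (\<Sum>k<L. \<Sum>w\<in>words (Suc (2 * k)). (1/16) ^ (length w div 2) / (real L)\<^sup>2)"
    by (rule sum.UNION_disjoint) (auto simp: finite_words, auto simp: words_def)
  also have "\<dots> = (\<Sum>k<L. real (card (words (Suc (2 * k)))) * ((1/16) ^ k / (real L)\<^sup>2))"
    by (intro sum.cong refl) (simp add: words_def)
  also have "\<dots> \<le> (\<Sum>k<L. (5 * 16 ^ k) * ((1/16) ^ k / (real L)\<^sup>2))"
  proof (intro sum_mono mult_right_mono)
    fix k
    have "real (card (words (Suc (2 * k)))) \<le> real (5 * 4 ^ (2 * k))" by (rule of_nat_mono[OF card_words])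
    then show "real (card (words (Suc (2 * k)))) \<le> 5 * 16 ^ k" by (simp add: power_mult)
  qed simp
  also have "\<dots> = (\<Sum>k<L. 5 / (real L)\<^sup>2)"
    by (intro sum.cong refl) (simp add: power_one_over)
  also have "\<dots> = 5 / real L" using L by (simp add: power2_eq_square)
  finally show ?thesis .
qed

definition kernel_fun :: "nat \<Rightarrow> nat \<Rightarrow> nat set \<Rightarrow> real"
  where "kernel_fun L n D = (\<Sum>w\<in>words_upto (2 * L). radial L w * rademacher (label_to_nat (w, n)) D)"

lemma cylinder_kernel_fun: "cylinder (kernel_fun L n)"
  unfolding kernel_fun_def[abs_def] by (intro cylinder_sum cylinder_comp[OF cylinder_rademacher])

lemma graph_sum_kernel_fun:
  "graph_sum (kernel_fun L n) = (\<lambda>D. \<Sum>w\<in>words_upto (2 * L). (\<Sum>c<5. radial L (word_nbr c w)) * rademacher (2 * label_to_nat (w, n)) D)"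
proof
  fix D
  have "(\<Sum>w\<in>words_upto (2 * L). radial L w * rademacher (label_to_nat (w, n)) (digit_map c -` D))
      = (\<Sum>w\<in>words_upto (2 * L). radial L (word_nbr c w) * rademacher (2 * label_to_nat (w, n)) D)" if c: "c < 5" for c
  proof -
    have digits: "rademacher (label_to_nat (w, n)) (digit_map c -` D) = rademacher (2 * label_to_nat (word_nbr c w, n)) D" if "reduced w" for w
      using that by (simp add: rademacher_def digit_map_def nat_to_label_label_to_nat labels_def label_nbr_def)
    have len: "length (word_nbr c w) \<le> 2 * L" if "radial L w \<noteq> 0" for w
      using that by (auto simp: radial_def word_nbr_def split: if_splits)
    have len': "length w \<le> 2 * L" if "radial L w \<noteq> 0" for w
      using that by (auto simp: radial_def split: if_splits)
    have "(\<Sum>w\<in>words_upto (2 * L). radial L w * rademacher (label_to_nat (w, n)) (digit_map c -` D))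
        = (\<Sum>w\<in>{w \<in> words_upto (2 * L). radial L w \<noteq> 0}. radial L w * rademacher (2 * label_to_nat (word_nbr c w, n)) D)"
      by (rule sum.mono_neutral_cong_right[OF finite_words_upto]) (auto simp: digits words_upto_def)
    also have "\<dots> = (\<Sum>w\<in>{w \<in> words_upto (2 * L). radial L (word_nbr c w) \<noteq> 0}. radial L (word_nbr c w) * rademacher (2 * label_to_nat (w, n)) D)"
      by (rule sum.reindex_bij_witness[of _ "word_nbr c" "word_nbr c"])
        (use len len' c in \<open>auto simp: words_upto_def word_nbr_word_nbr reduced_word_nbr\<close>)
    also have "\<dots> = (\<Sum>w\<in>words_upto (2 * L). radial L (word_nbr c w) * rademacher (2 * label_to_nat (w, n)) D)"
      by (rule sum.mono_neutral_left) (auto simp: finite_words_upto)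
    finally show ?thesis .
  qed
  then have "graph_sum (kernel_fun L n) D = (\<Sum>c<5. \<Sum>w\<in>words_upto (2 * L). radial L (word_nbr c w) * rademacher (2 * label_to_nat (w, n)) D)"
    by (simp add: graph_sum_def kernel_fun_def)
  also have "\<dots> = (\<Sum>w\<in>words_upto (2 * L). (\<Sum>c<5. radial L (word_nbr c w)) * rademacher (2 * label_to_nat (w, n)) D)"
    by (subst sum.swap) (simp add: sum_distrib_right)
  finally show "graph_sum (kernel_fun L n) D = (\<Sum>w\<in>words_upto (2 * L). (\<Sum>c<5. radial L (word_nbr c w)) * rademacher (2 * label_to_nat (w, n)) D)" .
qed

lemma norm_graph_sum_kernel_fun: "L > 0 \<Longrightarrow> norm (L1_of (graph_sum (kernel_fun L n))) \<le> sqrt (5 / real L)"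
proof -
  assume L: "L > 0"
  have "inj_on (\<lambda>w. 2 * label_to_nat (w, n)) (words_upto (2 * L))"
    using inj_on_label_to_nat by (auto simp: inj_on_def labels_def words_upto_def)
  from norm_L1_of_rademacher_sum_le[OF finite_words_upto this, of "\<lambda>w. \<Sum>c<5. radial L (word_nbr c w)"]
  have "norm (L1_of (graph_sum (kernel_fun L n))) \<le> sqrt (\<Sum>w\<in>words_upto (2 * L). (\<Sum>c<5. radial L (word_nbr c w))\<^sup>2)"
    unfolding graph_sum_kernel_fun .
  also have "\<dots> \<le> sqrt (5 / real L)" using radial_nbr_sum_squares[OF L] by simp
  finally show ?thesis .
qed

lemma mean_kernel_fun:
  "cylinder F \<Longrightarrow> mean (\<lambda>D. F D * kernel_fun L n D) = (\<Sum>w\<in>words_upto (2 * L). radial L w * mean (\<lambda>D. rademacher (label_to_nat (w, n)) D * F D))"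
proof -
  assume F: "cylinder F"
  have c: "cylinder (\<lambda>D. radial L w * (rademacher (label_to_nat (w, n)) D * F D))" for w
    by (rule cylinder_comp2[OF cylinder_rademacher F])
  have "(\<lambda>D. F D * kernel_fun L n D) = (\<lambda>D. \<Sum>w\<in>words_upto (2 * L). radial L w * (rademacher (label_to_nat (w, n)) D * F D))"
    by (simp add: kernel_fun_def sum_distrib_left ac_simps)
  then show ?thesis using mean_sum[of "words_upto (2 * L)" "\<lambda>w D. radial L w * (rademacher (label_to_nat (w, n)) D * F D)"] c
    by (simp add: mean_mult)
qed

lemma mean_root_kernel_fun:
  assumes L: "L > 0"
  shows "mean (\<lambda>D. rademacher (label_to_nat ([], n)) D * kernel_fun L m D) = (if n = m then 1 else 0)"
proof -
  have "mean (\<lambda>D. rademacher (label_to_nat ([], n)) D * kernel_fun L m D)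
      = (\<Sum>w\<in>words_upto (2 * L). radial L w * (if label_to_nat (w, m) = label_to_nat ([], n) then 1 else 0))"
    by (simp add: mean_kernel_fun[OF cylinder_rademacher] mean_rademacher_orthonormal)
  also have "\<dots> = (\<Sum>w\<in>words_upto (2 * L). if w = [] then (if n = m then 1 else 0) else 0)"
  proof (rule sum.cong[OF refl])
    fix w assume "w \<in> words_upto (2 * L)"
    then have "label_to_nat (w, m) = label_to_nat ([], n) \<longleftrightarrow> (w, m) = ([], n)"
      by (intro inj_on_eq_iff[OF inj_on_label_to_nat]) (auto simp: labels_def words_upto_def reduced_def)
    then show "radial L w * (if label_to_nat (w, m) = label_to_nat ([], n) then 1 else 0) = (if w = [] then (if n = m then 1 else 0) else 0)"
      using L by (auto simp: radial_def)
  qed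
  also have "\<dots> = (if n = m then 1 else 0)"
  proof -
    have "[] \<in> words_upto (2 * L)" by (simp add: words_upto_def reduced_def)
    then show ?thesis by (simp add: sum.delta[OF finite_words_upto])
  qed
  finally show ?thesis .
qed

section \<open>Dyadic atoms and the perturbed operator\<close>

definition atom :: "nat \<Rightarrow> nat \<Rightarrow> nat set \<Rightarrow> real"
  where "atom m a D = (if bin_val m D = a then 1 else 0)"

lemma depends_on_atom: "depends_on {..<m} (atom m a)"
  unfolding atom_def[abs_def] by (rule depends_on_bin_val)

lemma cylinder_atom: "cylinder (atom m a)"
  using depends_on_atom by (intro cylinderI[of "{..<m}"]) auto

lemma cylinder_atoms:
  assumes "cylinder F"
  obtains m H where "F = (\<lambda>D. \<Sum>a<2 ^ m. H a * atom m a D)"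
proof -
  obtain m where "depends_on {..<m} F" using assms by (rule cylinderE)
  then obtain H where H: "\<And>D. F D = H (bin_val m D)" using depends_on_factors by blast
  have "(\<Sum>a<2 ^ m. H a * atom m a D) = (\<Sum>a<2 ^ m. if a = bin_val m D then H a else 0)" for D
    by (intro sum.cong) (auto simp: atom_def)
  then have "F = (\<lambda>D. \<Sum>a<2 ^ m. H a * atom m a D)" by (simp add: H bin_val_less fun_eq_iff)
  then show thesis by (rule that)
qed

text \<open>A functional given by the sign of a good approximation of \<open>z\<close> almost attains the norm of \<open>z\<close>.\<close>

lemma atoms_total:
  assumes z: "\<And>m a. pairing (\<lambda>x. atom m a (digits x)) z = 0"
  shows "z = 0"
proof -
  obtain f where f: "integrable leb01 f" "z = mk f" by (rule L1_cases)
  have all: "pairing (\<lambda>x. F (digits x)) z = 0" if F: "cylinder F" for F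
  proof -
    obtain m H where H: "F = (\<lambda>D. \<Sum>a<2 ^ m. H a * atom m a D)" using F by (rule cylinder_atoms)
    have ia: "integrable leb01 (\<lambda>x. atom m a (digits x) * f x)" for a
      by (rule integrable_bdd_fun[OF cylinder_bdd_fun[OF cylinder_atom] f(1)])
    have "pairing (\<lambda>x. F (digits x)) z = (LINT x|leb01. (\<Sum>a<2 ^ m. H a * (atom m a (digits x) * f x)))"
      unfolding f(2) pairing_mk[OF cylinder_bdd_fun[OF F] f(1)] by (simp add: H sum_distrib_right mult.assoc)
    also have "\<dots> = (\<Sum>a<2 ^ m. H a * (LINT x|leb01. atom m a (digits x) * f x))"
      using ia by (subst Bochner_Integration.integral_sum) auto
    also have "\<dots> = 0" using z f by (simp add: pairing_mk cylinder_bdd_fun cylinder_atom)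
    finally show ?thesis .
  qed
  have "norm z \<le> 0"
  proof (rule field_le_epsilon)
    fix e :: real assume e: "e > 0"
    then obtain F where F: "cylinder F" "norm (z - L1_of F) < e / 2" using L1_of_dense_norm[of "e / 2" z] by auto
    define s where "s D = sgn (F D)" for D
    have cs: "cylinder s" unfolding s_def by (rule cylinder_comp[OF F(1)])
    have "norm (L1_of F) = pairing (\<lambda>x. s (digits x)) (L1_of F)"
      unfolding pairing_L1_of[OF cs F(1)] norm_L1_of[OF F(1)] by (simp add: s_def abs_sgn mult.commute)
    also have "\<dots> = - pairing (\<lambda>x. s (digits x)) (z - L1_of F)" using all[OF cs] by (simp add: blinfun.bilinear_simps)
    also have "\<dots> \<le> norm (pairing (\<lambda>x. s (digits x))) * norm (z - L1_of F)"
      using norm_blinfun[of "pairing (\<lambda>x. s (digits x))" "z - L1_of F"] by (simp add: abs_le_iff)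
    also have "\<dots> \<le> 1 * norm (z - L1_of F)"
      by (intro mult_right_mono norm_pairing_le cylinder_bdd_fun cs) (auto simp: s_def sgn_if)
    finally show "norm z \<le> 0 + e" using F(2) norm_triangle_ineq[of "z - L1_of F" "L1_of F"] by simp
  qed
  then show ?thesis by simp
qed

theorem theorem2:
  shows "\<exists>T :: L1 \<Rightarrow>\<^sub>L L1.
    tauberian T \<and>
    inj (blinfun_apply T) \<and>
    \<not> surj (blinfun_apply T) \<and>
    closure (range (blinfun_apply T)) = UNIV"
proof -
  obtain T :: "L1 \<Rightarrow>\<^sub>L L1" where T: "\<And>F. cylinder F \<Longrightarrow> T (L1_of F) = L1_of (graph_sum F)"
    using graph_operator_exists by blast
  have taub: "tauberian T"
  proof (rule tauberian_criterion[of "1 / 2" "1 / 46656"])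
    show "1 / 2 * norm (proj A x) \<le> norm (T (proj A x))"
      if "A \<in> sets leb01" "measure leb01 A \<le> 1 / 46656" for A x
      by (rule graph_operator_lower_bound[OF T that])
  qed simp_all
  \<comment> \<open>with this choice \<open>sqrt (5 / L n)\<close> is summable\<close>
  define L where "L n = (5 * 4 ^ n :: nat)" for n
  have L: "L n > 0" for n by (simp add: L_def)
  define x where "x n = L1_of (kernel_fun (L n) n)" for n
  define \<phi> where "\<phi> n = pairing (\<lambda>t. rademacher (label_to_nat ([], n)) (digits t))" for n
  define y where "y n = L1_of (rademacher (2 * n + 1))" for n
  define \<psi> where "\<psi> n = pairing (\<lambda>t. rademacher (2 * n + 1) (digits t))" for n
  define u where "u j = (case prod_decode j of (m, a) \<Rightarrow> pairing (\<lambda>t. atom m a (digits t)))" for j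
  define v where "v j = (case prod_decode j of (m, a) \<Rightarrow> L1_of (atom m a))" for j
  have sgn_norm: "norm (pairing (\<lambda>t. rademacher k (digits t))) \<le> 1" for k
    by (rule norm_pairing_le[OF cylinder_bdd_fun[OF cylinder_rademacher]]) (simp add: rademacher_def)
  have "\<exists>K. (\<forall>\<xi>. banach_adjoint (banach_adjoint K) \<xi> \<in> range bidual_embedding) \<and>
    inj (blinfun_apply (T + K)) \<and> \<not> surj (blinfun_apply (T + K)) \<and>
    closure (range (blinfun_apply (T + K))) = UNIV"
  proof (rule injective_dense_range_perturbation[of \<phi> T x y \<psi> u v])
    show "norm (\<phi> n) \<le> 1" for n unfolding \<phi>_def by (rule sgn_norm)
    show "summable (\<lambda>n. norm (T (x n)))"
    proof (rule summable_comparison_test'[of "\<lambda>n. (1/2::real) ^ n"])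
      show "summable (\<lambda>n. (1/2::real) ^ n)" by (rule summable_geometric) simp
      fix n
      have "norm (T (x n)) \<le> sqrt (5 / real (L n))"
        unfolding x_def T[OF cylinder_kernel_fun] by (rule norm_graph_sum_kernel_fun[OF L])
      also have "5 / real (L n) = ((1/2) ^ n)\<^sup>2"
        by (simp add: L_def power_divide power2_eq_square flip: power_mult_distrib)
      finally show "norm (norm (T (x n))) \<le> (1/2) ^ n" by simp
    qed
    show "\<phi> n (x m) = (if n = m then 1 else 0)" for n m
      unfolding \<phi>_def x_def pairing_L1_of[OF cylinder_rademacher cylinder_kernel_fun]
      by (rule mean_root_kernel_fun[OF L])
    show "norm (y n) \<le> 1" for n
    proof -
      have "norm (y n) = mean (\<lambda>D. \<bar>rademacher (2 * n + 1) D\<bar>)" unfolding y_def by (rule norm_L1_of[OF cylinder_rademacher])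
      also have "(\<lambda>D. \<bar>rademacher (2 * n + 1) D\<bar>) = (\<lambda>_. 1)" by (auto simp: rademacher_def)
      finally show ?thesis by (simp add: mean_const)
    qed
    show "\<psi> n (T z) = 0" for n z
    proof -
      have "(\<psi> n o\<^sub>L T) (L1_of F) = 0" if F: "cylinder F" for F
      proof -
        obtain K where K: "finite K" "depends_on K F" using F by (auto simp: cylinder_def)
        have "depends_on (\<Union>c<5. digit_map c ` K) (\<lambda>D. F (digit_map c -` D))" if "c < 5" for c
          by (rule depends_on_mono[OF depends_on_vimage[OF K(2)]]) (use that in auto)
        then have "depends_on (\<Union>c<5. digit_map c ` K) (graph_sum F)"
          unfolding graph_sum_def depends_on_def by (intro allI sum.cong refl) (metis lessThan_iff)
        moreover have "2 * n + 1 \<notin> (\<Union>c<5. digit_map c ` K)"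
          by (auto simp: digit_map_def) presburger
        ultimately have "mean (\<lambda>D. rademacher (2 * n + 1) D * graph_sum F D) = 0"
          using K(1) by (intro mean_rademacher_independent) auto
        then show ?thesis
          by (simp add: T[OF F] \<psi>_def pairing_L1_of[OF cylinder_rademacher cylinder_graph_sum[OF F]])
      qed
      then have "L1_of ` Collect cylinder \<subseteq> {z. (\<psi> n o\<^sub>L T) z = 0}" by blast
      then have "closure (L1_of ` Collect cylinder) \<subseteq> {z. (\<psi> n o\<^sub>L T) z = 0}"
        by (rule closure_minimal) (intro closed_Collect_eq continuous_intros)
      then show ?thesis unfolding L1_of_dense by auto
    qed
    show "\<psi> n (y m) = (if n = m then 1 else 0)" for n m
      unfolding \<psi>_def y_def pairing_L1_of[OF cylinder_rademacher cylinder_rademacher]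
      by (simp add: mean_rademacher_orthonormal)
    show "z = 0" if "\<And>j. u j z = 0" for z
    proof (rule atoms_total)
      show "pairing (\<lambda>t. atom m a (digits t)) z = 0" for m a
        using that[of "prod_encode (m, a)"] by (simp add: u_def)
    qed
    show "finite {n. u j (x n) \<noteq> 0}" for j
    proof -
      obtain m a where j: "prod_decode j = (m, a)" by fastforce
      have "u j (x n) = 0" if n: "n \<notin> snd ` nat_to_label ` {..<m}" for n
      proof -
        have "mean (\<lambda>D. rademacher (label_to_nat (w, n)) D * atom m a D) = 0" if w: "reduced w" for w
        proof (rule mean_rademacher_independent[OF _ depends_on_atom])
          show "label_to_nat (w, n) \<notin> {..<m}"
          proof
            assume "label_to_nat (w, n) \<in> {..<m}"
            then have "snd (nat_to_label (label_to_nat (w, n))) \<in> snd ` nat_to_label ` {..<m}" by blast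
            then show False using n w by (simp add: nat_to_label_label_to_nat labels_def)
          qed
        qed simp
        then have "mean (\<lambda>D. atom m a D * kernel_fun (L n) n D) = 0"
          unfolding mean_kernel_fun[OF cylinder_atom] by (intro sum.neutral) (auto simp: words_upto_def)
        then show ?thesis by (simp add: u_def j x_def pairing_L1_of[OF cylinder_atom cylinder_kernel_fun])
      qed
      then have "{n. u j (x n) \<noteq> 0} \<subseteq> snd ` nat_to_label ` {..<m}" by blast
      then show ?thesis by (rule finite_subset) simp
    qed
    show "closure (span (range v)) = UNIV"
    proof -
      have "L1_of ` Collect cylinder \<subseteq> span (range v)"
      proof clarify
        fix F assume "cylinder F"
        then obtain m H where F: "F = (\<lambda>D. \<Sum>a<2 ^ m. H a * atom m a D)" by (rule cylinder_atoms)
        have "L1_of F = (\<Sum>a<2 ^ m. L1_of (\<lambda>D. H a * atom m a D))"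
          unfolding F by (rule L1_of_sum) (rule cylinder_comp[OF cylinder_atom])
        also have "\<dots> = (\<Sum>a<2 ^ m. H a *\<^sub>R v (prod_encode (m, a)))"
          by (simp add: v_def L1_of_scaleR[OF cylinder_atom])
        also have "\<dots> \<in> span (range v)" by (intro span_sum span_scale span_base) auto
        finally show "L1_of F \<in> span (range v)" .
      qed
      from closure_mono[OF this] show ?thesis unfolding L1_of_dense by blast
    qed
    show "finite {n. \<psi> n (v j) \<noteq> 0}" for j
    proof -
      obtain m a where j: "prod_decode j = (m, a)" by fastforce
      have "\<psi> n (v j) = 0" if "n \<ge> m" for n
        using mean_rademacher_independent[OF _ depends_on_atom, where k = "2 * n + 1" and m1 = m] that
        by (simp add: \<psi>_def v_def j pairing_L1_of[OF cylinder_rademacher cylinder_atom])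
      then have "{n. \<psi> n (v j) \<noteq> 0} \<subseteq> {..<m}" using not_less by blast
      then show ?thesis by (rule finite_subset) simp
    qed
  qed
  then obtain K where "\<forall>\<xi>. banach_adjoint (banach_adjoint K) \<xi> \<in> range bidual_embedding"
    "inj (blinfun_apply (T + K))" "\<not> surj (blinfun_apply (T + K))"
    "closure (range (blinfun_apply (T + K))) = UNIV" by blast
  moreover from this have "tauberian (T + K)" by (intro tauberian_perturbation[OF taub]) blast
  ultimately show ?thesis by blast
qed

end
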